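(* Let $z:(0,\infty)\to[0,\infty)$ be nonincreasing and lower semi-continuous, set $c(\phi)=z(\phi)\phi$ for $\phi>0$, $c(0)=0$, and assume $\int_0^1\sqrt{c(\phi)}\,d\phi<\infty$. Let $\tau^z(w)=\inf\{F^c[\psi]\mid\psi:\mathbb{R}\to[0,\infty),\ \int_{\mathbb{R}}\psi\,dy=w\}$ and let $w>0$ be such that $\tau^z(w)\neq(\tau^z)'(0)\,w$, where $(\tau^z)'(0)$ is the right derivative at $0$. Then the infimum defining $\tau^z(w)$ is attained by a minimizer $\psi\in H^1(\mathbb{R})$ which is nonnegative, bounded, continuous, even, and nonincreasing on $[0,\infty)$.
   Context: For $c:[0,\infty)\to[0,\infty)$ and $\psi:\mathbb{R}\to\mathbb{R}$ (with locally integrable weak derivative; otherwise the energy is $+\infty$), $F^c[\psi]=\int_{\mathbb{R}}\frac12|\psi'(y)|^2+c(|\psi(y)|)\,dy$. *)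

theory Defs
  imports "HOL-Analysis.Analysis"
begin

definition lsc_on :: "real set \<Rightarrow> (real \<Rightarrow> real) \<Rightarrow> bool" where
  "lsc_on S f \<longleftrightarrow> (\<forall>x\<in>S. \<forall>a. a < f x \<longrightarrow> (\<forall>\<^sub>F y in at x within S. a < f y))"

definition cz :: "(real \<Rightarrow> real) \<Rightarrow> real \<Rightarrow> real" where
  "cz z phi = (if phi = 0 then 0 else z phi * phi)"

definition smooth_fun :: "(real \<Rightarrow> real) \<Rightarrow> bool" where
  "smooth_fun phi \<longleftrightarrow> (\<forall>n x. ((deriv ^^ n) phi) differentiable (at x))"

definition test_fun :: "(real \<Rightarrow> real) \<Rightarrow> bool" where
  "test_fun phi \<longleftrightarrow> smooth_fun phi \<and> (\<exists>R. \<forall>y. R < \<bar>y\<bar> \<longrightarrow> phi y = 0)"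

definition loc_integrable :: "(real \<Rightarrow> real) \<Rightarrow> bool" where
  "loc_integrable f \<longleftrightarrow> (\<forall>a b. set_integrable lborel {a..b} f)"

definition weak_deriv :: "(real \<Rightarrow> real) \<Rightarrow> (real \<Rightarrow> real) \<Rightarrow> bool" where
  "weak_deriv psi g \<longleftrightarrow> loc_integrable psi \<and> loc_integrable g \<and>
     (\<forall>phi. test_fun phi \<longrightarrow>
        (LINT y|lborel. psi y * deriv phi y) = - (LINT y|lborel. g y * phi y))"

definition energy :: "(real \<Rightarrow> real) \<Rightarrow> (real \<Rightarrow> real) \<Rightarrow> ennreal" where
  "energy c psi = (if \<exists>g. weak_deriv psi g then
      (let g = (SOME g. weak_deriv psi g) in
        \<integral>\<^sup>+ y. ennreal ((g y)\<^sup>2 / 2 + c \<bar>psi y\<bar>) \<partial>lborel)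
    else \<infinity>)"

definition tau :: "(real \<Rightarrow> real) \<Rightarrow> real \<Rightarrow> ennreal" where
  "tau z w = (INF psi \<in> {psi. (\<forall>y. 0 \<le> psi y) \<and> integrable lborel psi
                   \<and> (LINT y|lborel. psi y) = w}. energy (cz z) psi)"

definition H1 :: "(real \<Rightarrow> real) \<Rightarrow> bool" where
  "H1 psi \<longleftrightarrow> psi \<in> borel_measurable lborel \<and> integrable lborel (\<lambda>y. (psi y)\<^sup>2) \<and>
     (\<exists>g. weak_deriv psi g \<and> g \<in> borel_measurable lborel \<and> integrable lborel (\<lambda>y. (g y)\<^sup>2))"

end

theory Submission
  imports Defs "HOL-Computational_Algebra.Polynomial"
begin

text \<open>
  Among profiles of maximal height \<open>h\<close> the problem is convex in the speed at which the width of the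
  superlevel sets changes, and it is solved by duality. Put \<open>f\<^sub>\<mu> s = sqrt (2 s (z s - \<mu>))\<close>. For
  \<open>\<mu> < z h\<close> the pointwise bound \<open>g\<^sup>2/2 + z(\<psi>) \<psi> - \<mu> \<psi> \<ge> \<bar>g\<bar> f\<^sub>\<mu>(\<psi>)\<close> and a coarea inequality on
  both flanks give \<open>F[\<psi>] \<ge> \<mu> w + 2 \<integral>\<^sub>0\<^sup>h f\<^sub>\<mu>\<close> for every competitor of mass \<open>w\<close> and height \<open>h\<close>.
  Equality holds for the even profile descending with speed \<open>f\<^sub>\<mu>(\<psi>)\<close> when \<open>\<mu> \<le> z h\<close> is chosen so
  that its mass is \<open>w\<close>; if even \<open>\<mu> = z h\<close> leaves too little mass, the rest is put into a plateau at
  height \<open>h\<close>, which costs exactly \<open>\<mu>\<close> per unit of mass.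

  What remains is a minimization over the height alone. The kinetic energy bounds the height from
  above. The right derivative of \<open>\<tau>\<close> at \<open>0\<close> is the limit of \<open>z\<close> at \<open>0\<close>, so \<open>\<tau>(w) \<noteq> \<tau>'(0) w\<close>
  yields \<open>h\<^sub>0\<close> with \<open>\<tau>(w) < z(h\<^sub>0) w\<close>, and competitors of height at most \<open>h\<^sub>0\<close> are too expensive.
  Lower semicontinuity of \<open>z\<close> lets the dual bounds pass to a limit of the heights of a minimizing
  sequence, and the optimal profile at the limit height is a minimizer.
\<close>

section \<open>Smooth bumps\<close>

text \<open>Mass may escape to infinity along a minimizing sequence, and \<open>z\<close> may be
  unbounded near 0. Compactness is therefore used only for the heights, which are real numbers;
  functions are never passed to a limit but rebuilt from the limit height. Since \<open>z\<close> is
  merely monotone and lower semicontinuous, the equation prescribing the speed of descent is not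
  treated as an ODE. The profile is the inverse of its level-to-width function, and integrals along
  it are computed by pushing Lebesgue measure forward to the levels; continuity and the weak
  derivative come out of the same computation. Competitors are differentiable only in the sense of
  test functions, whereas coarea arguments follow level crossings. Hence the passage to a
  representative that is the integral of its weak derivative, which rests on the du Bois-Reymond
  lemma and a supply of smooth bumps. The multiplier can be negative, as for a tall profile of small
  mass, so signs need care wherever reals enter \<open>ennreal\<close>.\<close>

lemma smooth_fun_coinduct:
  assumes S: "\<And>f x. f \<in> S \<Longrightarrow> f differentiable (at (x::real))"
    and S': "\<And>f. f \<in> S \<Longrightarrow> deriv f \<in> S"
    and f: "f \<in> S"
  shows "smooth_fun f"
proof -
  have "(deriv ^^ n) f \<in> S" for n
    by (induction n) (auto simp: f S')
  then show ?thesis using S by (auto simp: smooth_fun_def)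
qed

lemma smooth_fun_differentiable: "smooth_fun f \<Longrightarrow> f differentiable (at x)"
  unfolding smooth_fun_def by (metis funpow_0)

lemma smooth_fun_deriv: "smooth_fun f \<Longrightarrow> smooth_fun (deriv f)"
  unfolding smooth_fun_def by (metis funpow_Suc_right o_apply)

lemma smooth_fun_DERIV: "smooth_fun f \<Longrightarrow> (f has_real_derivative deriv f x) (at x)"
  using smooth_fun_differentiable real_differentiable_def DERIV_deriv_iff_real_differentiable by blast

lemma smooth_fun_continuous: "smooth_fun f \<Longrightarrow> continuous_on A f"
  by (meson DERIV_continuous_on DERIV_subset subset_UNIV smooth_fun_DERIV)

lemma smooth_fun_if_deriv:
  assumes "\<And>x. (f has_real_derivative g x) (at x)" "smooth_fun g"
  shows "smooth_fun f"
proof -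
  have d: "deriv f = g" using assms(1) DERIV_imp_deriv by blast
  have "(deriv ^^ n) f differentiable (at x)" for n x
  proof (cases n)
    case 0
    then show ?thesis using assms(1) real_differentiable_def by auto
  next
    case (Suc m)
    then show ?thesis using assms(2) unfolding Suc funpow_Suc_right by (simp add: d smooth_fun_def)
  qed
  then show ?thesis by (simp add: smooth_fun_def)
qed

lemma smooth_fun_add:
  assumes "smooth_fun f" "smooth_fun g" shows "smooth_fun (\<lambda>x. f x + g x)"
proof (rule smooth_fun_coinduct[where S="{\<lambda>x. f x + g x |f g. smooth_fun f \<and> smooth_fun g}"])
  fix h x assume "h \<in> {\<lambda>x. f x + g x |f g. smooth_fun f \<and> smooth_fun g}"
  then obtain f g where h: "h = (\<lambda>x. f x + g x)" "smooth_fun f" "smooth_fun g" by blast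
  have D: "(h has_real_derivative deriv f x + deriv g x) (at x)" for x
    unfolding h(1) using h(2,3) by (auto intro!: derivative_eq_intros smooth_fun_DERIV)
  show "h differentiable (at x)" using D real_differentiable_def by blast
  have "deriv h = (\<lambda>x. deriv f x + deriv g x)" using D DERIV_imp_deriv by blast
  then show "deriv h \<in> {\<lambda>x. f x + g x |f g. smooth_fun f \<and> smooth_fun g}"
    using h smooth_fun_deriv by blast
qed (use assms in auto)

text \<open>The Leibniz rule turns a product into a sum of products, so products alone are not an
  invariant for \<open>smooth_fun_coinduct\<close>; their closure under sums is.\<close>

inductive_set sums_of_smooth_products :: "(real \<Rightarrow> real) set" where
  prod: "smooth_fun f \<Longrightarrow> smooth_fun g \<Longrightarrow> (\<lambda>x. f x * g x) \<in> sums_of_smooth_products"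
| sum: "f \<in> sums_of_smooth_products \<Longrightarrow> g \<in> sums_of_smooth_products
    \<Longrightarrow> (\<lambda>x. f x + g x) \<in> sums_of_smooth_products"

lemma sums_of_smooth_products_deriv:
  assumes "f \<in> sums_of_smooth_products"
  shows "\<exists>g\<in>sums_of_smooth_products. \<forall>x. (f has_real_derivative g x) (at x)"
  using assms
proof induction
  case (prod f g)
  let ?d = "\<lambda>x. deriv f x * g x + f x * deriv g x"
  have "?d \<in> sums_of_smooth_products"
    by (intro sums_of_smooth_products.intros prod smooth_fun_deriv)
  moreover have "((\<lambda>x. f x * g x) has_real_derivative ?d x) (at x)" for x
    using prod by (auto intro!: derivative_eq_intros smooth_fun_DERIV)
  ultimately show ?case by (intro bexI[of _ ?d]) auto
next
  case (sum f g)
  then obtain f' g' where "f' \<in> sums_of_smooth_products" "g' \<in> sums_of_smooth_products"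
    "\<And>x. (f has_real_derivative f' x) (at x)" "\<And>x. (g has_real_derivative g' x) (at x)" by blast
  then show ?case
    by (intro bexI[of _ "\<lambda>x. f' x + g' x"])
       (auto intro!: derivative_eq_intros sums_of_smooth_products.intros)
qed

lemma smooth_fun_mult:
  assumes "smooth_fun f" "smooth_fun g" shows "smooth_fun (\<lambda>x. f x * g x)"
proof (rule smooth_fun_coinduct[where S=sums_of_smooth_products])
  fix h x assume h: "h \<in> sums_of_smooth_products"
  then obtain h' where h': "h' \<in> sums_of_smooth_products" "\<And>x. (h has_real_derivative h' x) (at x)"
    using sums_of_smooth_products_deriv by blast
  then show "h differentiable (at x)" using real_differentiable_def by blast
  show "deriv h \<in> sums_of_smooth_products" using h' DERIV_imp_deriv by (metis ext)
qed (use assms in \<open>auto intro: sums_of_smooth_products.intros\<close>)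

lemma smooth_fun_const: "smooth_fun (\<lambda>x. k)"
  by (rule smooth_fun_coinduct[where S="range (\<lambda>k x. k)"]) auto

lemma smooth_fun_affine:
  assumes "smooth_fun f" shows "smooth_fun (\<lambda>x. f (a * x + b))"
\<comment> \<open>Each derivative produces a factor \<open>a\<close> by the chain rule; the free
  scalar \<open>k\<close> absorbs it.\<close>
proof (rule smooth_fun_coinduct[where S="{\<lambda>x. k * f (a * x + b) |f k. smooth_fun f}"])
  fix h x assume "h \<in> {\<lambda>x. k * f (a * x + b) |f k. smooth_fun f}"
  then obtain f k where h: "h = (\<lambda>x. k * f (a * x + b))" "smooth_fun f" by blast
  have D: "(h has_real_derivative (k * a) * deriv f (a * x + b)) (at x)" for x
    unfolding h(1) by (auto intro!: derivative_eq_intros DERIV_chain2[OF smooth_fun_DERIV[OF h(2)]])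
  show "h differentiable (at x)" using D real_differentiable_def by blast
  have "deriv h = (\<lambda>x. (k * a) * deriv f (a * x + b))" using D DERIV_imp_deriv by blast
  then show "deriv h \<in> {\<lambda>x. k * f (a * x + b) |f k. smooth_fun f}"
    using h smooth_fun_deriv by blast
next
  show "(\<lambda>x. f (a * x + b)) \<in> {\<lambda>x. k * f (a * x + b) |f k. smooth_fun f}"
    using assms by (intro CollectI exI[of _ f] exI[of _ 1]) auto
qed

section \<open>Flat functions and compactly supported bumps\<close>

definition flat_exp :: "real poly \<Rightarrow> real \<Rightarrow> real" where
  "flat_exp p x = (if x > 0 then poly p (1 / x) * exp (- (1 / x)) else 0)"

lemma poly_times_exp_neg_tendsto_0: "((\<lambda>t::real. poly p t * exp (- t)) \<longlongrightarrow> 0) at_top"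
proof -
  have "((\<lambda>t::real. \<Sum>i\<le>degree p. coeff p i * (t ^ i / exp t)) \<longlongrightarrow> (\<Sum>i\<le>degree p. coeff p i * 0)) at_top"
    by (intro tendsto_sum tendsto_mult tendsto_const tendsto_power_div_exp_0)
  moreover have "(\<lambda>t::real. \<Sum>i\<le>degree p. coeff p i * (t ^ i / exp t)) = (\<lambda>t. poly p t * exp (- t))"
    by (simp add: poly_altdef sum_distrib_right exp_minus divide_inverse mult.assoc)
  ultimately show ?thesis by simp
qed

text \<open>With t = 1/x, differentiating p(t) exp(-t) gives t^2 (p(t) - p'(t)) exp(-t), so the
  family indexed by polynomials is closed under \<open>deriv\<close>. This closure is why
  \<open>flat_exp\<close> carries a polynomial, although the bumps start from
  \<open>p = 1\<close>.\<close>

lemma flat_exp_has_derivative: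
  "(flat_exp p has_real_derivative flat_exp ((p - pderiv p) * [:0,0,1:]) x) (at x)"
proof -
  consider "x > 0" | "x < 0" | "x = 0" by linarith
  then show ?thesis
  proof cases
    case 1
    have "((\<lambda>x. poly p (1 / x) * exp (- (1 / x))) has_real_derivative
        flat_exp ((p - pderiv p) * [:0,0,1:]) x) (at x)"
      using 1 by (auto intro!: derivative_eq_intros DERIV_chain2[OF poly_DERIV]
          simp: flat_exp_def field_simps power2_eq_square)
    then show ?thesis
      by (rule has_field_derivative_transform_within_open[where S="{0<..}"])
         (use 1 in \<open>auto simp: flat_exp_def\<close>)
  next
    case 2
    have "((\<lambda>x. 0) has_real_derivative flat_exp ((p - pderiv p) * [:0,0,1:]) x) (at x)"
      using 2 by (auto simp: flat_exp_def)
    then show ?thesis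
      by (rule has_field_derivative_transform_within_open[where S="{..<0}"])
         (use 2 in \<open>auto simp: flat_exp_def\<close>)
  next
    case 3
    \<comment> \<open>From the right the difference quotient is again a polynomial in 1/y times
      exp(-1/y); the substitution t = 1/y turns its limit into one at infinity.\<close>
    have r: "((\<lambda>y. (flat_exp p y - flat_exp p 0) / (y - 0)) \<longlongrightarrow> 0) (at_right 0)"
    proof -
      have "((\<lambda>y::real. poly (p * [:0,1:]) (inverse y) * exp (- inverse y)) \<longlongrightarrow> 0) (at_right 0)"
        using filterlim_compose[OF poly_times_exp_neg_tendsto_0 filterlim_inverse_at_top_right] .
      then show ?thesis
        by (rule Lim_transform_eventually)
           (auto simp: eventually_at_right_field flat_exp_def field_simps intro!: exI[of _ 1])
    qed
    have l: "((\<lambda>y. (flat_exp p y - flat_exp p 0) / (y - 0)) \<longlongrightarrow> 0) (at_left 0)"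
      by (rule Lim_transform_eventually[OF tendsto_const])
         (auto simp: eventually_at_left_field flat_exp_def intro!: exI[of _ "-1"])
    from filterlim_split_at[OF l r] show ?thesis
      unfolding has_field_derivative_iff 3 by (simp add: flat_exp_def)
  qed
qed

lemma smooth_fun_flat_exp: "smooth_fun (flat_exp p)"
proof (rule smooth_fun_coinduct[where S="range flat_exp"])
  fix h x assume "h \<in> range flat_exp"
  then obtain p where h: "h = flat_exp p" by blast
  show "h differentiable (at x)" using h flat_exp_has_derivative real_differentiable_def by blast
  have "deriv h = flat_exp ((p - pderiv p) * [:0,0,1:])"
    unfolding h using flat_exp_has_derivative DERIV_imp_deriv by blast
  then show "deriv h \<in> range flat_exp" by blast
qed auto

text \<open>The factor \<open>k\<close> scales both arguments, so the exponent is of order 1/k and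
  the bump rises to the indicator of the open interval as \<open>k\<close> grows. In this way test
  functions reach intervals.\<close>

definition bump :: "real \<Rightarrow> real \<Rightarrow> real \<Rightarrow> real \<Rightarrow> real" where
  "bump k a b x = flat_exp 1 (k * x + - (k * a)) * flat_exp 1 (- k * x + k * b)"

lemma bump_eq:
  assumes "k > 0"
  shows "bump k a b x = (if a < x \<and> x < b then exp (- (1 / (k * (x - a))) - 1 / (k * (b - x))) else 0)"
proof -
  have "k * x + - (k * a) > 0 \<longleftrightarrow> a < x" "- k * x + k * b > 0 \<longleftrightarrow> x < b" using assms by auto
  then show ?thesis unfolding bump_def flat_exp_def
    by (auto simp: exp_diff exp_minus field_simps exp_add[symmetric] right_diff_distrib)
qed

lemma smooth_fun_bump: "smooth_fun (bump k a b)"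
  unfolding bump_def by (intro smooth_fun_mult smooth_fun_affine smooth_fun_flat_exp)

lemma test_fun_bump: assumes "k > 0" shows "test_fun (bump k a b)"
  unfolding test_fun_def using assms
  by (auto simp: smooth_fun_bump bump_eq intro!: exI[of _ "max \<bar>a\<bar> \<bar>b\<bar>"])

lemma bump_bounds: assumes "k > 0" shows "0 \<le> bump k a b x" "bump k a b x \<le> indicator {a<..<b} x"
proof -
  have "- (1 / (k * (x - a))) - 1 / (k * (b - x)) \<le> 0" if "a < x" "x < b"
    using that assms by (smt (verit) divide_nonneg_nonneg mult_nonneg_nonneg)
  then show "0 \<le> bump k a b x" "bump k a b x \<le> indicator {a<..<b} x"
    by (auto simp: bump_eq[OF assms])
qed

lemma bump_tendsto_indicator: "(\<lambda>n. bump (real (Suc n)) a b x) \<longlonglongrightarrow> indicator {a<..<b} x"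
proof (cases "a < x \<and> x < b")
  case True
  have r: "(\<lambda>n. 1 / (real (Suc n) * c)) \<longlonglongrightarrow> 0" for c
    using tendsto_mult[OF LIMSEQ_inverse_real_of_nat tendsto_const[of "1/c"]]
    by (simp add: divide_simps)
  have "(\<lambda>n. exp (- (1 / (real (Suc n) * (x - a))) - 1 / (real (Suc n) * (b - x)))) \<longlonglongrightarrow> exp (- 0 - 0)"
    by (intro tendsto_exp tendsto_diff tendsto_minus r)
  then show ?thesis using True by (simp add: bump_eq)
next
  case False
  then show ?thesis by (auto simp: bump_eq)
qed

section \<open>Weak derivatives and primitives on the line\<close>

lemma loc_integrable_measurable:
  assumes "loc_integrable g" shows "g \<in> borel_measurable borel"
proof -
  have m: "(\<lambda>x. indicator {- real n..real n} x *\<^sub>R g x) \<in> borel_measurable borel" for n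
    using assms unfolding loc_integrable_def set_integrable_def
    by (metis borel_measurable_integrable measurable_lborel2)
  have l: "(\<lambda>n. indicator {- real n..real n} x *\<^sub>R g x) \<longlonglongrightarrow> g x" for x
  proof (rule tendsto_eventually)
    obtain N :: nat where "\<bar>x\<bar> \<le> N" using real_arch_simple by blast
    then show "\<forall>\<^sub>F n in sequentially. indicator {- real n..real n} x *\<^sub>R g x = g x"
      by (auto simp: eventually_sequentially indicator_def abs_le_iff intro!: exI[of _ N])
  qed
  show ?thesis by (rule borel_measurable_LIMSEQ_metric[OF m l])
qed

lemma loc_integrable_diff:
  assumes "loc_integrable f" "loc_integrable g" shows "loc_integrable (\<lambda>x. f x - g x)"
  using assms unfolding loc_integrable_def by (auto intro: set_integral_diff)

lemma loc_integrable_continuous: "continuous_on UNIV f \<Longrightarrow> loc_integrable f"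
  unfolding loc_integrable_def
  by (auto intro!: borel_integrable_atLeastAtMost' elim: continuous_on_subset)

lemma loc_integrable_times_bounded:
  assumes g: "loc_integrable g" and h[measurable]: "h \<in> borel_measurable borel"
    and B: "\<And>y. \<bar>h y\<bar> \<le> B" and R: "\<And>y. R < \<bar>y\<bar> \<Longrightarrow> h y = 0"
  shows "integrable lborel (\<lambda>y. g y * h y)"
proof -
  note [measurable] = loc_integrable_measurable[OF g]
  have "integrable lborel (\<lambda>y. B * \<bar>indicator {-R..R} y *\<^sub>R g y\<bar>)"
    using g unfolding loc_integrable_def set_integrable_def by auto
  then show ?thesis
  proof (rule Bochner_Integration.integrable_bound)
    have "0 \<le> B" using B abs_ge_zero order_trans by blast
    have "\<bar>g y * h y\<bar> \<le> B * \<bar>indicator {-R..R} y *\<^sub>R g y\<bar>" for y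
    proof (cases "R < \<bar>y\<bar>")
      case False
      then have "y \<in> {-R..R}" by auto
      then show ?thesis using mult_right_mono[OF B[of y], of "\<bar>g y\<bar>"] by (simp add: abs_mult mult.commute)
    qed (use R \<open>0 \<le> B\<close> in auto)
    then show "AE x in lborel. norm (g x * h x) \<le> norm (B * \<bar>indicator {-R..R} x *\<^sub>R g x\<bar>)"
      using \<open>0 \<le> B\<close> by (auto simp: abs_mult)
  qed simp
qed

lemma continuous_compact_support_bounded:
  fixes f :: "real \<Rightarrow> real"
  assumes "continuous_on UNIV f" and R: "\<And>y. R < \<bar>y\<bar> \<Longrightarrow> f y = 0"
  obtains B where "\<And>y. \<bar>f y\<bar> \<le> B"
proof -
  have "bounded (f ` {-R..R})"
    using assms(1) by (intro compact_imp_bounded compact_continuous_image) (auto elim: continuous_on_subset)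
  then obtain B where B: "\<And>y. y \<in> {-R..R} \<Longrightarrow> \<bar>f y\<bar> \<le> B" unfolding bounded_iff by fastforce
  have "\<bar>f y\<bar> \<le> max B 0" for y
  proof (cases "R < \<bar>y\<bar>")
    case False
    then have "y \<in> {-R..R}" by auto
    then show ?thesis using B[of y] by simp
  qed (use R in auto)
  then show thesis using that by blast
qed

lemma loc_integrable_times_continuous:
  assumes g: "loc_integrable g" and h: "continuous_on UNIV h" and R: "\<And>y. R < \<bar>y\<bar> \<Longrightarrow> h y = 0"
  shows "integrable lborel (\<lambda>y. g y * h y)"
proof -
  obtain B where "\<And>y. \<bar>h y\<bar> \<le> B" using continuous_compact_support_bounded[OF h R] by blast
  then show ?thesis using assms by (intro loc_integrable_times_bounded borel_measurable_continuous_onI) auto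
qed

lemma deriv_support:
  fixes f :: "real \<Rightarrow> real"
  assumes R: "\<And>y. R < \<bar>y\<bar> \<Longrightarrow> f y = 0" and y: "R < \<bar>y\<bar>"
  shows "deriv f y = 0"
proof -
  have "open {y::real. R < \<bar>y\<bar>}" by (intro open_Collect_less continuous_intros)
  then have "(f has_real_derivative 0) (at y)"
    using has_field_derivative_transform_within_open[OF DERIV_const[of 0], of "{y. R < \<bar>y\<bar>}" y f] R y by auto
  then show ?thesis by (rule DERIV_imp_deriv)
qed

lemma test_funE:
  assumes "test_fun \<phi>"
  obtains R where "R > 0" "\<And>y. R < \<bar>y\<bar> \<Longrightarrow> \<phi> y = 0" "\<And>y. R < \<bar>y\<bar> \<Longrightarrow> deriv \<phi> y = 0"
proof -
  obtain R where R: "\<And>y. R < \<bar>y\<bar> \<Longrightarrow> \<phi> y = 0" using assms unfolding test_fun_def by blast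
  show thesis by (rule that[of "\<bar>R\<bar> + 1"]) (use R deriv_support[of R \<phi>, OF R] in auto)
qed

text \<open>The positive and negative parts of \<open>u\<close>, cut off to a bounded interval, are
  densities of two finite measures. Vanishing interval integrals make these agree on half-lines,
  hence everywhere, so the two parts coincide almost everywhere; this is possible only where
  \<open>u\<close> is 0.\<close>

lemma AE_zero_if_interval_integrals_zero:
  assumes u: "loc_integrable u" and 0: "\<And>a b. a < b \<Longrightarrow> (LINT y:{a<..<b}|lborel. u y) = 0"
  shows "AE y in lborel. u y = 0"
proof -
  note [measurable] = loc_integrable_measurable[OF u]
  have *: "AE y in lborel. indicator {- real n<..<real n} y * u y = 0" for n
  proof -
    define v where "v y = indicator {- real n<..<real n} y * u y" for y
    have v: "integrable lborel v"
      using set_integrable_subset[OF u[unfolded loc_integrable_def, rule_format, of "- real n" "real n"],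
          of "{- real n<..<real n}"]
      unfolding v_def set_integrable_def by (auto simp: subset_eq)
    have [measurable]: "v \<in> borel_measurable borel" using v by auto
    define M where "M = density lborel (\<lambda>y. ennreal (max (v y) 0))"
    define N where "N = density lborel (\<lambda>y. ennreal (max (- v y) 0))"
    have eM: "emeasure M A = ennreal (LINT y:A|lborel. max (v y) 0)"
      and eN: "emeasure N A = ennreal (LINT y:A|lborel. max (- v y) 0)" if [measurable]: "A \<in> sets borel" for A
    proof -
      have i: "integrable lborel (\<lambda>y. indicator A y *\<^sub>R max (v y) 0)"
        "integrable lborel (\<lambda>y. indicator A y *\<^sub>R max (- v y) 0)"
        using v by (intro integrable_mult_indicator Bochner_Integration.integrable_max integrable_zero
            Bochner_Integration.integrable_minus; simp)+
      have "emeasure M A = (\<integral>\<^sup>+y. ennreal (indicator A y *\<^sub>R max (v y) 0) \<partial>lborel)"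
        unfolding M_def by (subst emeasure_density) (auto intro!: nn_integral_cong split: split_indicator)
      then show "emeasure M A = ennreal (LINT y:A|lborel. max (v y) 0)"
        unfolding set_lebesgue_integral_def by (subst nn_integral_eq_integral[OF i(1), symmetric]) auto
      have "emeasure N A = (\<integral>\<^sup>+y. ennreal (indicator A y *\<^sub>R max (- v y) 0) \<partial>lborel)"
        unfolding N_def by (subst emeasure_density) (auto intro!: nn_integral_cong split: split_indicator)
      then show "emeasure N A = ennreal (LINT y:A|lborel. max (- v y) 0)"
        unfolding set_lebesgue_integral_def by (subst nn_integral_eq_integral[OF i(2), symmetric]) auto
    qed
    have z: "(LINT y:{x<..}|lborel. max (v y) 0) = (LINT y:{x<..}|lborel. max (- v y) 0)" for x
    proof -
      have i: "integrable lborel (\<lambda>y. indicator {x<..} y *\<^sub>R max (v y) 0)"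
        "integrable lborel (\<lambda>y. indicator {x<..} y *\<^sub>R max (- v y) 0)"
        using v by (intro integrable_mult_indicator Bochner_Integration.integrable_max integrable_zero
            Bochner_Integration.integrable_minus; simp)+
      have "(LINT y:{x<..}|lborel. max (v y) 0) - (LINT y:{x<..}|lborel. max (- v y) 0)
        = (LINT y|lborel. indicator {x<..} y *\<^sub>R max (v y) 0 - indicator {x<..} y *\<^sub>R max (- v y) 0)"
        unfolding set_lebesgue_integral_def using i by simp
      also have "\<dots> = (LINT y:{max x (- real n)<..<real n}|lborel. u y)"
        unfolding set_lebesgue_integral_def v_def
        by (intro Bochner_Integration.integral_cong) (auto split: split_indicator)
      also have "\<dots> = 0"
        using 0[of "max x (- real n)" "real n"]
        by (cases "max x (- real n) < real n") (auto simp: set_lebesgue_integral_def)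
      finally show ?thesis by simp
    qed
    have "M = N"
      by (rule measure_eqI_lessThan) (auto simp: eM eN z, auto simp: M_def N_def)
    then have "AE y in lborel. ennreal (max (v y) 0) = ennreal (max (- v y) 0)"
      unfolding M_def N_def by (subst (asm) sigma_finite_measure.density_unique_iff[OF sigma_finite_lborel]) auto
    then have "AE y in lborel. v y = 0"
    proof eventually_elim
      case (elim y)
      then have "max (v y) 0 = max (- v y) 0" by (metis ennreal_inj max.cobounded2)
      then show ?case by (auto simp: max_def split: if_splits)
    qed
    then show ?thesis unfolding v_def .
  qed
  have "AE y in lborel. \<forall>n. indicator {- real n<..<real n} y * u y = 0"
    using * by (subst AE_all_countable) auto
  then show ?thesis
  proof eventually_elim
    case (elim y)
    obtain n :: nat where "\<bar>y\<bar> < n" using reals_Archimedean2 by blast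
    then show ?case using elim[rule_format, of n] by (auto simp: indicator_def split: if_splits)
  qed
qed

lemma fundamental_lemma_variations:
  assumes u: "loc_integrable u" and 0: "\<And>\<eta>. test_fun \<eta> \<Longrightarrow> (LINT y|lborel. u y * \<eta> y) = 0"
  shows "AE y in lborel. u y = 0"
proof (rule AE_zero_if_interval_integrals_zero[OF u])
  fix a b :: real assume "a < b"
  note [measurable] = loc_integrable_measurable[OF u]
  have [measurable]: "bump k a b \<in> borel_measurable borel" for k
    by (intro borel_measurable_continuous_onI smooth_fun_continuous smooth_fun_bump)
  \<comment> \<open>Bumps converge to the indicator of the interval and are dominated by it, so
    integrals against test functions determine integrals over intervals.\<close>
  have "(\<lambda>n. LINT y|lborel. u y * bump (real (Suc n)) a b y) \<longlonglongrightarrow> (LINT y|lborel. u y * indicator {a<..<b} y)"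
  proof (rule integral_dominated_convergence[where w="\<lambda>y. \<bar>indicator {a..b} y *\<^sub>R u y\<bar>"])
    show "integrable lborel (\<lambda>y. \<bar>indicator {a..b} y *\<^sub>R u y\<bar>)"
      using u unfolding loc_integrable_def set_integrable_def by auto
    show "AE x in lborel. (\<lambda>n. u x * bump (real (Suc n)) a b x) \<longlonglongrightarrow> u x * indicator {a<..<b} x"
      by (intro AE_I2 tendsto_mult tendsto_const bump_tendsto_indicator)
    fix n
    have "\<bar>u x * bump (real (Suc n)) a b x\<bar> \<le> \<bar>indicator {a..b} x *\<^sub>R u x\<bar>" for x
    proof (cases "x \<in> {a<..<b}")
      case True
      then show ?thesis using bump_bounds[of "real (Suc n)" a b x]
        by (simp add: abs_mult mult_left_le)
    next
      case False
      then show ?thesis using bump_bounds[of "real (Suc n)" a b x] by simp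
    qed
    then show "AE x in lborel. norm (u x * bump (real (Suc n)) a b x) \<le> \<bar>indicator {a..b} x *\<^sub>R u x\<bar>"
      by auto
  qed auto
  then have "(LINT y|lborel. u y * indicator {a<..<b} y) = 0"
    using 0 test_fun_bump by (simp add: LIMSEQ_const_iff)
  then show "(LINT y:{a<..<b}|lborel. u y) = 0" by (simp add: set_lebesgue_integral_def mult.commute)
qed

text \<open>Integrating from the left of the support gives 0 further left and, by the zero mean, 0
  to the right of it, so the primitive has compact support too. Every test function of mean 0 may
  thus be used as \<open>deriv \<phi>\<close>.\<close>

lemma test_fun_primitive:
  assumes \<zeta>: "test_fun \<zeta>" and 0: "(LINT y|lborel. \<zeta> y) = 0"
  obtains \<phi> where "test_fun \<phi>" "deriv \<phi> = \<zeta>"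
proof -
  obtain R where R: "R > 0" "\<And>y. R < \<bar>y\<bar> \<Longrightarrow> \<zeta> y = 0" using test_funE[OF \<zeta>] by metis
  have s: "smooth_fun \<zeta>" using \<zeta> test_fun_def by blast
  have c: "continuous_on A \<zeta>" for A using smooth_fun_continuous[OF s] .
  define \<phi> where "\<phi> x = (LBINT t=ereal (-R)..ereal x. \<zeta> t)" for x
  have D: "(\<phi> has_real_derivative \<zeta> x) (at x)" for x
  proof -
    have x: "x \<in> {- \<bar>x\<bar> - R - 1<..<\<bar>x\<bar> + R + 1}" using R by auto
    have "(\<phi> has_vector_derivative \<zeta> x) (at x within {- \<bar>x\<bar> - R - 1..\<bar>x\<bar> + R + 1})"
      unfolding \<phi>_def using R by (intro interval_integral_FTC2 c) auto
    then show ?thesis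
      using x at_within_Icc_at[of "- \<bar>x\<bar> - R - 1" x "\<bar>x\<bar> + R + 1"]
      by (simp add: has_real_derivative_iff_has_vector_derivative)
  qed
  have 1: "\<phi> x = 0" if "R < \<bar>x\<bar>" for x
  proof (cases "x > 0")
    case True
    then have "x > R" using that by linarith
    have "\<phi> x = (LINT y|lborel. \<zeta> y)"
    proof -
      have "\<phi> x = (LINT y:{-R..x}|lborel. \<zeta> y)"
        unfolding \<phi>_def using \<open>x > R\<close> R(1) by (subst interval_integral_Icc) simp_all
      also have "\<dots> = (LINT y|lborel. \<zeta> y)"
        unfolding set_lebesgue_integral_def
      proof (rule Bochner_Integration.integral_cong[OF refl])
        fix y
        show "indicator {-R..x} y *\<^sub>R \<zeta> y = \<zeta> y"
          using R(2)[of y] \<open>x > R\<close> by (cases "y \<in> {-R..x}") force+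
      qed
      finally show ?thesis .
    qed
    then show ?thesis using 0 by simp
  next
    case False
    then have "x < -R" using that by linarith
    have "\<phi> x = - (LBINT y=ereal x..ereal (-R). \<zeta> y)" unfolding \<phi>_def
      by (rule interval_integral_endpoints_reverse)
    also have "(LBINT y=ereal x..ereal (-R). \<zeta> y) = (LINT y:{x<..<-R}|lborel. \<zeta> y)"
      using \<open>x < -R\<close> by (subst interval_integral_Ioo) auto
    also have "\<dots> = 0"
      unfolding set_lebesgue_integral_def
    proof (intro integral_eq_zero_AE AE_I2)
      fix y
      show "indicator {x<..<-R} y *\<^sub>R \<zeta> y = 0"
        using R(2)[of y] by (cases "y \<in> {x<..<-R}") force+
    qed
    finally show ?thesis by simp
  qed
  show thesis
  proof (rule that)
    show "test_fun \<phi>" using smooth_fun_if_deriv[OF D s] 1 unfolding test_fun_def by blast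
    show "deriv \<phi> = \<zeta>" using D DERIV_imp_deriv by blast
  qed
qed

text \<open>An arbitrary test function becomes a derivative once a multiple of a fixed bump is
  subtracted that carries its mean. The correction accounts for the constant, which is the average
  of \<open>u\<close> weighted by the bump.\<close>

lemma du_Bois_Reymond:
  assumes u: "loc_integrable u" and 0: "\<And>\<phi>. test_fun \<phi> \<Longrightarrow> (LINT y|lborel. u y * deriv \<phi> y) = 0"
  shows "\<exists>C. AE y in lborel. u y = C"
proof -
  define \<beta> where "\<beta> = bump 1 0 1"
  have \<beta>: "test_fun \<beta>" "smooth_fun \<beta>" unfolding \<beta>_def by (auto intro: test_fun_bump smooth_fun_bump)
  have int: "integrable lborel (\<lambda>y. v y * \<eta> y)" if "test_fun \<eta>" "loc_integrable v" for v \<eta>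
    using that(1) unfolding test_fun_def
    by (auto intro: loc_integrable_times_continuous that smooth_fun_continuous)
  have l1: "loc_integrable (\<lambda>y. c)" for c by (rule loc_integrable_continuous) simp
  have int1: "integrable lborel \<eta>" if "test_fun \<eta>" for \<eta> using int[OF that l1[of 1]] by simp
  define m where "m = (LINT y|lborel. \<beta> y)"
  have "m \<noteq> 0"
  proof
    assume "m = 0"
    then have "AE y in lborel. \<beta> y = 0"
      unfolding m_def using int1[OF \<beta>(1)]
      by (subst (asm) integral_nonneg_eq_0_iff_AE) (auto simp: \<beta>_def bump_bounds)
    then have "AE y in lborel. y \<notin> {0<..<1::real}" by eventually_elim (auto simp: \<beta>_def bump_eq)
    then have "emeasure lborel {0<..<1::real} = 0"
      by (subst (asm) AE_iff_measurable[where N="{0<..<1::real}"]) auto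
    then show False by simp
  qed
  define C where "C = (LINT y|lborel. u y * \<beta> y) / m"
  have "AE y in lborel. u y - C = 0"
  proof (rule fundamental_lemma_variations)
    show "loc_integrable (\<lambda>y. u y - C)" by (intro loc_integrable_diff u l1)
    fix \<eta> assume \<eta>: "test_fun \<eta>"
    define k where "k = (LINT y|lborel. \<eta> y) / m"
    define \<zeta> where "\<zeta> y = \<eta> y + (- k) * \<beta> y" for y
    have "smooth_fun \<zeta>" unfolding \<zeta>_def using \<eta> \<beta>
      by (intro smooth_fun_add smooth_fun_mult smooth_fun_const) (auto simp: test_fun_def)
    moreover obtain R1 R2 where "\<And>y. R1 < \<bar>y\<bar> \<Longrightarrow> \<eta> y = 0" "\<And>y. R2 < \<bar>y\<bar> \<Longrightarrow> \<beta> y = 0"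
      using \<eta> \<beta> unfolding test_fun_def by blast
    ultimately have t: "test_fun \<zeta>" unfolding test_fun_def
      by (auto simp: \<zeta>_def intro!: exI[of _ "max R1 R2"])
    have "(LINT y|lborel. \<zeta> y) = 0"
      unfolding \<zeta>_def using int1[OF \<eta>] int1[OF \<beta>(1)] \<open>m \<noteq> 0\<close> by (simp add: k_def m_def)
    from test_fun_primitive[OF t this] obtain \<phi> where "test_fun \<phi>" "deriv \<phi> = \<zeta>" .
    then have "(LINT y|lborel. u y * \<zeta> y) = 0" using 0 by metis
    also have "(\<lambda>y. u y * \<zeta> y) = (\<lambda>y. u y * \<eta> y - k * (u y * \<beta> y))"
      by (auto simp: \<zeta>_def algebra_simps)
    finally have "(LINT y|lborel. u y * \<eta> y) = k * (LINT y|lborel. u y * \<beta> y)"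
      using int[OF \<eta> u] int[OF \<beta>(1) u] by simp
    also have "\<dots> = C * (LINT y|lborel. \<eta> y)" by (simp add: k_def C_def)
    finally show "(LINT y|lborel. (u y - C) * \<eta> y) = 0"
      using int[OF \<eta> u] int1[OF \<eta>] by (simp add: left_diff_distrib)
  qed
  then show ?thesis by auto
qed

text \<open>Absolute continuity, encoded through the fundamental theorem of calculus: no pointwise
  derivative is mentioned, and \<open>g\<close> is free to change on null sets.\<close>

definition is_primitive :: "(real \<Rightarrow> real) \<Rightarrow> (real \<Rightarrow> real) \<Rightarrow> bool" where
  "is_primitive \<psi> g \<longleftrightarrow> loc_integrable g \<and> (\<forall>a b. a \<le> b \<longrightarrow> \<psi> b - \<psi> a = (LINT y:{a..b}|lborel. g y))"

lemma is_primitive_continuous: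
  assumes "is_primitive \<psi> g" shows "continuous_on UNIV \<psi>"
proof -
  have "isCont \<psi> x" for x
  proof -
    have i: "set_integrable lborel {x-1..x+1} g"
      using assms unfolding is_primitive_def loc_integrable_def by auto
    have c: "continuous_on {x-1..x+1} (\<lambda>y. integral {x-1..y} g)"
      using set_borel_integral_eq_integral(1)[OF i] by (rule indefinite_integral_continuous_1)
    have e: "\<psi> y = \<psi> (x-1) + integral {x-1..y} g" if "y \<in> {x-1..x+1}" for y
    proof -
      have "set_integrable lborel {x-1..y} g" using set_integrable_subset[OF i, of "{x-1..y}"] that by auto
      then have "\<psi> y - \<psi> (x-1) = integral {x-1..y} g"
        using assms that set_borel_integral_eq_integral(2)[of "{x-1..y}" g]
        unfolding is_primitive_def by simp
      then show ?thesis by simp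
    qed
    have "continuous_on {x-1..x+1} \<psi>"
      by (rule continuous_on_eq[OF continuous_on_add[OF continuous_on_const[of _ "\<psi> (x-1)"] c]])
         (rule e[symmetric])
    then show ?thesis by (rule continuous_on_interior) auto
  qed
  then show ?thesis by (simp add: continuous_on_eq_continuous_at)
qed

lemma integrable_times_lborel_pair:
  fixes f g :: "real \<Rightarrow> real"
  assumes f: "integrable lborel f" and g: "integrable lborel g"
  shows "integrable (lborel \<Otimes>\<^sub>M lborel) (\<lambda>(x,y). f x * g y)"
proof -
  have [measurable]: "f \<in> borel_measurable borel" "g \<in> borel_measurable borel" using f g by auto
  show ?thesis
  proof (rule lborel_pair.Fubini_integrable)
    have "(\<lambda>x. LINT y|lborel. norm (case (x,y) of (x,y) \<Rightarrow> f x * g y)) = (\<lambda>x. \<bar>f x\<bar> * (LINT y|lborel. \<bar>g y\<bar>))"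
      by (auto simp: abs_mult)
    then show "integrable lborel (\<lambda>x. LINT y|lborel. norm (case (x,y) of (x,y) \<Rightarrow> f x * g y))"
      using f by simp
  qed (use g in auto)
qed

text \<open>Integration by parts without pointwise differentiation of \<psi>: both functions are
  written as integrals, and Fubini exchanges the order over the triangle
  \<open>t \<le> y\<close>.\<close>

lemma is_primitive_weak_deriv:
  assumes p: "is_primitive \<psi> g" shows "weak_deriv \<psi> g"
  unfolding weak_deriv_def
proof (intro conjI allI impI)
  have g: "loc_integrable g" using p is_primitive_def by blast
  have c: "continuous_on UNIV \<psi>" by (rule is_primitive_continuous[OF p])
  show "loc_integrable \<psi>" by (rule loc_integrable_continuous[OF c])
  show "loc_integrable g" by (rule g)
  fix \<phi> assume \<phi>: "test_fun \<phi>"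
  obtain R where R: "R > 0" "\<And>y. R < \<bar>y\<bar> \<Longrightarrow> \<phi> y = 0" "\<And>y. R < \<bar>y\<bar> \<Longrightarrow> deriv \<phi> y = 0"
    using test_funE[OF \<phi>] by blast
  have s: "smooth_fun \<phi>" using \<phi> test_fun_def by blast
  have c': "continuous_on A (deriv \<phi>)" for A by (intro smooth_fun_continuous smooth_fun_deriv s)
  note [measurable] = loc_integrable_measurable[OF g]
  have [measurable]: "deriv \<phi> \<in> borel_measurable borel" using c' by (intro borel_measurable_continuous_onI)
  \<comment> \<open>\<open>R\<close> guarantees vanishing only strictly beyond distance
    \<open>R\<close>; one unit more puts the end points where \<phi> is 0.\<close>
  define S where "S = R + 1"
  have S0: "\<phi> S = 0" "\<phi> (-S) = 0" using R by (auto simp: S_def)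
  have FTC: "(LINT y:{a..b}|lborel. deriv \<phi> y) = \<phi> b - \<phi> a" if "a \<le> b" for a b
    unfolding set_lebesgue_integral_def
    by (rule integral_FTC_Icc[OF that]) (use c' smooth_fun_DERIV[OF s] in
      \<open>auto simp: has_real_derivative_iff_has_vector_derivative intro: has_vector_derivative_at_within\<close>)
  let ?G = "\<lambda>t. indicator {-S..S} t *\<^sub>R g t" and ?H = "\<lambda>y. indicator {-S..S} y *\<^sub>R deriv \<phi> y"
  define K where "K t y = (if t \<le> y then ?G t * ?H y else 0)" for t y
  have iG: "integrable lborel ?G" using g unfolding loc_integrable_def set_integrable_def by auto
  have iH: "integrable lborel ?H" using borel_integrable_compact[OF compact_Icc c'] .
  have "integrable (lborel \<Otimes>\<^sub>M lborel) (\<lambda>(t,y). K t y)"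
    using integrable_times_lborel_pair[OF iG iH]
    by (rule Bochner_Integration.integrable_bound) (auto simp: K_def)
  then have F: "(LINT y|lborel. LINT t|lborel. K t y) = (LINT t|lborel. LINT y|lborel. K t y)"
    using lborel_pair.Fubini_integral by fastforce
  have 1: "(LINT t|lborel. K t y) = (\<psi> y - \<psi> (-S)) * deriv \<phi> y" for y
  proof (cases "y \<in> {-S..S}")
    case True
    have "(LINT t|lborel. K t y) = (LINT t|lborel. (indicator {-S..y} t *\<^sub>R g t) * deriv \<phi> y)"
      using True by (intro Bochner_Integration.integral_cong) (auto simp: K_def indicator_def)
    also have "\<dots> = (LINT t:{-S..y}|lborel. g t) * deriv \<phi> y" unfolding set_lebesgue_integral_def by simp
    finally show ?thesis using p True by (simp add: is_primitive_def)
  next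
    case False
    then have "K t y = 0" for t by (simp add: K_def)
    moreover have "R < \<bar>y\<bar>" using False by (auto simp: S_def)
    ultimately show ?thesis using R(3)[of y] by simp
  qed
  have 2: "(LINT y|lborel. K t y) = - (g t * \<phi> t)" for t
  proof (cases "t \<in> {-S..S}")
    case True
    have "(LINT y|lborel. K t y) = (LINT y|lborel. g t * (indicator {t..S} y *\<^sub>R deriv \<phi> y))"
      using True by (intro Bochner_Integration.integral_cong) (auto simp: K_def indicator_def)
    also have "\<dots> = g t * (LINT y:{t..S}|lborel. deriv \<phi> y)" unfolding set_lebesgue_integral_def by simp
    finally show ?thesis using FTC[of t S] True S0 by simp
  next
    case False
    then have "K t y = 0" for y by (simp add: K_def)
    moreover have "R < \<bar>t\<bar>" using False by (auto simp: S_def)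
    ultimately show ?thesis using R(2)[of t] by simp
  qed
  have i1: "integrable lborel (\<lambda>y. \<psi> y * deriv \<phi> y)"
    by (rule loc_integrable_times_continuous[OF loc_integrable_continuous[OF c] c' R(3)])
  have i2: "integrable lborel (deriv \<phi>)"
    using loc_integrable_times_continuous[OF loc_integrable_continuous[of "\<lambda>_. 1"] c' R(3)] by simp
  have "(LINT y|lborel. deriv \<phi> y) = (LINT y:{-S..S}|lborel. deriv \<phi> y)"
    unfolding set_lebesgue_integral_def
  proof (rule Bochner_Integration.integral_cong[OF refl])
    fix y
    show "deriv \<phi> y = indicator {-S..S} y *\<^sub>R deriv \<phi> y"
      using R(3)[of y] unfolding S_def by (cases "y \<in> {-(R+1)..R+1}") force+
  qed
  then have z: "(LINT y|lborel. deriv \<phi> y) = 0" using FTC[of "-S" S] S0 R by (simp add: S_def)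
  \<comment> \<open>A constant may be subtracted because the derivative of a test function has
    integral 0; the shifted integrand is the inner integral of \<open>K\<close>.\<close>
  have "(LINT y|lborel. \<psi> y * deriv \<phi> y) = (LINT y|lborel. (\<psi> y - \<psi> (-S)) * deriv \<phi> y)"
    using i1 i2 z by (simp add: left_diff_distrib)
  also have "\<dots> = (LINT t|lborel. - (g t * \<phi> t))" using F unfolding 1 2 .
  finally show "(LINT y|lborel. \<psi> y * deriv \<phi> y) = - (LINT y|lborel. g y * \<phi> y)" by simp
qed

lemma weak_deriv_unique:
  assumes "weak_deriv \<psi> g" "weak_deriv \<psi> g'" shows "AE y in lborel. g y = g' y"
proof -
  have "AE y in lborel. g y - g' y = 0"
  proof (rule fundamental_lemma_variations)
    show "loc_integrable (\<lambda>y. g y - g' y)" using assms by (auto simp: weak_deriv_def loc_integrable_diff)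
    fix \<eta> assume \<eta>: "test_fun \<eta>"
    have "integrable lborel (\<lambda>y. h y * \<eta> y)" if "loc_integrable h" for h
      using \<eta> unfolding test_fun_def
      by (auto intro: loc_integrable_times_continuous that smooth_fun_continuous)
    then show "(LINT y|lborel. (g y - g' y) * \<eta> y) = 0"
      using assms \<eta> by (auto simp: left_diff_distrib weak_deriv_def)
  qed
  then show ?thesis by auto
qed

lemma loc_integrable_ex_primitive:
  assumes g: "loc_integrable g" obtains \<psi> where "is_primitive \<psi> g"
proof -
  define \<psi> where "\<psi> x = (LBINT t=ereal 0..ereal x. g t)" for x :: real
  have i: "interval_lebesgue_integrable lborel (ereal a) (ereal b) g" for a b
    unfolding interval_lebesgue_integrable_def using g unfolding loc_integrable_def
    by (auto simp: einterval_eq intro: set_integrable_subset[of _ "{a..b}"] set_integrable_subset[of _ "{b..a}"])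
  have "\<psi> b - \<psi> a = (LINT y:{a..b}|lborel. g y)" if "a \<le> b" for a b
  proof -
    have m: "min (ereal 0) (min (ereal a) (ereal b)) = ereal (min 0 (min a b))"
      "max (ereal 0) (max (ereal a) (ereal b)) = ereal (max 0 (max a b))" by (simp_all add: min_def max_def)
    have "\<psi> a + (LBINT t=ereal a..ereal b. g t) = \<psi> b"
      unfolding \<psi>_def by (rule interval_integral_sum) (unfold m, rule i)
    then show ?thesis using interval_integral_Icc[OF that, of g] by simp
  qed
  then show thesis using that g unfolding is_primitive_def by blast
qed

text \<open>Subtracting a primitive of \<open>g\<close> leaves a function with weak derivative 0,
  which is constant almost everywhere. Competitors can so be taken continuous.\<close>

lemma weak_deriv_primitive_representative:
  assumes w: "weak_deriv \<psi> g"
  obtains \<psi>' where "is_primitive \<psi>' g" "AE y in lborel. \<psi> y = \<psi>' y"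
proof -
  have g: "loc_integrable g" "loc_integrable \<psi>" using w weak_deriv_def by auto
  obtain G where G: "is_primitive G g" using loc_integrable_ex_primitive[OF g(1)] .
  have Gl: "loc_integrable G" by (rule loc_integrable_continuous[OF is_primitive_continuous[OF G]])
  have "\<exists>C. AE y in lborel. \<psi> y - G y = C"
  proof (rule du_Bois_Reymond)
    show "loc_integrable (\<lambda>y. \<psi> y - G y)" by (intro loc_integrable_diff g Gl)
    fix \<phi> assume \<phi>: "test_fun \<phi>"
    obtain R where "\<And>y. R < \<bar>y\<bar> \<Longrightarrow> deriv \<phi> y = 0" using test_funE[OF \<phi>] by blast
    then have "integrable lborel (\<lambda>y. h y * deriv \<phi> y)" if "loc_integrable h" for h
      using \<phi> unfolding test_fun_def
      by (auto intro: loc_integrable_times_continuous that smooth_fun_continuous smooth_fun_deriv)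
    then show "(LINT y|lborel. (\<psi> y - G y) * deriv \<phi> y) = 0"
      using w is_primitive_weak_deriv[OF G] \<phi> by (auto simp: left_diff_distrib weak_deriv_def)
  qed
  then obtain C where "AE y in lborel. \<psi> y - G y = C" by blast
  then have "AE y in lborel. \<psi> y = G y + C" by eventually_elim auto
  moreover have "is_primitive (\<lambda>y. G y + C) g" using G unfolding is_primitive_def by simp
  ultimately show thesis using that by blast
qed

section \<open>A one-dimensional coarea inequality\<close>

lemma open_connected_bounded_real:
  fixes C :: "real set"
  assumes "open C" "connected C" "bounded C" "C \<noteq> {}"
  shows "C = {Inf C<..<Sup C}"
proof
  have b: "bdd_above C" "bdd_below C"
    using assms(3) by (auto simp: bounded_imp_bdd_above bounded_imp_bdd_below)
  show "C \<subseteq> {Inf C<..<Sup C}"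
  proof
    fix x assume "x \<in> C"
    then obtain e where e: "e > 0" "\<And>y. dist y x < e \<Longrightarrow> y \<in> C" using assms(1) by (auto simp: open_dist)
    have "x - e/2 \<in> C" "x + e/2 \<in> C" using e by (auto simp: dist_real_def)
    then have "Inf C \<le> x - e/2" "x + e/2 \<le> Sup C" using b by (auto intro: cInf_lower cSup_upper)
    then show "x \<in> {Inf C<..<Sup C}" using e(1) by auto
  qed
  show "{Inf C<..<Sup C} \<subseteq> C"
  proof
    fix x assume "x \<in> {Inf C<..<Sup C}"
    then obtain y y' where "y \<in> C" "y < x" "y' \<in> C" "x < y'"
      using cInf_less_iff[OF assms(4) b(2)] less_cSup_iff[OF assms(4) b(1)] by auto
    then show "x \<in> C" using assms(2) unfolding connected_iff_interval by (meson less_imp_le)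
  qed
qed

text \<open>Open sets split into countably many disjoint intervals, their components; general Borel
  sets follow by outer regularity of \<open>M\<close>, which relies on its finiteness. Since only
  intervals inside \<open>[d, s]\<close> are compared, open supersets are first cut with the open
  interval.\<close>

lemma lborel_le_measure_if_intervals:
  fixes M :: "real measure"
  assumes sets[simp]: "sets M = sets borel" and fin: "emeasure M UNIV \<noteq> \<infinity>"
    and I: "\<And>a b. d \<le> a \<Longrightarrow> a < b \<Longrightarrow> b \<le> s \<Longrightarrow> ennreal (b - a) \<le> emeasure M {a<..<b}"
    and A: "A \<in> sets borel" "A \<subseteq> {d<..<s}"
  shows "emeasure lborel A \<le> emeasure M A"
proof -
  have *: "emeasure lborel W \<le> emeasure M W" if W: "open W" "W \<subseteq> {d<..<s}" for W
  proof -
    have o: "open C" if "C \<in> components W" for C using that W(1) by (rule open_components[rotated])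
    have c: "countable (components W)"
      using o pairwise_disjoint_components[of W]
      by (intro countable_disjoint_open_subsets) (auto simp: disjnt_def pairwise_def)
    have dj: "disjoint_family_on (\<lambda>C. C) (components W)"
      using pairwise_disjoint_components[of W] by (auto simp: pairwise_def disjoint_family_on_def)
    have le: "emeasure lborel C \<le> emeasure M C" if C: "C \<in> components W" for C
    proof -
      have sub: "C \<subseteq> {d<..<s}" using in_components_subset[OF C] W by auto
      have ne: "C \<noteq> {}" using in_components_nonempty[OF C] .
      have "C \<subseteq> {d..s}" using sub by (auto simp: subset_eq less_imp_le)
      then have "bounded C" by (rule bounded_subset[OF bounded_closed_interval])
      then have eq: "C = {Inf C<..<Sup C}"
        by (intro open_connected_bounded_real o C in_components_connected[OF C] ne)
      have "Inf C < Sup C" using ne by (subst (asm) eq) auto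
      moreover have "d \<le> Inf C" using ne sub by (intro cInf_greatest) auto
      moreover have "Sup C \<le> s" using ne sub by (intro cSup_least) auto
      ultimately have "emeasure lborel {Inf C<..<Sup C} \<le> emeasure M {Inf C<..<Sup C}" using I by simp
      then show ?thesis using eq by simp
    qed
    have "emeasure lborel W = emeasure lborel (\<Union>C\<in>components W. C)" by simp
    also have "\<dots> = (\<integral>\<^sup>+C. emeasure lborel C \<partial>count_space (components W))"
      using o c dj by (intro emeasure_UN_countable) auto
    also have "\<dots> \<le> (\<integral>\<^sup>+C. emeasure M C \<partial>count_space (components W))"
      using le by (intro nn_integral_mono) auto
    also have "\<dots> = emeasure M (\<Union>C\<in>components W. C)"
      using o c dj by (intro emeasure_UN_countable[symmetric]) auto
    finally show ?thesis by simp
  qed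
  have "space M = UNIV" using sets_eq_imp_space_eq[OF sets] by simp
  then have "emeasure M A = (INF U \<in> {U. A \<subseteq> U \<and> open U}. emeasure M U)"
    using fin A by (intro outer_regular) auto
  moreover have "emeasure lborel A \<le> emeasure M U" if "A \<subseteq> U" "open U" for U
  proof -
    have "emeasure lborel A \<le> emeasure lborel (U \<inter> {d<..<s})"
      using that A by (intro emeasure_mono) auto
    also have "\<dots> \<le> emeasure M (U \<inter> {d<..<s})" using that by (intro *) auto
    also have "\<dots> \<le> emeasure M U" using that by (intro emeasure_mono) auto
    finally show ?thesis .
  qed
  ultimately show ?thesis by (auto intro: INF_greatest)
qed

lemma nn_integral_mono_measure:
  assumes sets: "sets M = sets N" and le: "\<And>A. A \<in> sets M \<Longrightarrow> emeasure M A \<le> emeasure N A"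
    and f: "f \<in> borel_measurable M"
  shows "integral\<^sup>N M f \<le> integral\<^sup>N N f"
  using f
proof (induction rule: borel_measurable_induct)
  case (cong f g)
  have "space M = space N" using sets by (rule sets_eq_imp_space_eq)
  then have "integral\<^sup>N M g = integral\<^sup>N M f" "integral\<^sup>N N g = integral\<^sup>N N f"
    using cong(3) by (auto intro!: nn_integral_cong)
  then show ?case using cong by simp
next
  case (set A)
  then show ?case using le sets by simp
next
  case (mult u c)
  then show ?case using sets by (simp add: nn_integral_cmult mult_left_mono measurable_cong_sets[OF sets refl])
next
  case (add u v)
  then show ?case by (simp add: nn_integral_add add_mono measurable_cong_sets[OF sets refl])
next
  case (seq U)
  have "integral\<^sup>N M (SUP i. U i) = (SUP i. integral\<^sup>N M (U i))"
    "integral\<^sup>N N (SUP i. U i) = (SUP i. integral\<^sup>N N (U i))"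
    unfolding image_comp[symmetric] SUP_apply
    using seq by (auto intro!: nn_integral_monotone_convergence_SUP simp: measurable_cong_sets[OF sets refl])
  moreover have "(SUP i. integral\<^sup>N M (U i)) \<le> (SUP i. integral\<^sup>N N (U i))"
    by (rule SUP_mono') (rule seq)
  ultimately show ?case unfolding \<open>f = _\<close> by (simp only:)
qed

text \<open>Several bounds below hold only with a margin, at levels above some positive number or
  strictly below the height; monotone convergence removes the margin.\<close>

lemma nn_integral_exhaustion_le:
  assumes [measurable]: "f \<in> borel_measurable M" "\<And>n::nat. A n \<in> sets M"
    and A: "incseq A" "(\<Union>n. A n) = B" and le: "\<And>n. (\<integral>\<^sup>+x\<in>A n. f x \<partial>M) \<le> K"
  shows "(\<integral>\<^sup>+x\<in>B. f x \<partial>M) \<le> K"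
proof -
  have "(\<integral>\<^sup>+x\<in>B. f x \<partial>M) = emeasure (density M f) (\<Union>n. A n)"
    using A(2) by (subst emeasure_density) auto
  also have "\<dots> = (SUP n. emeasure (density M f) (A n))"
    using A(1) by (intro SUP_emeasure_incseq[symmetric]) auto
  also have "\<dots> = (SUP n. \<integral>\<^sup>+x\<in>A n. f x \<partial>M)" by (simp add: emeasure_density)
  also have "\<dots> \<le> K" by (rule SUP_least[OF le])
  finally show ?thesis .
qed

lemma is_primitive_increment_le:
  assumes p: "is_primitive \<psi> g" and "a \<le> b"
  shows "ennreal \<bar>\<psi> b - \<psi> a\<bar> \<le> (\<integral>\<^sup>+y\<in>{a<..<b}. ennreal \<bar>g y\<bar> \<partial>lborel)"
proof -
  have g: "loc_integrable g" using p is_primitive_def by auto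
  note [measurable] = loc_integrable_measurable[OF g]
  have i: "integrable lborel (\<lambda>y. indicator {a..b} y *\<^sub>R g y)"
    using g unfolding loc_integrable_def set_integrable_def by auto
  have "ennreal \<bar>\<psi> b - \<psi> a\<bar> = ennreal (norm (LINT y|lborel. indicator {a..b} y *\<^sub>R g y))"
    using p assms(2) by (simp add: is_primitive_def set_lebesgue_integral_def)
  also have "\<dots> \<le> (\<integral>\<^sup>+y. ennreal (norm (indicator {a..b} y *\<^sub>R g y)) \<partial>lborel)"
    using i by (rule integral_norm_bound_ennreal)
  also have "\<dots> = (\<integral>\<^sup>+y\<in>{a<..<b}. ennreal \<bar>g y\<bar> \<partial>lborel)"
  proof (rule nn_integral_cong_AE)
    have "AE y in lborel. y \<noteq> a \<and> y \<noteq> b" using AE_lborel_singleton[of a] AE_lborel_singleton[of b] by auto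
    then show "AE y in lborel. ennreal (norm (indicator {a..b} y *\<^sub>R g y)) = ennreal \<bar>g y\<bar> * indicator {a<..<b} y"
      by eventually_elim (auto simp: indicator_def)
  qed
  finally show ?thesis .
qed

text \<open>The image under \<open>\<psi>\<close> of the measure with density
  \<open>\<bar>g\<bar>\<close> charges every open interval of levels with at least its length.\<close>

lemma coarea_inequality_falling:
  assumes p: "is_primitive \<psi> g" and x: "x0 \<le> x2" and \<psi>: "s \<le> \<psi> x0" "\<psi> x2 \<le> d"
    and f[measurable]: "f \<in> borel_measurable borel"
  shows "(\<integral>\<^sup>+t\<in>{d<..<s}. f t \<partial>lborel) \<le> (\<integral>\<^sup>+y\<in>{x0<..<x2}. ennreal \<bar>g y\<bar> * f (\<psi> y) \<partial>lborel)"
proof -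
  have g: "loc_integrable g" using p is_primitive_def by auto
  note [measurable] = loc_integrable_measurable[OF g]
  have c: "continuous_on UNIV \<psi>" by (rule is_primitive_continuous[OF p])
  have [measurable]: "\<psi> \<in> borel_measurable borel" by (rule borel_measurable_continuous_onI[OF c])
  define D where "D = density lborel (\<lambda>y. ennreal \<bar>g y\<bar> * indicator {x0<..<x2} y)"
  define M where "M = distr D borel \<psi>"
  have [measurable]: "\<psi> \<in> measurable D borel" unfolding D_def by simp
  have eM: "emeasure M A = (\<integral>\<^sup>+y\<in>{x0<..<x2} \<inter> \<psi> -` A. ennreal \<bar>g y\<bar> \<partial>lborel)" if [measurable]: "A \<in> sets borel" for A
  proof -
    have "\<psi> -` A \<in> sets borel" using measurable_sets_borel[of \<psi> borel A] by simp
    then show ?thesis unfolding M_def by (subst emeasure_distr)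
      (auto simp: D_def emeasure_density ac_simps indicator_inter_arith intro!: nn_integral_cong)
  qed
  have fin: "emeasure M UNIV \<noteq> \<infinity>"
  proof -
    have i: "integrable lborel (\<lambda>y. indicator {x0..x2} y *\<^sub>R g y)"
      using g unfolding loc_integrable_def set_integrable_def by auto
    have "emeasure M UNIV \<le> (\<integral>\<^sup>+y. ennreal (norm (indicator {x0..x2} y *\<^sub>R g y)) \<partial>lborel)"
      by (subst eM) (auto intro!: nn_integral_mono simp: indicator_def)
    also have "\<dots> < \<infinity>" using i unfolding integrable_iff_bounded by simp
    finally show ?thesis by simp
  qed
  have I: "ennreal (b - a) \<le> emeasure M {a<..<b}" if ab: "d \<le> a" "a < b" "b \<le> s" for a b
  proof -
    \<comment> \<open>\<open>y2\<close> is the first place where \<psi> is at most \<open>a\<close>,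
      and \<open>y1\<close> the last place before it where \<psi> is at least \<open>b\<close>. In
      between \<psi> stays strictly inside the interval of levels and falls by at least
      \<open>b - a\<close>, so |g| has at least this integral over the preimage.\<close>
    define P where "P = {x\<in>{x0..x2}. \<psi> x \<le> a}"
    have "P = {x0..x2} \<inter> {x. \<psi> x \<le> a}" unfolding P_def by auto
    moreover have "closed {x. \<psi> x \<le> a}" using c by (intro closed_Collect_le) auto
    ultimately have "compact P" by (auto intro: compact_Int_closed)
    moreover have "x2 \<in> P" using x \<psi> ab by (auto simp: P_def)
    ultimately obtain y2 where y2: "y2 \<in> P" "\<And>y. y \<in> P \<Longrightarrow> y2 \<le> y" using compact_attains_inf[of P] by auto
    define Q where "Q = {x\<in>{x0..y2}. b \<le> \<psi> x}"
    have "Q = {x0..y2} \<inter> {x. b \<le> \<psi> x}" unfolding Q_def by auto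
    moreover have "closed {x. b \<le> \<psi> x}" using c by (intro closed_Collect_le) auto
    ultimately have "compact Q" by (auto intro: compact_Int_closed)
    moreover have "x0 \<in> Q" using y2 \<psi> ab by (auto simp: P_def Q_def)
    ultimately obtain y1 where y1: "y1 \<in> Q" "\<And>y. y \<in> Q \<Longrightarrow> y \<le> y1" using compact_attains_sup[of Q] by auto
    have in_ab: "a < \<psi> y \<and> \<psi> y < b" if "y1 < y" "y < y2" for y
    proof (intro conjI; rule ccontr)
      have y: "x0 \<le> y" "y \<le> x2" using that y1(1) y2(1) by (auto simp: P_def Q_def)
      assume "\<not> a < \<psi> y"
      then show False using y2(2)[of y] that y by (auto simp: P_def)
    next
      have y: "x0 \<le> y" "y \<le> y2" using that y1(1) by (auto simp: Q_def)
      assume "\<not> \<psi> y < b"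
      then show False using y1(2)[of y] that y by (auto simp: Q_def)
    qed
    have "b - a \<le> \<bar>\<psi> y2 - \<psi> y1\<bar>" using y1(1) y2(1) by (auto simp: P_def Q_def)
    then have "ennreal (b - a) \<le> ennreal \<bar>\<psi> y2 - \<psi> y1\<bar>" by (rule ennreal_leI)
    also have "\<dots> \<le> (\<integral>\<^sup>+y\<in>{y1<..<y2}. ennreal \<bar>g y\<bar> \<partial>lborel)"
      using y1(1) by (intro is_primitive_increment_le[OF p]) (auto simp: Q_def)
    also have "\<dots> \<le> (\<integral>\<^sup>+y\<in>{x0<..<x2} \<inter> \<psi> -` {a<..<b}. ennreal \<bar>g y\<bar> \<partial>lborel)"
      using in_ab y1(1) y2(1) by (intro nn_integral_mono) (auto simp: indicator_def P_def Q_def)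
    also have "\<dots> = emeasure M {a<..<b}" by (subst eM) auto
    finally show ?thesis .
  qed
  have "(\<integral>\<^sup>+t\<in>{d<..<s}. f t \<partial>lborel) = integral\<^sup>N (density lborel (indicator {d<..<s})) f"
    by (subst nn_integral_density) (auto simp: mult.commute)
  also have "\<dots> \<le> integral\<^sup>N M f"
  proof (rule nn_integral_mono_measure)
    fix A assume A: "A \<in> sets (density lborel (indicator {d<..<s}))"
    then have "emeasure (density lborel (indicator {d<..<s})) A = emeasure lborel ({d<..<s} \<inter> A)"
      by (subst emeasure_density) (auto simp: nn_integral_indicator[symmetric] indicator_inter_arith)
    also have "\<dots> \<le> emeasure M ({d<..<s} \<inter> A)"
      using A by (intro lborel_le_measure_if_intervals[OF _ fin I]) (auto simp: M_def)
    also have "\<dots> \<le> emeasure M A" using A by (intro emeasure_mono) (auto simp: M_def)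
    finally show "emeasure (density lborel (indicator {d<..<s})) A \<le> emeasure M A" .
  qed (auto simp: M_def)
  also have "\<dots> = (\<integral>\<^sup>+y\<in>{x0<..<x2}. ennreal \<bar>g y\<bar> * f (\<psi> y) \<partial>lborel)"
    unfolding M_def D_def by (subst nn_integral_distr, measurable, subst nn_integral_density)
      (auto simp: ac_simps intro!: nn_integral_cong)
  finally show ?thesis .
qed

lemma is_primitive_reflect:
  assumes "is_primitive \<psi> g" shows "is_primitive (\<lambda>y. \<psi> (- y)) (\<lambda>y. - g (- y))"
  unfolding is_primitive_def loc_integrable_def
proof (intro conjI allI impI)
  fix a b :: real
  have "set_integrable lborel {-b..-a} g" using assms unfolding is_primitive_def loc_integrable_def by auto
  then have "integrable lborel (\<lambda>y. indicator {-b..-a} (0 + (-1) * y) *\<^sub>R g (0 + (-1) * y))"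
    unfolding set_integrable_def by (rule lborel_integrable_real_affine) simp
  moreover have "(\<lambda>y. indicator {-b..-a} (0 + (-1) * y) *\<^sub>R g (0 + (-1) * y)) = (\<lambda>y. indicator {a..b} y *\<^sub>R g (- y))"
    by (auto simp: indicator_def)
  ultimately show "set_integrable lborel {a..b} (\<lambda>y. - g (- y))"
    unfolding set_integrable_def by simp
next
  fix a b :: real assume "a \<le> b"
  then have "\<psi> (-a) - \<psi> (-b) = (LINT y:{-b..-a}|lborel. g y)"
    using assms unfolding is_primitive_def by simp
  also have "\<dots> = (LINT y:{y. -y \<in> {-b..-a}}|lborel. g (- y))" by (rule set_integral_reflect)
  also have "{y. -y \<in> {-b..-a}} = {a..b}" by auto
  finally show "\<psi> (-b) - \<psi> (-a) = (LINT y:{a..b}|lborel. - g (- y))"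
    by (simp add: set_lebesgue_integral_def)
qed

lemma coarea_inequality_rising:
  assumes p: "is_primitive \<psi> g" and x: "x1 \<le> x0" and \<psi>: "s \<le> \<psi> x0" "\<psi> x1 \<le> d"
    and f[measurable]: "f \<in> borel_measurable borel"
  shows "(\<integral>\<^sup>+t\<in>{d<..<s}. f t \<partial>lborel) \<le> (\<integral>\<^sup>+y\<in>{x1<..<x0}. ennreal \<bar>g y\<bar> * f (\<psi> y) \<partial>lborel)"
proof -
  have g: "loc_integrable g" using p is_primitive_def by auto
  note [measurable] = loc_integrable_measurable[OF g]
  have [measurable]: "\<psi> \<in> borel_measurable borel"
    by (rule borel_measurable_continuous_onI[OF is_primitive_continuous[OF p]])
  have "(\<integral>\<^sup>+t\<in>{d<..<s}. f t \<partial>lborel) \<le> (\<integral>\<^sup>+y\<in>{-x0<..<-x1}. ennreal \<bar>- g (-y)\<bar> * f (\<psi> (-y)) \<partial>lborel)"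
    using x \<psi> by (intro coarea_inequality_falling[OF is_primitive_reflect[OF p]]) auto
  also have "\<dots> = (\<integral>\<^sup>+y\<in>{x1<..<x0}. ennreal \<bar>g y\<bar> * f (\<psi> y) \<partial>lborel)"
    by (subst nn_integral_real_affine[where c="-1" and t=0 and f="\<lambda>y. ennreal \<bar>g y\<bar> * f (\<psi> y) * indicator {x1<..<x0} y"])
       (auto intro!: nn_integral_cong simp: indicator_def)
  finally show ?thesis .
qed

section \<open>Small values near every point, and a bound on the height\<close>

lemma integrable_nonneg_ex_small:
  assumes "integrable lborel \<psi>" "\<And>y::real. 0 \<le> \<psi> y" "(LINT y|lborel. \<psi> y) = w" "w < L * d" "0 \<le> L"
  shows "\<exists>y\<in>{x..x+L}. \<psi> y \<le> (d::real)"
proof (rule ccontr)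
  assume "\<not> ?thesis"
  then have *: "d < \<psi> y" if "y \<in> {x..x+L}" for y using that by force
  have "L * d = (LINT y|lborel. indicator {x..x+L} y * d)"
    using assms(5) by simp
  also have "\<dots> \<le> (LINT y|lborel. \<psi> y)"
  proof (rule integral_mono)
    show "integrable lborel (\<lambda>y. indicator {x..x+L} y * d)"
      using assms(5) by (intro integrable_mult_left integrable_real_indicator) auto
    fix y show "indicator {x..x+L} y * d \<le> \<psi> y"
      using *[of y] assms(2)[of y] by (cases "y \<in> {x..x+L}") auto
  qed fact
  finally show False using assms by simp
qed

text \<open>A function of mass \<open>w\<close> and height \<open>H\<close> must drop to
  \<open>H / 2\<close> within a distance of order w / H, and a drop over a short distance costs
  kinetic energy. Energy and mass therefore bound the height, uniformly along a minimizing
  sequence.\<close>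

lemma height_bound:
  assumes p: "is_primitive \<psi> g" and i: "integrable lborel \<psi>" and nn: "\<And>y. 0 \<le> \<psi> y"
    and w: "(LINT y|lborel. \<psi> y) = w" "w > 0"
    and E: "(\<integral>\<^sup>+y. ennreal ((g y)\<^sup>2 / 2) \<partial>lborel) \<le> ennreal E" "E > 0"
  shows "(\<psi> x) ^ 3 \<le> 32 * w * E"
proof (cases "\<psi> x = 0")
  case True
  then show ?thesis using w E by simp
next
  case False
  define H where "H = \<psi> x"
  have H: "H > 0" using False nn[of x] unfolding H_def by linarith
  \<comment> \<open>With this \<open>L\<close> the product \<open>L * (H / 2)\<close> exceeds
    \<open>w\<close>, so the drop happens within distance \<open>L\<close>. The weight \<theta> in
    Young's inequality is chosen so that \<open>\<theta> * E = H / 4\<close>, half of the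
    drop.\<close>
  define L where "L = 4 * w / H"
  define \<theta> where "\<theta> = H / (4 * E)"
  have pos: "L > 0" "\<theta> > 0" unfolding L_def \<theta>_def using H w E by auto
  have "g \<in> borel_measurable borel"
    using p is_primitive_def loc_integrable_measurable by auto
  note [measurable] = this
  have "\<exists>y\<in>{x..x+L}. \<psi> y \<le> H / 2"
    using integrable_nonneg_ex_small[OF i nn w(1), of L "H/2" x] pos H w by (simp add: L_def)
  then obtain y where y: "x \<le> y" "y \<le> x + L" "\<psi> y \<le> H / 2" by auto
  have amgm: "\<bar>a\<bar> \<le> \<theta> * (a\<^sup>2 / 2) + 1 / (2 * \<theta>)" for a :: real
  proof -
    have "0 \<le> (\<theta> * \<bar>a\<bar> - 1)\<^sup>2" by simp
    then have "2 * \<theta> * \<bar>a\<bar> \<le> \<theta>\<^sup>2 * a\<^sup>2 + 1" by (simp add: power2_eq_square algebra_simps)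
    then show ?thesis using pos by (simp add: field_simps power2_eq_square)
  qed
  have "H / 2 \<le> \<bar>\<psi> y - \<psi> x\<bar>" using y(3) unfolding H_def by linarith
  then have "ennreal (H / 2) \<le> ennreal \<bar>\<psi> y - \<psi> x\<bar>" by (rule ennreal_leI)
  also have "\<dots> \<le> (\<integral>\<^sup>+t\<in>{x<..<y}. ennreal \<bar>g t\<bar> \<partial>lborel)" using y by (intro is_primitive_increment_le[OF p])
  also have "\<dots> \<le> (\<integral>\<^sup>+t. ennreal \<theta> * ennreal ((g t)\<^sup>2 / 2) + ennreal (1 / (2 * \<theta>)) * indicator {x<..<y} t \<partial>lborel)"
  proof (rule nn_integral_mono)
    fix t
    show "ennreal \<bar>g t\<bar> * indicator {x<..<y} t \<le> ennreal \<theta> * ennreal ((g t)\<^sup>2 / 2) + ennreal (1 / (2 * \<theta>)) * indicator {x<..<y} t"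
      using amgm[of "g t"] pos
      by (auto simp: indicator_def ennreal_mult'[symmetric] ennreal_plus[symmetric] simp del: ennreal_plus)
  qed
  also have "\<dots> = ennreal \<theta> * (\<integral>\<^sup>+t. ennreal ((g t)\<^sup>2 / 2) \<partial>lborel) + ennreal (1 / (2 * \<theta>)) * ennreal (y - x)"
    using y by (subst nn_integral_add) (auto simp: nn_integral_cmult)
  also have "\<dots> \<le> ennreal \<theta> * ennreal E + ennreal (1 / (2 * \<theta>)) * ennreal L"
    using E y by (intro add_mono mult_left_mono ennreal_leI) auto
  also have "\<dots> = ennreal (\<theta> * E + L / (2 * \<theta>))"
    using pos E by (simp add: ennreal_mult'[symmetric] ennreal_plus[symmetric] del: ennreal_plus)
  finally have "H / 2 \<le> \<theta> * E + L / (2 * \<theta>)"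
    by (subst (asm) ennreal_le_iff) (use pos E in auto)
  also have "\<dots> = H / 4 + 8 * w * E / H\<^sup>2" unfolding \<theta>_def L_def using H E w by (simp add: field_simps power2_eq_square)
  finally have "H / 4 \<le> 8 * w * E / H\<^sup>2" by simp
  then show ?thesis unfolding H_def[symmetric] using H by (simp add: field_simps power2_eq_square power3_eq_cube)
qed

section \<open>Lower bound at a given height\<close>

lemma nn_integral_Ioo_le:
  fixes f :: "real \<Rightarrow> ennreal"
  assumes [measurable]: "f \<in> borel_measurable borel"
    and le: "\<And>c d. a < c \<Longrightarrow> d < b \<Longrightarrow> (\<integral>\<^sup>+t\<in>{c<..<d}. f t \<partial>lborel) \<le> K"
  shows "(\<integral>\<^sup>+t\<in>{a<..<b}. f t \<partial>lborel) \<le> K"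
proof (rule nn_integral_exhaustion_le[where A="\<lambda>n. {a + 1 / real (Suc n)<..<b - 1 / real (Suc n)}"])
  show "incseq (\<lambda>n. {a + 1 / real (Suc n)<..<b - 1 / real (Suc n)})"
  proof (rule monoI)
    fix m n :: nat assume "m \<le> n"
    then have "1 / real (Suc n) \<le> 1 / real (Suc m)" by (simp add: frac_le)
    then show "{a + 1 / real (Suc m)<..<b - 1 / real (Suc m)} \<le> {a + 1 / real (Suc n)<..<b - 1 / real (Suc n)}"
      by (auto simp del: of_nat_Suc)
  qed
  have p: "0 < 1 / real (Suc n)" for n by simp
  show "(\<Union>n. {a + 1 / real (Suc n)<..<b - 1 / real (Suc n)}) = {a<..<b}"
  proof (intro equalityI subsetI)
    fix t assume t: "t \<in> {a<..<b}"
    then obtain n where "1 / real (Suc n) < min (t - a) (b - t)" using nat_approx_posE[of "min (t - a) (b - t)"] by auto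
    then have "t \<in> {a + 1 / real (Suc n)<..<b - 1 / real (Suc n)}" by (auto simp del: of_nat_Suc)
    then show "t \<in> (\<Union>n. {a + 1 / real (Suc n)<..<b - 1 / real (Suc n)})" by blast
  next
    fix t assume "t \<in> (\<Union>n. {a + 1 / real (Suc n)<..<b - 1 / real (Suc n)})"
    then obtain n where "t \<in> {a + 1 / real (Suc n)<..<b - 1 / real (Suc n)}" by blast
    then have "a + 1 / real (Suc n) < t" "t < b - 1 / real (Suc n)" by (simp_all only: greaterThanLessThan_iff)
    then have "a < t" "t < b" using p[of n] by linarith+
    then show "t \<in> {a<..<b}" by simp
  qed
  show "(\<integral>\<^sup>+t\<in>{a + 1 / real (Suc n)<..<b - 1 / real (Suc n)}. f t \<partial>lborel) \<le> K" for n
    by (rule le) (use p[of n] in linarith)+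
qed auto

text \<open>The energy is defined through a choice of weak derivative; uniqueness almost everywhere
  makes the choice immaterial.\<close>

lemma energy_eq:
  assumes "weak_deriv \<psi> g"
  shows "energy c \<psi> = (\<integral>\<^sup>+y. ennreal ((g y)\<^sup>2 / 2 + c \<bar>\<psi> y\<bar>) \<partial>lborel)"
proof -
  define g' where "g' = (SOME g. weak_deriv \<psi> g)"
  have "weak_deriv \<psi> g'" unfolding g'_def by (rule someI[of "weak_deriv \<psi>", OF assms])
  then have "AE y in lborel. g' y = g y" using assms by (rule weak_deriv_unique)
  then have "(\<integral>\<^sup>+y. ennreal ((g' y)\<^sup>2 / 2 + c \<bar>\<psi> y\<bar>) \<partial>lborel) = (\<integral>\<^sup>+y. ennreal ((g y)\<^sup>2 / 2 + c \<bar>\<psi> y\<bar>) \<partial>lborel)"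
    by (intro nn_integral_cong_AE) auto
  then show ?thesis unfolding energy_def using assms by (auto simp: g'_def)
qed

text \<open>The first integral of the Euler-Lagrange equation: a critical point that vanishes at
  infinity, with multiplier \<mu> for the mass, satisfies \<psi>'^2 / 2 = c(\<psi>) - \<mu> \<psi>.
  This is the resulting |\<psi>'| at level \<open>s\<close>.\<close>

definition slope :: "(real \<Rightarrow> real) \<Rightarrow> real \<Rightarrow> real \<Rightarrow> real" where
  "slope z \<mu> s = sqrt (2 * s * (z s - \<mu>))"

text \<open>The values of \<open>z\<close> outside the positive half-line never enter the energy; fixing them to be
  \<open>0\<close> makes \<open>z\<close> Borel measurable.\<close>

locale cost_rate =
  fixes z :: "real \<Rightarrow> real"
  assumes z_nonneg: "0 < x \<Longrightarrow> 0 \<le> z x"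
    and z_noninc: "0 < x \<Longrightarrow> x \<le> y \<Longrightarrow> z y \<le> z x"
    and z_lsc: "lsc_on {0<..} z"
    and z_nonpos: "x \<le> 0 \<Longrightarrow> z x = 0"
    and sqrt_int: "(\<integral>\<^sup>+ phi\<in>{0..1}. ennreal (sqrt (cz z phi)) \<partial>lborel) < \<infinity>"
begin

lemma z_measurable[measurable]: "z \<in> borel_measurable borel"
proof -
  \<comment> \<open>Monotonicity is given on the half-line only; composing with \<open>exp\<close>
    moves it to the whole line, and \<open>ln\<close> leads back.\<close>
  have "mono (\<lambda>t. - z (exp t))" by (auto intro!: monoI z_noninc)
  then have m: "(\<lambda>t. - z (exp t)) \<in> borel_measurable borel" by (rule borel_measurable_mono)
  have "(\<lambda>x. if x > 0 then - (- z (exp (ln x))) else 0) \<in> borel_measurable borel"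
    by (intro measurable_If borel_measurable_uminus measurable_compose[OF _ m]) auto
  moreover have "(\<lambda>x. if x > 0 then - (- z (exp (ln x))) else 0) = z"
    by (auto simp: z_nonpos)
  ultimately show ?thesis by simp
qed

lemma cz_eq: "cz z s = z s * s"
  by (simp add: cz_def)

lemma cz_nonneg: "0 \<le> s \<Longrightarrow> 0 \<le> cz z s"
  using z_nonneg[of s] by (cases "s = 0") (auto simp: cz_eq)

lemma slope_measurable[measurable]: "slope z \<mu> \<in> borel_measurable borel"
  unfolding slope_def by measurable

text \<open>All that the limit argument has to know about a competitor is condensed into one number
  \<open>h\<close>. The conclusions bound heights from above, exclude small heights, and feed the
  dual problem; the last one is stated for strict inequalities because these persist when heights
  converge.\<close>

lemma lower_bound:
  assumes nn: "\<And>y. 0 \<le> \<psi> y" and i: "integrable lborel \<psi>" and w: "(LINT y|lborel. \<psi> y) = w" "w > 0"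
    and E: "energy (cz z) \<psi> \<le> ennreal E" "E > 0"
  obtains h where "h > 0" "h ^ 3 \<le> 32 * w * E" "z h * w \<le> E"
    "\<And>\<mu> s. \<mu> < z h \<Longrightarrow> s < h \<Longrightarrow>
      2 * (\<integral>\<^sup>+t\<in>{0<..<s}. ennreal (slope z \<mu> t) \<partial>lborel) \<le> ennreal (E - \<mu> * w)"
proof -
  have "\<exists>g. weak_deriv \<psi> g"
  proof (rule ccontr)
    assume "\<not> ?thesis"
    then have "energy (cz z) \<psi> = \<infinity>" unfolding energy_def by auto
    then show False using E by (simp add: top_unique)
  qed
  then obtain g where g: "weak_deriv \<psi> g" by blast
  obtain u where u: "is_primitive u g" "AE y in lborel. \<psi> y = u y"
    using weak_deriv_primitive_representative[OF g] .
  have uc: "continuous_on UNIV u" by (rule is_primitive_continuous[OF u(1)])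
  have [measurable]: "u \<in> borel_measurable borel" by (rule borel_measurable_continuous_onI[OF uc])
  have [measurable]: "g \<in> borel_measurable borel"
    using u(1) is_primitive_def loc_integrable_measurable by auto
  \<comment> \<open>Equality with \<psi> holds only almost everywhere, but the set where the
    continuous \<open>u\<close> is negative is open, and an open null set is empty.\<close>
  have unn: "0 \<le> u y" for y
  proof (rule ccontr)
    assume "\<not> 0 \<le> u y"
    have o: "open {y. u y < 0}" using uc by (intro open_Collect_less) auto
    have "AE y in lborel. y \<notin> {y. u y < 0}" using u(2) by eventually_elim (use nn in \<open>auto simp: not_less dest: sym\<close>)
    then have "emeasure lborel {y. u y < 0} = 0"
      using o by (subst (asm) AE_iff_measurable[where N="{y. u y < 0}"]) auto
    then have "negligible {y. u y < 0}"
      unfolding negligible_iff_null_sets using o by (intro null_sets_completionI) (auto simp: null_sets_def)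
    then show False using open_not_negligible[OF o] \<open>\<not> 0 \<le> u y\<close> by (force simp: not_le)
  qed
  have ui: "integrable lborel u" using i u(2) by (subst integrable_cong_AE[of u _ \<psi>]) auto
  have uw: "(LINT y|lborel. u y) = w"
    using w(1) u(2) i by (subst integral_cong_AE[of u _ \<psi>]) auto
  define F where "F y = (g y)\<^sup>2 / 2 + z (u y) * u y" for y
  have Fnn: "0 \<le> F y" for y using cz_nonneg[OF unn] by (auto simp: F_def cz_eq)
  have [measurable]: "F \<in> borel_measurable borel" unfolding F_def by measurable
  have "energy (cz z) \<psi> = (\<integral>\<^sup>+y. ennreal ((g y)\<^sup>2 / 2 + cz z \<bar>\<psi> y\<bar>) \<partial>lborel)" by (rule energy_eq[OF g])
  also have "\<dots> = (\<integral>\<^sup>+y. ennreal (F y) \<partial>lborel)"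
    using u(2) by (intro nn_integral_cong_AE) (auto simp: F_def cz_eq unn)
  finally have FE: "(\<integral>\<^sup>+y. ennreal (F y) \<partial>lborel) \<le> ennreal E" using E(1) by simp
  have Fi: "integrable lborel F"
    using FE Fnn by (intro integrableI_bounded) (auto simp: le_less_trans[OF _ ennreal_less_top])
  have FE': "(LINT y|lborel. F y) \<le> E"
    using FE Fnn E(2) by (subst (asm) nn_integral_eq_integral[OF Fi]) auto
  have "(\<integral>\<^sup>+y. ennreal ((g y)\<^sup>2 / 2) \<partial>lborel) \<le> (\<integral>\<^sup>+y. ennreal (F y) \<partial>lborel)"
    using cz_nonneg[OF unn] by (intro nn_integral_mono ennreal_leI) (auto simp: F_def cz_eq)
  then have gE: "(\<integral>\<^sup>+y. ennreal ((g y)\<^sup>2 / 2) \<partial>lborel) \<le> ennreal E" using FE by (rule order_trans)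
  have cube: "(u x) ^ 3 \<le> 32 * w * E" for x
    by (rule height_bound[OF u(1) ui unn uw w(2) gE E(2)])
  define K where "K = 32 * w * E"
  have root: "a \<le> root 3 K" if "a ^ 3 \<le> K" for a
    using that by (metis odd_real_root_power_cancel odd_numeral real_root_le_iff zero_less_numeral)
  have bdd: "bdd_above (range u)" using root cube by (auto simp: K_def bdd_above_def)
  \<comment> \<open>For \<open>s < h\<close> some value of \<open>u\<close> exceeds
    \<open>s\<close>, whether or not the supremum is attained.\<close>
  define h where "h = Sup (range u)"
  have uh: "u y \<le> h" for y unfolding h_def using bdd by (intro cSup_upper) auto
  have "h \<le> root 3 K" unfolding h_def using root cube by (intro cSup_least) (auto simp: K_def)
  then have "h ^ 3 \<le> (root 3 K) ^ 3"
    by (simp add: power_mono_odd)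
  then have hK: "h ^ 3 \<le> 32 * w * E" unfolding K_def by (simp add: odd_real_root_pow)
  have h: "h > 0"
  proof (rule ccontr)
    assume "\<not> h > 0"
    then have "u y = 0" for y using uh[of y] unn[of y] by linarith
    then have "(LINT y|lborel. u y) = 0" by simp
    then show False using uw w by simp
  qed
  have zu: "\<mu> * u y \<le> z (u y) * u y" if "\<mu> \<le> z h" for \<mu> y
  proof (cases "u y = 0")
    case False
    then have "0 < u y" using unn[of y] by linarith
    then show ?thesis using z_noninc[of "u y" h] uh[of y] that by (intro mult_right_mono) auto
  qed auto
  have "z h * w = (LINT y|lborel. z h * u y)" using uw by simp
  also have "\<dots> \<le> (LINT y|lborel. F y)"
  proof (rule integral_mono)
    show "z h * u y \<le> F y" for y using zu[of "z h" y] by (auto simp: F_def intro: add_increasing)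
  qed (use ui Fi in auto)
  finally have zh: "z h * w \<le> E" using FE' by simp
  have key: "2 * (\<integral>\<^sup>+t\<in>{0<..<s}. ennreal (slope z \<mu> t) \<partial>lborel) \<le> ennreal (E - \<mu> * w)"
    if \<mu>: "\<mu> < z h" and s: "s < h" for \<mu> s
  proof -
    obtain x0 where x0: "s < u x0"
      using s less_cSup_iff[of "range u" s] bdd unfolding h_def by auto
    have Gnn: "0 \<le> F y - \<mu> * u y" for y using zu[of \<mu> y] \<mu> by (simp add: F_def add_increasing)
    have "(\<integral>\<^sup>+y. ennreal (F y - \<mu> * u y) \<partial>lborel) = ennreal (LINT y|lborel. F y - \<mu> * u y)"
      using Fi ui Gnn by (intro nn_integral_eq_integral) auto
    also have "\<dots> \<le> ennreal (E - \<mu> * w)" using Fi ui uw FE' by (intro ennreal_leI) simp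
    finally have G: "(\<integral>\<^sup>+y. ennreal (F y - \<mu> * u y) \<partial>lborel) \<le> ennreal (E - \<mu> * w)" .
    have pt: "\<bar>g y\<bar> * slope z \<mu> (u y) \<le> F y - \<mu> * u y" for y
    proof -
      define q where "q = sqrt (2 * u y * (z (u y) - \<mu>))"
      have "0 \<le> 2 * u y * (z (u y) - \<mu>)" using zu[of \<mu> y] \<mu> by (simp add: algebra_simps)
      then have q: "q\<^sup>2 = 2 * u y * (z (u y) - \<mu>)" unfolding q_def by simp
      have "0 \<le> (\<bar>g y\<bar> - q)\<^sup>2" by simp
      then have "\<bar>g y\<bar> * q \<le> (g y)\<^sup>2 / 2 + q\<^sup>2 / 2" by (simp add: power2_eq_square algebra_simps)
      then show ?thesis unfolding slope_def q_def[symmetric] F_def using q by (simp add: field_simps)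
    qed
    have half: "2 * (\<integral>\<^sup>+t\<in>{d<..<s}. ennreal (slope z \<mu> t) \<partial>lborel) \<le> ennreal (E - \<mu> * w)" if d: "d > 0" for d
    proof -
      \<comment> \<open>Since \<open>L * d\<close> exceeds \<open>w\<close>, a value at most
        \<open>d\<close> occurs within distance \<open>L\<close> on either side of
        \<open>x0\<close>. The two flanks are disjoint, so their coarea bounds add up to the factor
        2.\<close>
      define L where "L = w / d + 1"
      have L: "w < L * d" "0 \<le> L" unfolding L_def using d w by (auto simp: field_simps)
      obtain x2 where x2: "x0 \<le> x2" "u x2 \<le> d"
        using integrable_nonneg_ex_small[OF ui unn uw L, of x0] by auto
      obtain x1 where x1: "x1 \<le> x0" "u x1 \<le> d"
        using integrable_nonneg_ex_small[OF ui unn uw L, of "x0 - L"] by auto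
      let ?f = "\<lambda>t. ennreal (slope z \<mu> t)"
      have "2 * (\<integral>\<^sup>+t\<in>{d<..<s}. ?f t \<partial>lborel)
        \<le> (\<integral>\<^sup>+y\<in>{x1<..<x0}. ennreal \<bar>g y\<bar> * ?f (u y) \<partial>lborel) + (\<integral>\<^sup>+y\<in>{x0<..<x2}. ennreal \<bar>g y\<bar> * ?f (u y) \<partial>lborel)"
        unfolding mult_2 using x0 x1 x2
        by (intro add_mono coarea_inequality_rising[OF u(1)] coarea_inequality_falling[OF u(1)]) auto
      also have "\<dots> = (\<integral>\<^sup>+y. ennreal \<bar>g y\<bar> * ?f (u y) * indicator {x1<..<x0} y + ennreal \<bar>g y\<bar> * ?f (u y) * indicator {x0<..<x2} y \<partial>lborel)"
        by (subst nn_integral_add) auto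
      also have "\<dots> \<le> (\<integral>\<^sup>+y. ennreal (F y - \<mu> * u y) \<partial>lborel)"
      proof (rule nn_integral_mono)
        fix y
        have "ennreal \<bar>g y\<bar> * ?f (u y) \<le> ennreal (F y - \<mu> * u y)"
          using ennreal_leI[OF pt[of y]] by (simp add: ennreal_mult')
        then show "ennreal \<bar>g y\<bar> * ?f (u y) * indicator {x1<..<x0} y + ennreal \<bar>g y\<bar> * ?f (u y) * indicator {x0<..<x2} y \<le> ennreal (F y - \<mu> * u y)"
          by (auto simp: indicator_def)
      qed
      finally show ?thesis using G by simp
    qed
    \<comment> \<open>\<open>u\<close> need not reach 0, which is why levels were kept above a
      positive \<open>d\<close>; that margin now disappears.\<close>
    have "(\<integral>\<^sup>+t\<in>{0<..<s}. 2 * ennreal (slope z \<mu> t) \<partial>lborel) \<le> ennreal (E - \<mu> * w)"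
    proof (rule nn_integral_Ioo_le)
      fix c d :: real assume cd: "0 < c" "d < s"
      have "(\<integral>\<^sup>+t\<in>{c<..<d}. 2 * ennreal (slope z \<mu> t) \<partial>lborel) \<le> (\<integral>\<^sup>+t\<in>{c<..<s}. 2 * ennreal (slope z \<mu> t) \<partial>lborel)"
        using cd by (intro nn_integral_mono) (auto simp: indicator_def)
      also have "\<dots> \<le> ennreal (E - \<mu> * w)"
        using half[OF cd(1)] by (simp add: nn_integral_cmult mult.assoc)
      finally show "(\<integral>\<^sup>+t\<in>{c<..<d}. 2 * ennreal (slope z \<mu> t) \<partial>lborel) \<le> ennreal (E - \<mu> * w)" .
    qed auto
    then show ?thesis by (simp add: nn_integral_cmult mult.assoc)
  qed
  show thesis by (rule that[OF h hK zh key])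
qed

end

section \<open>Profiles with prescribed superlevel widths\<close>

text \<open>The even nonincreasing profile with plateau \<open>[-p, p]\<close> at height \<open>h\<close> whose superlevel set
  at height \<open>s\<close> has half-width \<open>p + \<integral>\<^sub>s\<^sup>h v\<close>, so that it descends with speed \<open>1 / v\<close>.\<close>

locale profile =
  fixes h p :: real and v :: "real \<Rightarrow> real"
  assumes h_pos: "0 < h" and p_nonneg: "0 \<le> p"
    and v_measurable[measurable]: "v \<in> borel_measurable borel"
    and v_pos: "0 < s \<Longrightarrow> s < h \<Longrightarrow> 0 < v s"
    and v_finite: "0 < c \<Longrightarrow> (\<integral>\<^sup>+t\<in>{c<..<h}. ennreal (v t) \<partial>lborel) < \<infinity>"
begin

text \<open>Extended values, since at level 0 the width is infinite when the profile never reaches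
  0.\<close>

definition width :: "real \<Rightarrow> ennreal" where
  "width s = (\<integral>\<^sup>+t\<in>{s<..<h}. ennreal (v t) \<partial>lborel)"

definition levels :: "real \<Rightarrow> real set" where
  "levels y = {s. 0 < s \<and> s < h \<and> ennreal \<bar>y\<bar> < ennreal p + width s}"

text \<open>The generalized inverse of the decreasing map from a level to its half-width. Inserting
  0 supplies the value outside the support, where \<open>levels y\<close> is empty.\<close>

definition shape :: "real \<Rightarrow> real" where
  "shape y = Sup (insert 0 (levels y))"

text \<open>The value 0 at the levels 0 and \<open>h\<close> accounts for the flat pieces, the
  complement of the support and the plateau.\<close>

definition speed :: "real \<Rightarrow> real" where
  "speed s = (if 0 < s \<and> s < h then 1 / v s else 0)"

lemma width_antimono: "s \<le> t \<Longrightarrow> width t \<le> width s"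
  unfolding width_def by (intro nn_integral_mono) (auto simp: indicator_def)

lemma bdd_levels: "bdd_above (insert 0 (levels y))"
  unfolding levels_def by (auto intro!: bdd_aboveI[of _ h] simp: h_pos less_imp_le)

lemma shape_nonneg: "0 \<le> shape y"
  unfolding shape_def using bdd_levels by (intro cSup_upper) auto

lemma shape_le: "shape y \<le> h"
  unfolding shape_def using h_pos by (intro cSup_least) (auto simp: levels_def)

lemma shape_antimono: "\<bar>x\<bar> \<le> \<bar>y\<bar> \<Longrightarrow> shape y \<le> shape x"
  unfolding shape_def using bdd_levels
  by (intro cSup_subset_mono) (auto simp: levels_def intro: le_less_trans[OF ennreal_leI])

lemma shape_even: "shape (- y) = shape y"
  by (simp add: shape_def levels_def)

lemma shape_measurable[measurable]: "shape \<in> borel_measurable borel"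
proof -
  have "mono (\<lambda>y. - shape (max y 0))" by (auto intro!: monoI shape_antimono)
  then have m: "(\<lambda>y. - shape (max y 0)) \<in> borel_measurable borel" by (rule borel_measurable_mono)
  have "(\<lambda>y. - (- shape (max \<bar>y\<bar> 0))) \<in> borel_measurable borel"
    by (intro borel_measurable_uminus measurable_compose[OF _ m]) auto
  moreover have "(\<lambda>y. - (- shape (max \<bar>y\<bar> 0))) = shape"
    by (auto simp: shape_def levels_def)
  ultimately show ?thesis by simp
qed

lemma speed_measurable[measurable]: "speed \<in> borel_measurable borel"
  unfolding speed_def by measurable

lemma speed_nonneg: "0 \<le> speed s"
  using v_pos[of s] by (auto simp: speed_def less_imp_le)

text \<open>Exhausting \<open>{s<..<h}\<close> shows that \<open>width\<close> is continuous from
  the right, so a strict inequality at level \<open>s\<close> survives at a slightly higher level.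
  This makes the superlevel sets open intervals of exactly the prescribed width.\<close>

lemma less_shape_iff:
  assumes s: "0 < s" "s < h"
  shows "s < shape y \<longleftrightarrow> ennreal \<bar>y\<bar> < ennreal p + width s"
proof
  assume "s < shape y"
  then obtain s' where "s' \<in> insert 0 (levels y)" "s < s'"
    unfolding shape_def using bdd_levels less_cSup_iff[of "insert 0 (levels y)" s] by auto
  then have "ennreal \<bar>y\<bar> < ennreal p + width s'" using s by (auto simp: levels_def)
  also have "\<dots> \<le> ennreal p + width s" using \<open>s < s'\<close> by (intro add_left_mono width_antimono) simp
  finally show "ennreal \<bar>y\<bar> < ennreal p + width s" .
next
  assume y: "ennreal \<bar>y\<bar> < ennreal p + width s"
  have "\<exists>c>s. ennreal (\<bar>y\<bar> - p) < width c \<or> \<bar>y\<bar> < p"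
  proof (rule ccontr)
    assume c: "\<not> ?thesis"
    have "(\<integral>\<^sup>+t\<in>{s<..<h}. ennreal (v t) \<partial>lborel) \<le> ennreal (\<bar>y\<bar> - p)"
    proof (rule nn_integral_Ioo_le)
      fix a b assume ab: "s < a" "b < h"
      have "(\<integral>\<^sup>+t\<in>{a<..<b}. ennreal (v t) \<partial>lborel) \<le> width a"
        unfolding width_def using ab by (intro nn_integral_mono) (auto simp: indicator_def)
      also have "\<dots> \<le> ennreal (\<bar>y\<bar> - p)" using c ab(1) not_less by blast
      finally show "(\<integral>\<^sup>+t\<in>{a<..<b}. ennreal (v t) \<partial>lborel) \<le> ennreal (\<bar>y\<bar> - p)" .
    qed auto
    then have "ennreal p + width s \<le> ennreal p + ennreal (\<bar>y\<bar> - p)"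
      unfolding width_def by (rule add_left_mono)
    moreover have "p \<le> \<bar>y\<bar>" using c gt_ex[of s] not_less by blast
    ultimately have "ennreal p + width s \<le> ennreal \<bar>y\<bar>"
      using p_nonneg by (simp add: ennreal_plus[symmetric] del: ennreal_plus)
    then show False using y by simp
  qed
  then obtain c where c: "c > s" "ennreal (\<bar>y\<bar> - p) < width c \<or> \<bar>y\<bar> < p" by blast
  \<comment> \<open>The level \<open>c\<close> may lie above \<open>h\<close> when \<open>y\<close>
    is inside the plateau; lowering it restores \<open>c' < h\<close> and can only increase
    \<open>width\<close>.\<close>
  define c' where "c' = min c ((s + h) / 2)"
  have c': "s < c'" "c' < h" "c' \<le> c" using c s by (auto simp: c'_def min_less_iff_disj)
  have "ennreal \<bar>y\<bar> < ennreal p + width c'"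
  proof (cases "\<bar>y\<bar> < p")
    case True
    then have "ennreal \<bar>y\<bar> < ennreal p" by (simp add: ennreal_less_iff)
    also have "\<dots> \<le> ennreal p + width c'" by simp
    finally show ?thesis .
  next
    case False
    then have "ennreal (\<bar>y\<bar> - p) < width c'" using c(2) width_antimono[OF c'(3)] by (auto intro: less_le_trans)
    then have "ennreal p + ennreal (\<bar>y\<bar> - p) < ennreal p + width c'"
      by (simp add: ennreal_add_left_cancel_less)
    then show ?thesis using False p_nonneg by (simp add: ennreal_plus[symmetric] del: ennreal_plus)
  qed
  then have "c' \<in> levels y" using c' s by (auto simp: levels_def)
  then have "c' \<le> shape y" unfolding shape_def using bdd_levels by (intro cSup_upper) auto
  then show "s < shape y" using c' by simp
qed

lemma shape_plateau: assumes "\<bar>y\<bar> < p" shows "shape y = h"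
proof (rule antisym[OF shape_le], rule ccontr)
  assume "\<not> h \<le> shape y"
  then obtain s where s: "shape y < s" "s < h" using dense[of "shape y" h] by auto
  have "0 < s" using s shape_nonneg[of y] by linarith
  have "ennreal \<bar>y\<bar> < ennreal p" using assms by (simp add: ennreal_less_iff)
  then have "ennreal \<bar>y\<bar> < ennreal p + width s" by (rule less_le_trans) simp
  then show False using less_shape_iff[of s y] s \<open>0 < s\<close> by simp
qed

text \<open>As \<open>v\<close> is positive, every positive level below \<open>h\<close> has
  positive width, so the peak is reached even without a plateau. This makes the energy density right
  also at 0, where \<open>sgn\<close> vanishes.\<close>

lemma shape_zero: "shape 0 = h"
proof (rule antisym[OF shape_le], rule ccontr)
  assume "\<not> h \<le> shape 0"
  then obtain s where s: "shape 0 < s" "s < h" using dense[of "shape 0" h] by auto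
  have "0 < s" using s shape_nonneg[of 0] by linarith
  have "width s \<noteq> 0"
  proof
    assume "width s = 0"
    then have "AE t in lborel. ennreal (v t) * indicator {s<..<h} t = 0"
      unfolding width_def by (subst (asm) nn_integral_0_iff_AE) auto
    then have "AE t in lborel. t \<notin> {s<..<h}"
    proof eventually_elim
      case (elim t)
      show ?case
      proof
        assume t: "t \<in> {s<..<h}"
        then have "0 < v t" using \<open>0 < s\<close> by (intro v_pos) auto
        then show False using elim t by simp
      qed
    qed
    then have "emeasure lborel {s<..<h} = 0"
      by (subst (asm) AE_iff_measurable[where N="{s<..<h}"]) auto
    then show False using s by simp
  qed
  then have "ennreal \<bar>0\<bar> < ennreal p + width s" by (simp add: zero_less_iff_neq_zero)
  then show False using less_shape_iff[of s 0] s \<open>0 < s\<close> by simp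
qed

text \<open>Outside the plateau the superlevel set at level \<open>s\<close> has measure twice
  \<open>width s\<close>, one copy per flank, so \<open>shape\<close> carries Lebesgue measure to
  the density \<open>2 * v\<close>. Staying above \<delta> keeps the measures finite on half-lines,
  which then determine them.\<close>

lemma push_forward_above:
  assumes \<delta>: "0 < \<delta>" and F[measurable]: "F \<in> borel_measurable borel"
  shows "(\<integral>\<^sup>+y\<in>{y. p < \<bar>y\<bar> \<and> \<delta> < shape y}. F (shape y) \<partial>lborel)
    = (\<integral>\<^sup>+t\<in>{\<delta><..<h}. 2 * ennreal (v t) * F t \<partial>lborel)"
proof -
  define D where "D = density lborel (indicator {y. p < \<bar>y\<bar> \<and> \<delta> < shape y} :: real \<Rightarrow> ennreal)"
  define M where "M = distr D borel shape"
  define N where "N = density lborel (\<lambda>t. 2 * ennreal (v t) * indicator {\<delta><..<h} t)"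
  have [measurable]: "shape \<in> measurable D borel" unfolding D_def by simp
  have eN: "emeasure N {s<..} = 2 * width (max s \<delta>)" for s
    unfolding N_def width_def
    by (subst emeasure_density, simp, simp, subst nn_integral_cmult[symmetric])
       (auto intro!: nn_integral_cong simp: indicator_def)
  have eM: "emeasure M {s<..} = 2 * width (max s \<delta>)" for s
  proof -
    have "emeasure M {s<..} = emeasure D (shape -` {s<..})"
      unfolding M_def by (subst emeasure_distr) (auto simp: D_def)
    also have "\<dots> = emeasure lborel {y. p < \<bar>y\<bar> \<and> max s \<delta> < shape y}"
    proof -
      have [measurable]: "shape -` {s<..} \<in> sets borel" using measurable_sets_borel[OF shape_measurable, of "{s<..}"] by simp
      have "emeasure D (shape -` {s<..}) = (\<integral>\<^sup>+y. indicator {y. p < \<bar>y\<bar> \<and> \<delta> < shape y} y * indicator (shape -` {s<..}) y \<partial>lborel)"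
        unfolding D_def by (rule emeasure_density) auto
      also have "\<dots> = (\<integral>\<^sup>+y. indicator {y. p < \<bar>y\<bar> \<and> max s \<delta> < shape y} y \<partial>lborel)"
        by (intro nn_integral_cong) (auto simp: indicator_def)
      also have "\<dots> = emeasure lborel {y. p < \<bar>y\<bar> \<and> max s \<delta> < shape y}"
        by (rule nn_integral_indicator) measurable
      finally show ?thesis .
    qed
    also have "\<dots> = 2 * width (max s \<delta>)"
    proof (cases "max s \<delta> < h")
      case False
      then have "shape y \<le> max s \<delta>" for y using shape_le[of y] by linarith
      then have "{y. p < \<bar>y\<bar> \<and> max s \<delta> < shape y} = {}" using leD by blast
      moreover have "{max s \<delta><..<h} = {}" using False by (intro greaterThanLessThan_empty) linarith
      then have "width (max s \<delta>) = 0" unfolding width_def by (simp only:) simp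
      ultimately show ?thesis by (simp only: emeasure_empty mult_zero_right)
    next
      case True
      define c where "c = max s \<delta>"
      have c: "0 < c" "c < h" using True \<delta> by (auto simp: c_def)
      have "width c < \<infinity>" unfolding width_def by (rule v_finite[OF c(1)])
      then obtain r where r: "width c = ennreal r" "0 \<le> r"
        by (metis ennreal_cases infinity_ennreal_def less_irrefl)
      have iff: "c < shape y \<longleftrightarrow> \<bar>y\<bar> < p + r" for y
        using less_shape_iff[OF c, of y] r p_nonneg
        by (simp add: ennreal_plus[symmetric] ennreal_less_iff del: ennreal_plus)
      have "p < \<bar>y\<bar> \<and> \<bar>y\<bar> < p + r \<longleftrightarrow> (p < y \<and> y < p + r) \<or> (-(p+r) < y \<and> y < -p)" for y
        using p_nonneg by linarith
      then have "{y. p < \<bar>y\<bar> \<and> c < shape y} = {p<..<p + r} \<union> {-(p+r)<..<-p}"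
        unfolding iff by (simp only: set_eq_iff Un_iff mem_Collect_eq greaterThanLessThan_iff simp_thms)
      moreover have "emeasure lborel ({p<..<p + r} \<union> {-(p+r)<..<-p}) = emeasure lborel {p<..<p + r} + emeasure lborel {-(p+r)<..<-p}"
        using p_nonneg by (intro plus_emeasure[symmetric]) auto
      moreover have "\<dots> = ennreal r + ennreal r" using r p_nonneg by simp
      ultimately show ?thesis unfolding c_def[symmetric] r(1) mult_2 by simp
    qed
    finally show ?thesis .
  qed
  have "M = N"
  proof (rule measure_eqI_lessThan)
    fix s
    have "width (max s \<delta>) < \<infinity>" unfolding width_def using \<delta> by (intro v_finite) auto
    then show "emeasure M {s<..} < \<infinity>" unfolding eM by (simp add: ennreal_mult_less_top)
  qed (auto simp: eM eN, auto simp: M_def N_def)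
  have "(\<integral>\<^sup>+y\<in>{y. p < \<bar>y\<bar> \<and> \<delta> < shape y}. F (shape y) \<partial>lborel) = integral\<^sup>N D (\<lambda>y. F (shape y))"
    unfolding D_def by (subst nn_integral_density) (auto simp: mult.commute)
  also have "\<dots> = integral\<^sup>N N F"
    unfolding \<open>M = N\<close>[symmetric] M_def by (subst nn_integral_distr) auto
  also have "\<dots> = (\<integral>\<^sup>+t\<in>{\<delta><..<h}. 2 * ennreal (v t) * F t \<partial>lborel)"
    unfolding N_def by (subst nn_integral_density) (auto simp: ac_simps intro!: nn_integral_cong)
  finally show ?thesis .
qed

text \<open>The margin \<delta> is removed and the plateau added, an atom of weight
  \<open>2 * p\<close> at level \<open>h\<close>. Level 0 may be taken on a set of infinite measure,
  whence the condition \<open>F 0 = 0\<close>.\<close>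

lemma push_forward:
  assumes F[measurable]: "F \<in> borel_measurable borel" and F0: "F 0 = 0"
  shows "(\<integral>\<^sup>+y. F (shape y) \<partial>lborel)
    = (\<integral>\<^sup>+t\<in>{0<..<h}. 2 * ennreal (v t) * F t \<partial>lborel) + ennreal (2 * p) * F h"
proof -
  have "(\<integral>\<^sup>+y. F (shape y) \<partial>lborel)
    = (\<integral>\<^sup>+y. F (shape y) * indicator {y. p < \<bar>y\<bar>} y + F h * indicator {-p..p} y \<partial>lborel)"
  proof (rule nn_integral_cong_AE)
    have "AE y in lborel. y \<noteq> p \<and> y \<noteq> -p" using AE_lborel_singleton[of p] AE_lborel_singleton[of "-p"] by auto
    then show "AE y in lborel. F (shape y) = F (shape y) * indicator {y. p < \<bar>y\<bar>} y + F h * indicator {-p..p} y"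
    proof eventually_elim
      case (elim y)
      then consider "\<bar>y\<bar> < p" | "p < \<bar>y\<bar>" by linarith
      then show ?case
      proof cases
        case 1
        then have "y \<in> {-p..p}" by auto
        then show ?thesis using 1 shape_plateau[OF 1] by simp
      next
        case 2
        then have "y \<notin> {-p..p}" by auto
        then show ?thesis using 2 by simp
      qed
    qed
  qed
  also have "\<dots> = (\<integral>\<^sup>+y\<in>{y. p < \<bar>y\<bar>}. F (shape y) \<partial>lborel) + F h * ennreal (2 * p)"
    using p_nonneg by (subst nn_integral_add) (auto simp: nn_integral_cmult)
  also have "(\<integral>\<^sup>+y\<in>{y. p < \<bar>y\<bar>}. F (shape y) \<partial>lborel) = (\<integral>\<^sup>+t\<in>{0<..<h}. 2 * ennreal (v t) * F t \<partial>lborel)"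
    (is "?L = ?R")
  proof (rule antisym)
    have "(\<integral>\<^sup>+y\<in>{y. p < \<bar>y\<bar> \<and> 0 < shape y}. F (shape y) \<partial>lborel) \<le> ?R"
    proof (rule nn_integral_exhaustion_le[where A="\<lambda>n. {y. p < \<bar>y\<bar> \<and> 1 / real (Suc n) < shape y}"])
      show "incseq (\<lambda>n. {y. p < \<bar>y\<bar> \<and> 1 / real (Suc n) < shape y})"
      proof (rule monoI)
        fix m n :: nat assume "m \<le> n"
        then have "1 / real (Suc n) \<le> 1 / real (Suc m)" by (simp add: frac_le)
        then show "{y. p < \<bar>y\<bar> \<and> 1 / real (Suc m) < shape y} \<le> {y. p < \<bar>y\<bar> \<and> 1 / real (Suc n) < shape y}"
          by (auto simp del: of_nat_Suc)
      qed
      have pos: "0 < 1 / real (Suc n)" for n by simp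
      show "(\<Union>n. {y. p < \<bar>y\<bar> \<and> 1 / real (Suc n) < shape y}) = {y. p < \<bar>y\<bar> \<and> 0 < shape y}"
      proof (intro equalityI subsetI)
        fix y assume "y \<in> {y. p < \<bar>y\<bar> \<and> 0 < shape y}"
        moreover then obtain n where "1 / real (Suc n) < shape y" using nat_approx_posE[of "shape y"] by auto
        ultimately show "y \<in> (\<Union>n. {y. p < \<bar>y\<bar> \<and> 1 / real (Suc n) < shape y})" by blast
      next
        fix y assume "y \<in> (\<Union>n. {y. p < \<bar>y\<bar> \<and> 1 / real (Suc n) < shape y})"
        then obtain n where "p < \<bar>y\<bar>" "1 / real (Suc n) < shape y" by blast
        then show "y \<in> {y. p < \<bar>y\<bar> \<and> 0 < shape y}" using pos[of n] less_trans by blast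
      qed
      show "(\<integral>\<^sup>+y\<in>{y. p < \<bar>y\<bar> \<and> 1 / real (Suc n) < shape y}. F (shape y) \<partial>lborel) \<le> ?R" for n
      proof -
        have "(\<integral>\<^sup>+t\<in>{c<..<h}. 2 * ennreal (v t) * F t \<partial>lborel) \<le> ?R" if "0 < c" for c
          using that by (intro nn_integral_mono) (auto simp: indicator_def)
        then show ?thesis unfolding push_forward_above[OF pos[of n] F] using pos[of n] by blast
      qed
    qed auto
    moreover have "?L = (\<integral>\<^sup>+y\<in>{y. p < \<bar>y\<bar> \<and> 0 < shape y}. F (shape y) \<partial>lborel)"
      using shape_nonneg F0 by (intro nn_integral_cong) (auto simp: indicator_def order_less_le)
    ultimately show "?L \<le> ?R" by simp
    show "?R \<le> ?L"
    proof (rule nn_integral_Ioo_le)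
      fix c d :: real assume cd: "0 < c" "d < h"
      have "(\<integral>\<^sup>+t\<in>{c<..<d}. 2 * ennreal (v t) * F t \<partial>lborel) \<le> (\<integral>\<^sup>+t\<in>{c<..<h}. 2 * ennreal (v t) * F t \<partial>lborel)"
        using cd by (intro nn_integral_mono) (auto simp: indicator_def)
      also have "\<dots> = (\<integral>\<^sup>+y\<in>{y. p < \<bar>y\<bar> \<and> c < shape y}. F (shape y) \<partial>lborel)"
        by (rule push_forward_above[OF cd(1) F, symmetric])
      also have "\<dots> \<le> ?L" by (intro nn_integral_mono) (auto simp: indicator_def)
      finally show "(\<integral>\<^sup>+t\<in>{c<..<d}. 2 * ennreal (v t) * F t \<partial>lborel) \<le> ?L" .
    qed auto
  qed
  finally show ?thesis by (simp add: mult.commute)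
qed

text \<open>The densities \<open>v\<close> and \<open>speed\<close> cancel: weighted by its speed,
  the profile passes each level between 0 and \<open>h\<close> once per flank.\<close>

lemma push_forward_speed:
  assumes A[measurable]: "A \<in> sets borel"
  shows "(\<integral>\<^sup>+y. ennreal (speed (shape y)) * indicator A (shape y) \<partial>lborel) = 2 * emeasure lborel ({0<..<h} \<inter> A)"
proof -
  have "(\<integral>\<^sup>+y. ennreal (speed (shape y)) * indicator A (shape y) \<partial>lborel)
    = (\<integral>\<^sup>+t\<in>{0<..<h}. 2 * ennreal (v t) * (ennreal (speed t) * indicator A t) \<partial>lborel)
      + ennreal (2 * p) * (ennreal (speed h) * indicator A h)"
    by (rule push_forward) (auto simp: speed_def)
  also have "\<dots> = (\<integral>\<^sup>+t. 2 * indicator ({0<..<h} \<inter> A) t \<partial>lborel)"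
  proof -
    have "2 * ennreal (v t) * (ennreal (speed t) * indicator A t) * indicator {0<..<h} t = 2 * indicator ({0<..<h} \<inter> A) t" for t
    proof (cases "t \<in> {0<..<h}")
      case True
      then have "0 < v t" using v_pos by auto
      then have "ennreal (v t) * ennreal (speed t) = 1"
        using True by (simp add: speed_def ennreal_mult'[symmetric])
      then show ?thesis using True by (simp add: mult.assoc[symmetric] mult.assoc[of 2] indicator_inter_arith)
    qed auto
    then show ?thesis by (simp add: speed_def)
  qed
  finally show ?thesis by (simp add: nn_integral_cmult)
qed

text \<open>Points with \<open>a < \<bar>y\<bar>\<close> and \<open>\<bar>y\<bar> < b\<close> have
  levels between \<open>shape b\<close> and \<open>shape a\<close>, and levels strictly between
  these come only from such points. The two resulting bounds differ by end points, which are null;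
  evenness halves the result. Continuity of \<open>shape\<close> is a consequence, not an
  ingredient.\<close>

lemma descent:
  assumes ab: "0 \<le> a" "a \<le> b"
  shows "(\<integral>\<^sup>+y\<in>{a<..<b}. ennreal (speed (shape y)) \<partial>lborel) = ennreal (shape a - shape b)"
proof -
  let ?f = "\<lambda>y. ennreal (speed (shape y))"
  have sab: "shape b \<le> shape a" using ab by (intro shape_antimono) auto
  have lo: "2 * emeasure lborel ({0<..<h} \<inter> {shape b<..<shape a}) = 2 * ennreal (shape a - shape b)"
  proof -
    have "{0<..<h} \<inter> {shape b<..<shape a} = {shape b<..<shape a}"
      using shape_nonneg[of b] shape_le[of a] by auto
    then show ?thesis using sab by simp
  qed
  have hi: "2 * emeasure lborel ({0<..<h} \<inter> {shape b..shape a}) \<le> 2 * ennreal (shape a - shape b)"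
  proof -
    have "emeasure lborel ({0<..<h} \<inter> {shape b..shape a}) \<le> emeasure lborel {shape b..shape a}"
      by (intro emeasure_mono) auto
    then show ?thesis using sab by (intro mult_left_mono) auto
  qed
  have ltD: "\<bar>x\<bar> < \<bar>y\<bar>" if "shape y < shape x" for x y
    using shape_antimono[of y x] that by linarith
  have eq2: "(\<integral>\<^sup>+y\<in>{y. a < \<bar>y\<bar> \<and> \<bar>y\<bar> < b}. ?f y \<partial>lborel) = 2 * ennreal (shape a - shape b)" (is "?I = _")
  proof (rule antisym)
    have "?I \<le> (\<integral>\<^sup>+y. ?f y * indicator {shape b..shape a} (shape y) \<partial>lborel)"
      using ab by (intro nn_integral_mono) (auto simp: indicator_def intro!: shape_antimono)
    also have "\<dots> = 2 * emeasure lborel ({0<..<h} \<inter> {shape b..shape a})"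
      by (rule push_forward_speed) simp
    also have "\<dots> \<le> 2 * ennreal (shape a - shape b)" by (rule hi)
    finally show "?I \<le> 2 * ennreal (shape a - shape b)" .
    have "2 * ennreal (shape a - shape b) = (\<integral>\<^sup>+y. ?f y * indicator {shape b<..<shape a} (shape y) \<partial>lborel)"
      unfolding lo[symmetric] by (rule push_forward_speed[symmetric]) simp
    also have "\<dots> \<le> ?I"
    proof (rule nn_integral_mono)
      fix y
      show "?f y * indicator {shape b<..<shape a} (shape y) \<le> ?f y * indicator {y. a < \<bar>y\<bar> \<and> \<bar>y\<bar> < b} y"
        using ltD[of b y] ltD[of y a] ab by (auto simp: indicator_def)
    qed
    finally show "2 * ennreal (shape a - shape b) \<le> ?I" .
  qed
  have refl: "(\<integral>\<^sup>+y\<in>{-b<..<-a}. ?f y \<partial>lborel) = (\<integral>\<^sup>+y\<in>{a<..<b}. ?f y \<partial>lborel)"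
    by (subst nn_integral_real_affine[where c="-1" and t=0])
       (auto intro!: nn_integral_cong simp: indicator_def shape_even)
  have "?I = (\<integral>\<^sup>+y. ?f y * indicator {a<..<b} y + ?f y * indicator {-b<..<-a} y \<partial>lborel)"
    using ab by (intro nn_integral_cong) (auto simp: indicator_def)
  also have "\<dots> = 2 * (\<integral>\<^sup>+y\<in>{a<..<b}. ?f y \<partial>lborel)"
    by (subst nn_integral_add) (auto simp: refl mult_2)
  finally show ?thesis using eq2 by (simp add: ennreal_mult_cancel_left)
qed

lemma is_primitive_shape: "is_primitive shape (\<lambda>y. - sgn y * speed (shape y))"
proof -
  define g where "g y = - sgn y * speed (shape y)" for y
  have [measurable]: "g \<in> borel_measurable borel" unfolding g_def by measurable
  have "(\<integral>\<^sup>+y. ennreal (speed (shape y)) \<partial>lborel) = 2 * emeasure lborel ({0<..<h} \<inter> UNIV)"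
    using push_forward_speed[of UNIV] by simp
  then have "integrable lborel (\<lambda>y. speed (shape y))"
    using h_pos speed_nonneg by (intro integrableI_bounded) (auto simp: ennreal_mult_less_top)
  then have gi: "integrable lborel g"
    by (rule Bochner_Integration.integrable_bound) (auto simp: g_def abs_mult sgn_if)
  have g: "loc_integrable g"
    unfolding loc_integrable_def set_integrable_def using integrable_mult_indicator[OF _ gi] by auto
  obtain G where G: "is_primitive G g" using loc_integrable_ex_primitive[OF g] .
  have right: "(LINT y:{a..b}|lborel. g y) = shape b - shape a" if ab: "0 \<le> a" "a \<le> b" for a b
  proof -
    have "(LINT y:{a..b}|lborel. g y) = (LINT y|lborel. - (speed (shape y) * indicator {a<..<b} y))"
      unfolding set_lebesgue_integral_def
    proof (rule integral_cong_AE)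
      have "AE y in lborel. y \<noteq> a \<and> y \<noteq> b" using AE_lborel_singleton[of a] AE_lborel_singleton[of b] by auto
      then show "AE y in lborel. indicator {a..b} y *\<^sub>R g y = - (speed (shape y) * indicator {a<..<b} y)"
        by eventually_elim (use ab in \<open>auto simp: g_def indicator_def sgn_if\<close>)
    qed auto
    also have "\<dots> = - enn2real (\<integral>\<^sup>+y\<in>{a<..<b}. ennreal (speed (shape y)) \<partial>lborel)"
      by (subst integral_minus, subst integral_eq_nn_integral)
         (auto simp: speed_nonneg indicator_def intro!: arg_cong[where f=enn2real] nn_integral_cong)
    also have "\<dots> = shape b - shape a"
      unfolding descent[OF ab] using ab by (simp add: shape_antimono)
    finally show ?thesis .
  qed
  have left: "(LINT y:{a..b}|lborel. g y) = shape b - shape a" if ab: "b \<le> 0" "a \<le> b" for a b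
  proof -
    have "(LINT y:{a..b}|lborel. g y) = (LINT y:{y. - y \<in> {a..b}}|lborel. g (- y))" by (rule set_integral_reflect)
    also have "{y. - y \<in> {a..b}} = {-b..-a}" by auto
    also have "(LINT y:{-b..-a}|lborel. g (- y)) = - (LINT y:{-b..-a}|lborel. g y)"
      by (simp add: set_lebesgue_integral_def g_def shape_even)
    also have "\<dots> = shape b - shape a" using right[of "-b" "-a"] ab by (simp add: shape_even)
    finally show ?thesis .
  qed
  \<comment> \<open>Comparison with a single primitive \<open>G\<close> at the base point 0 reduces
    intervals containing 0 to the two one-sided cases.\<close>
  have const: "shape y - G y = shape 0 - G 0" for y
  proof (cases "0 \<le> y")
    case True
    then have "G y - G 0 = shape y - shape 0" using G right[of 0 y] unfolding is_primitive_def by simp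
    then show ?thesis by simp
  next
    case False
    then have "G 0 - G y = shape 0 - shape y" using G left[of 0 y] unfolding is_primitive_def by simp
    then show ?thesis by simp
  qed
  have "shape b - shape a = G b - G a" for a b using const[of a] const[of b] by linarith
  then show ?thesis using G unfolding is_primitive_def g_def[symmetric] by simp
qed

end

section \<open>Energy of the optimal profile at a given height\<close>

definition bell_profile :: "real \<Rightarrow> (real \<Rightarrow> real) \<Rightarrow> bool" where
  "bell_profile w \<psi> \<longleftrightarrow> (\<forall>y. 0 \<le> \<psi> y) \<and> integrable lborel \<psi> \<and> (LINT y|lborel. \<psi> y) = w
    \<and> H1 \<psi> \<and> bounded (range \<psi>) \<and> continuous_on UNIV \<psi> \<and> (\<forall>y. \<psi> (- y) = \<psi> y)
    \<and> (\<forall>x y. 0 \<le> x \<longrightarrow> x \<le> y \<longrightarrow> \<psi> y \<le> \<psi> x)"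

context cost_rate
begin

lemma slope_nonneg:
  assumes "0 \<le> s" "\<mu> \<le> z s" shows "0 \<le> slope z \<mu> s"
  using assms by (simp add: slope_def)

lemma slope_antimono:
  assumes "0 \<le> s" "\<mu> \<le> \<nu>" shows "slope z \<nu> s \<le> slope z \<mu> s"
  unfolding slope_def using assms by (intro real_sqrt_le_mono mult_left_mono) auto

lemma slope_pos:
  assumes "0 < s" "\<mu> < z s" shows "0 < slope z \<mu> s"
  using assms by (simp add: slope_def)

lemma slope_square:
  assumes "0 \<le> s" "\<mu> \<le> z s" shows "(slope z \<mu> s)\<^sup>2 = 2 * s * (z s - \<mu>)"
  using assms by (simp add: slope_def)

text \<open>Here the integrability of \<open>sqrt (cz z phi)\<close> enters: it controls
  \<open>slope\<close> near 0, while \<open>z t \<le> z 1\<close> controls it beyond 1 and the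
  multiplier, of either sign, adds a bounded term.\<close>

lemma slope_integral_finite:
  assumes h: "0 < h" and \<mu>: "\<mu> \<le> z h"
  shows "(\<integral>\<^sup>+t\<in>{0<..<h}. ennreal (slope z \<mu> t) \<partial>lborel) < \<infinity>"
proof -
  define K where "K = sqrt (2 * (z 1 * h)) + sqrt (2 * h * \<bar>\<mu>\<bar>)"
  have K: "0 \<le> K" unfolding K_def using h z_nonneg[of 1] by simp
  have b: "slope z \<mu> t \<le> sqrt 2 * (sqrt (cz z t) * indicator {0..1} t) + K" if t: "0 < t" "t < h" for t
  proof -
    have c: "0 \<le> cz z t" using t by (intro cz_nonneg) auto
    have "slope z \<mu> t \<le> sqrt (2 * cz z t + 2 * h * \<bar>\<mu>\<bar>)"
    proof -
      have "- (t * \<mu>) \<le> h * \<bar>\<mu>\<bar>" using t mult_mono[of t h "-\<mu>" "\<bar>\<mu>\<bar>"]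
        by (smt (verit) mult_minus_right mult_mono)
      then show ?thesis unfolding slope_def by (intro real_sqrt_le_mono) (simp add: cz_eq algebra_simps)
    qed
    also have "\<dots> \<le> sqrt (2 * cz z t) + sqrt (2 * h * \<bar>\<mu>\<bar>)"
      using c h by (intro sqrt_add_le_add_sqrt) auto
    also have "sqrt (2 * cz z t) \<le> sqrt 2 * (sqrt (cz z t) * indicator {0..1} t) + sqrt (2 * (z 1 * h))"
    proof (cases "t \<le> 1")
      case True
      then show ?thesis using t h z_nonneg[of 1] by (simp add: real_sqrt_mult)
    next
      case False
      then have "z t * t \<le> z 1 * h" using t z_noninc[of 1 t] z_nonneg[of 1] by (intro mult_mono) auto
      then show ?thesis using False by (simp add: cz_eq)
    qed
    finally show ?thesis by (simp add: K_def)
  qed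
  have "(\<integral>\<^sup>+t\<in>{0<..<h}. ennreal (slope z \<mu> t) \<partial>lborel)
    \<le> (\<integral>\<^sup>+t. ennreal (sqrt 2) * (ennreal (sqrt (cz z t)) * indicator {0..1} t) + ennreal K * indicator {0<..<h} t \<partial>lborel)"
  proof (rule nn_integral_mono)
    fix t
    show "ennreal (slope z \<mu> t) * indicator {0<..<h} t \<le> ennreal (sqrt 2) * (ennreal (sqrt (cz z t)) * indicator {0..1} t) + ennreal K * indicator {0<..<h} t"
    proof (cases "t \<in> {0<..<h}")
      case True
      then have "ennreal (slope z \<mu> t) \<le> ennreal (sqrt 2 * (sqrt (cz z t) * indicator {0..1} t) + K)"
        using b by (intro ennreal_leI) auto
      also have "\<dots> = ennreal (sqrt 2) * (ennreal (sqrt (cz z t)) * indicator {0..1} t) + ennreal K"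
        using K cz_nonneg[of t] True by (auto simp: indicator_def ennreal_mult)
      finally show ?thesis using True by simp
    qed simp
  qed
  also have "\<dots> = ennreal (sqrt 2) * (\<integral>\<^sup>+t\<in>{0..1}. ennreal (sqrt (cz z t)) \<partial>lborel) + ennreal K * ennreal h"
    using h unfolding cz_eq by (subst nn_integral_add) (auto simp: nn_integral_cmult)
  also have "\<dots> < \<infinity>" using sqrt_int by (simp add: ennreal_mult_less_top)
  finally show ?thesis .
qed

text \<open>At speed \<open>slope z \<mu>\<close> Young's inequality is an equality: the energy
  density at level \<open>s\<close> is slope^2 + \<mu> s, and dividing by the speed gives slope plus
  \<mu> times the mass density. A plateau costs \<open>z h\<close> per unit of mass, which matches
  the multiplier when \<open>\<mu> = z h\<close>; hence the alternative in the hypotheses.\<close>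

lemma profile_energy:
  assumes h: "0 < h" and p: "0 \<le> p" and \<mu>: "\<mu> \<le> z h" and pos: "\<And>s. 0 < s \<Longrightarrow> s < h \<Longrightarrow> \<mu> < z s"
    and p0: "p = 0 \<or> \<mu> = z h"
    and m: "(\<integral>\<^sup>+s\<in>{0<..<h}. ennreal (s / slope z \<mu> s) \<partial>lborel) = ennreal m" "0 \<le> m" "2 * m + 2 * h * p = w"
    and T: "2 * (\<integral>\<^sup>+s\<in>{0<..<h}. ennreal (slope z \<mu> s) \<partial>lborel) \<le> ennreal (T - \<mu> * w)" "\<mu> * w \<le> T"
  shows "\<exists>\<psi>. bell_profile w \<psi> \<and> energy (cz z) \<psi> \<le> ennreal T"
proof -
  define v where "v s = 1 / slope z \<mu> s" for s
  have v_pos: "0 < v s" if "0 < s" "s < h" for s using slope_pos[OF that(1) pos[OF that]] by (simp add: v_def)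
  have [measurable]: "v \<in> borel_measurable borel" unfolding v_def by measurable
  interpret profile h p v
  proof
    fix c :: real assume c: "0 < c"
    \<comment> \<open>Above a positive level \<open>c\<close> the width density is at most
      \<open>1 / c\<close> times the mass density, so finite mass makes superlevel sets
      bounded.\<close>
    have "(\<integral>\<^sup>+t\<in>{c<..<h}. ennreal (v t) \<partial>lborel) \<le> (\<integral>\<^sup>+t. ennreal (1 / c) * (ennreal (t / slope z \<mu> t) * indicator {0<..<h} t) \<partial>lborel)"
    proof (rule nn_integral_mono)
      fix t
      show "ennreal (v t) * indicator {c<..<h} t \<le> ennreal (1 / c) * (ennreal (t / slope z \<mu> t) * indicator {0<..<h} t)"
      proof (cases "t \<in> {c<..<h}")
        case True
        then have "v t \<le> 1 / c * (t * v t)" using v_pos[of t] c by (simp add: field_simps)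
        then have "ennreal (v t) \<le> ennreal (1 / c * (t * v t))" by (rule ennreal_leI)
        also have "\<dots> = ennreal (1 / c) * ennreal (t / slope z \<mu> t)" using c
          by (subst ennreal_mult'[symmetric]) (auto simp: v_def)
        finally show ?thesis using True c by simp
      qed simp
    qed
    also have "\<dots> = ennreal (1 / c) * ennreal m" by (subst nn_integral_cmult) (auto simp: m(1))
    also have "\<dots> < \<infinity>" by (simp add: ennreal_mult_less_top)
    finally show "(\<integral>\<^sup>+t\<in>{c<..<h}. ennreal (v t) \<partial>lborel) < \<infinity>" .
  qed (use h p v_pos in auto)
  define g where "g y = - sgn y * speed (shape y)" for y
  have prim: "is_primitive shape g" using is_primitive_shape unfolding g_def .
  have wd: "weak_deriv shape g" by (rule is_primitive_weak_deriv[OF prim])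
  have [measurable]: "g \<in> borel_measurable borel" unfolding g_def by measurable
  have "(\<integral>\<^sup>+y. ennreal (shape y) \<partial>lborel) = (\<integral>\<^sup>+t\<in>{0<..<h}. 2 * ennreal (v t) * ennreal t \<partial>lborel) + ennreal (2 * p) * ennreal h"
    by (rule push_forward) auto
  also have "(\<integral>\<^sup>+t\<in>{0<..<h}. 2 * ennreal (v t) * ennreal t \<partial>lborel) = (\<integral>\<^sup>+t. 2 * (ennreal (t / slope z \<mu> t) * indicator {0<..<h} t) \<partial>lborel)"
  proof (rule nn_integral_cong)
    fix t
    show "2 * ennreal (v t) * ennreal t * indicator {0<..<h} t = 2 * (ennreal (t / slope z \<mu> t) * indicator {0<..<h} t)"
    proof (cases "t \<in> {0<..<h}")
      case True
      then have "ennreal (v t) * ennreal t = ennreal (t / slope z \<mu> t)"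
        using v_pos[of t] by (subst ennreal_mult[symmetric]) (auto simp: v_def)
      then show ?thesis using True by (simp add: mult.assoc)
    qed simp
  qed
  also have "\<dots> = 2 * ennreal m" by (subst nn_integral_cmult) (auto simp: m(1))
  also have "2 * ennreal m + ennreal (2 * p) * ennreal h = ennreal w"
  proof -
    have "2 * ennreal m = ennreal (2 * m)" using m(2) by (simp add: ennreal_mult)
    moreover have "ennreal (2 * p) * ennreal h = ennreal (2 * p * h)" using p h by (simp add: ennreal_mult)
    ultimately show ?thesis using m p h
      by (simp add: ennreal_plus[symmetric] algebra_simps del: ennreal_plus)
  qed
  finally have mass: "(\<integral>\<^sup>+y. ennreal (shape y) \<partial>lborel) = ennreal w" .
  have si: "integrable lborel shape"
    using mass shape_nonneg by (intro integrableI_bounded) auto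
  have w0: "0 \<le> w" using m p h by (metis add_nonneg_nonneg mult_nonneg_nonneg less_imp_le zero_le_numeral)
  have sw: "(LINT y|lborel. shape y) = w"
    using mass shape_nonneg w0 by (subst integral_eq_nn_integral) auto
  define J where "J = (LINT s|lborel. slope z \<mu> s * indicator {0<..<h} s)"
  define F where "F s = (speed s)\<^sup>2 / 2 + cz z s" for s
  have [measurable]: "F \<in> borel_measurable borel" unfolding F_def cz_eq by measurable
  have F0: "F 0 = 0" by (simp add: F_def speed_def cz_eq)
  have Fh: "F h = z h * h" by (simp add: F_def speed_def cz_eq)
  have Ji: "integrable lborel (\<lambda>s. slope z \<mu> s * indicator {0<..<h} s)" (is "integrable _ ?S")
  proof (rule integrableI_bounded)
    have "(\<integral>\<^sup>+s. ennreal (norm (?S s)) \<partial>lborel) = (\<integral>\<^sup>+t\<in>{0<..<h}. ennreal (slope z \<mu> t) \<partial>lborel)"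
      using slope_pos[OF _ pos] by (intro nn_integral_cong) (auto simp: indicator_def less_imp_le)
    also have "\<dots> < \<infinity>" by (rule slope_integral_finite[OF h \<mu>])
    finally show "(\<integral>\<^sup>+s. ennreal (norm (?S s)) \<partial>lborel) < \<infinity>" .
  qed auto
  have mi: "integrable lborel (\<lambda>s. s / slope z \<mu> s * indicator {0<..<h} s)" (is "integrable _ ?V")
  proof (rule integrableI_bounded)
    have "(\<integral>\<^sup>+s. ennreal (norm (?V s)) \<partial>lborel) = (\<integral>\<^sup>+s\<in>{0<..<h}. ennreal (s / slope z \<mu> s) \<partial>lborel)"
      using slope_pos[OF _ pos] by (intro nn_integral_cong) (auto simp: indicator_def less_imp_le)
    then show "(\<integral>\<^sup>+s. ennreal (norm (?V s)) \<partial>lborel) < \<infinity>" using m(1) by simp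
  qed auto
  have Jn: "(\<integral>\<^sup>+s\<in>{0<..<h}. ennreal (slope z \<mu> s) \<partial>lborel) = ennreal J"
  proof -
    have "(\<integral>\<^sup>+s\<in>{0<..<h}. ennreal (slope z \<mu> s) \<partial>lborel) = (\<integral>\<^sup>+s. ennreal (?S s) \<partial>lborel)"
      by (intro nn_integral_cong) (auto simp: indicator_def)
    also have "\<dots> = ennreal J" unfolding J_def using slope_pos[OF _ pos]
      by (intro nn_integral_eq_integral[OF Ji]) (auto simp: indicator_def less_imp_le)
    finally show ?thesis .
  qed
  have mn: "(LINT s|lborel. ?V s) = m"
  proof -
    have "(\<integral>\<^sup>+s. ennreal (?V s) \<partial>lborel) = ennreal m"
      unfolding m(1)[symmetric] by (intro nn_integral_cong) (auto simp: indicator_def)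
    then show ?thesis using m(2) slope_pos[OF _ pos]
      by (subst integral_eq_nn_integral) (auto simp: indicator_def less_imp_le)
  qed
  have J0: "0 \<le> J" unfolding J_def using slope_pos[OF _ pos]
    by (intro integral_nonneg_AE) (auto simp: indicator_def less_imp_le)
  have "energy (cz z) shape = (\<integral>\<^sup>+y. ennreal ((g y)\<^sup>2 / 2 + cz z \<bar>shape y\<bar>) \<partial>lborel)" by (rule energy_eq[OF wd])
  also have "\<dots> = (\<integral>\<^sup>+y. ennreal (F (shape y)) \<partial>lborel)"
  proof (rule nn_integral_cong)
    fix y
    have "(g y)\<^sup>2 = (speed (shape y))\<^sup>2"
    proof (cases "y = 0")
      case True
      then show ?thesis using shape_zero by (simp add: g_def speed_def)
    next
      case False
      then show ?thesis by (auto simp: g_def sgn_if)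
    qed
    then show "ennreal ((g y)\<^sup>2 / 2 + cz z \<bar>shape y\<bar>) = ennreal (F (shape y))"
      using shape_nonneg by (simp add: F_def)
  qed
  also have "\<dots> = (\<integral>\<^sup>+t\<in>{0<..<h}. 2 * ennreal (v t) * ennreal (F t) \<partial>lborel) + ennreal (2 * p) * ennreal (F h)"
    by (rule push_forward) (auto simp: F0)
  also have "(\<integral>\<^sup>+t\<in>{0<..<h}. 2 * ennreal (v t) * ennreal (F t) \<partial>lborel) = (\<integral>\<^sup>+t. ennreal (2 * (?S t + \<mu> * ?V t)) \<partial>lborel)"
  proof (rule nn_integral_cong)
    fix t
    show "2 * ennreal (v t) * ennreal (F t) * indicator {0<..<h} t = ennreal (2 * (?S t + \<mu> * ?V t))"
    proof (cases "t \<in> {0<..<h}")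
      case True
      then have sp: "0 < slope z \<mu> t" using slope_pos[OF _ pos] by auto
      have sq: "(slope z \<mu> t)\<^sup>2 = 2 * t * (z t - \<mu>)" using True pos[of t] by (intro slope_square) auto
      have "F t = (slope z \<mu> t)\<^sup>2 / 2 + z t * t" using True by (simp add: F_def speed_def v_def cz_eq)
      also have "\<dots> = (slope z \<mu> t)\<^sup>2 + \<mu> * t" unfolding sq by (simp add: field_simps)
      finally have "v t * F t = slope z \<mu> t + \<mu> * (t / slope z \<mu> t)"
        using sp by (simp add: v_def field_simps power2_eq_square)
      then have e: "2 * (v t * F t) = 2 * (?S t + \<mu> * ?V t)" using True by simp
      have "2 * ennreal (v t) * ennreal (F t) = ennreal (2 * (v t * F t))"
        using v_pos[of t] True by (simp add: ennreal_mult' mult.assoc)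
      then show ?thesis using True e by simp
    qed simp
  qed
  also have "\<dots> = ennreal (LINT t|lborel. 2 * (?S t + \<mu> * ?V t))"
  proof (rule nn_integral_eq_integral)
    show "integrable lborel (\<lambda>t. 2 * (?S t + \<mu> * ?V t))"
      by (intro integrable_mult_right Bochner_Integration.integrable_add Ji mi)
    \<comment> \<open>For negative \<mu> as well: slope^2 + \<mu> t = t z(t) + t (z(t) - \<mu>), a
      sum of nonnegative terms.\<close>
    have "0 \<le> ?S t + \<mu> * ?V t" for t
    proof (cases "t \<in> {0<..<h}")
      case True
      then have sp: "0 < slope z \<mu> t" using slope_pos[OF _ pos] by auto
      have sq: "(slope z \<mu> t)\<^sup>2 = 2 * t * (z t - \<mu>)" using True pos[of t] by (intro slope_square) auto
      have "0 \<le> 2 * t * z t" "0 \<le> t * (z t - \<mu>)" using True z_nonneg[of t] pos[of t] by auto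
      then have "0 \<le> (slope z \<mu> t)\<^sup>2 + \<mu> * t" unfolding sq by (simp add: algebra_simps)
      then have "0 \<le> ((slope z \<mu> t)\<^sup>2 + \<mu> * t) / slope z \<mu> t" using sp by simp
      also have "\<dots> = slope z \<mu> t + \<mu> * (t / slope z \<mu> t)" using sp by (simp add: field_simps power2_eq_square)
      finally show ?thesis using True by simp
    qed simp
    then show "AE t in lborel. 0 \<le> 2 * (?S t + \<mu> * ?V t)"
      by (intro AE_I2 mult_nonneg_nonneg) auto
  qed
  also have "(LINT t|lborel. 2 * (?S t + \<mu> * ?V t)) = 2 * (J + \<mu> * m)"
    by (simp only: integral_mult_right_zero Bochner_Integration.integral_add[OF Ji integrable_mult_right[OF mi]] mn J_def)
  also have "ennreal (2 * p) * ennreal (F h) = ennreal (2 * p * (\<mu> * h))"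
    using p0 p by (auto simp: Fh ennreal_mult')
  also have "ennreal (2 * (J + \<mu> * m)) + ennreal (2 * p * (\<mu> * h)) \<le> ennreal T"
  proof -
    have J2: "2 * J \<le> T - \<mu> * w"
    proof -
      have "2 * (\<integral>\<^sup>+s\<in>{0<..<h}. ennreal (slope z \<mu> s) \<partial>lborel) = ennreal (2 * J)"
        unfolding Jn using J0 by (simp add: ennreal_mult)
      then show ?thesis using T by (simp add: ennreal_le_iff)
    qed
    have "0 \<le> 2 * p * (\<mu> * h)" using p0 p h z_nonneg[of h] by auto
    moreover have "2 * (J + \<mu> * m) + 2 * p * (\<mu> * h) = 2 * J + \<mu> * w" unfolding m(3)[symmetric] by (simp add: algebra_simps)
    ultimately show ?thesis
    \<comment> \<open>\<open>ennreal\<close> truncates negative reals, so adding the two parts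
      requires their signs. A negative first part would force \<mu> to be negative, hence
      \<open>p = 0\<close>, and then the left-hand side is 0.\<close>
    proof (cases "0 \<le> 2 * (J + \<mu> * m)")
      case True
      then have "ennreal (2 * (J + \<mu> * m)) + ennreal (2 * p * (\<mu> * h)) = ennreal (2 * J + \<mu> * w)"
        using \<open>0 \<le> 2 * p * (\<mu> * h)\<close> \<open>_ = 2 * J + \<mu> * w\<close> by (simp only: ennreal_plus[symmetric])
      then show ?thesis using J2 by (simp only:) (intro ennreal_leI, linarith)
    next
      case False
      have "\<mu> \<ge> 0 \<or> p = 0" using p0 z_nonneg[of h] h by auto
      then have "p = 0" using False J0 m(2) by (metis add_nonneg_nonneg mult_nonneg_nonneg zero_le_numeral)
      then show ?thesis using False by (simp add: ennreal_neg)
    qed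
  qed
  finally have en: "energy (cz z) shape \<le> ennreal T" .
  have "bell_profile w shape"
    unfolding bell_profile_def
  proof (intro conjI allI impI)
    show "0 \<le> shape y" for y by (rule shape_nonneg)
    show "integrable lborel shape" by (rule si)
    show "(LINT y|lborel. shape y) = w" by (rule sw)
    show "bounded (range shape)" unfolding bounded_iff using shape_nonneg shape_le by (auto intro!: exI[of _ h])
    show "continuous_on UNIV shape" by (rule is_primitive_continuous[OF prim])
    show "shape (- y) = shape y" for y by (rule shape_even)
    show "shape y \<le> shape x" if "0 \<le> x" "x \<le> y" for x y using that by (intro shape_antimono) auto
    have s2: "integrable lborel (\<lambda>y. (shape y)\<^sup>2)"
      using integrable_mult_right[OF si, of h]
    proof (rule Bochner_Integration.integrable_bound)
      have "(shape y)\<^sup>2 \<le> h * shape y" for y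
        using shape_nonneg[of y] shape_le[of y] by (simp add: power2_eq_square mult_right_mono)
      then show "AE y in lborel. norm ((shape y)\<^sup>2) \<le> norm (h * shape y)" using h shape_nonneg by (auto simp: abs_mult)
    qed auto
    have g2: "integrable lborel (\<lambda>y. (g y)\<^sup>2)"
    proof (rule integrableI_bounded)
      have "(\<integral>\<^sup>+y. ennreal (norm ((g y)\<^sup>2)) \<partial>lborel) \<le> (\<integral>\<^sup>+y. 2 * ennreal ((g y)\<^sup>2 / 2 + cz z \<bar>shape y\<bar>) \<partial>lborel)"
      proof (rule nn_integral_mono)
        fix y
        have "ennreal ((g y)\<^sup>2) \<le> ennreal (2 * ((g y)\<^sup>2 / 2 + cz z \<bar>shape y\<bar>))"
          using cz_nonneg[of "\<bar>shape y\<bar>"] by (intro ennreal_leI) auto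
        also have "\<dots> = 2 * ennreal ((g y)\<^sup>2 / 2 + cz z \<bar>shape y\<bar>)" by (subst ennreal_mult') auto
        finally show "ennreal (norm ((g y)\<^sup>2)) \<le> 2 * ennreal ((g y)\<^sup>2 / 2 + cz z \<bar>shape y\<bar>)"
          by simp
      qed
      also have "\<dots> = 2 * energy (cz z) shape" unfolding energy_eq[OF wd] cz_eq by (rule nn_integral_cmult) measurable
      also have "\<dots> < \<infinity>" using le_less_trans[OF en ennreal_less_top] by (simp add: ennreal_mult_less_top)
      finally show "(\<integral>\<^sup>+y. ennreal (norm ((g y)\<^sup>2)) \<partial>lborel) < \<infinity>" .
    qed auto
    show "H1 shape" unfolding H1_def using s2 g2 wd by auto
  qed
  then show ?thesis using en by blast
qed

end

section \<open>Choice of the multiplier\<close>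

context cost_rate
begin

text \<open>The quotient equals \<open>sqrt (s / (2 * (z s - \<mu>)))\<close>, and replacing
  \<open>s\<close> by \<open>h\<close> and \<open>z s\<close> by its lower bound \<open>z h\<close>
  only increases it.\<close>

lemma mass_density_bound:
  assumes \<mu>: "\<mu> < z h" and s: "0 < s" "s < h"
  shows "s / slope z \<mu> s \<le> sqrt (h / (2 * (z h - \<mu>)))"
proof -
  have zs: "z h \<le> z s" using z_noninc[of s h] s by auto
  have "s / slope z \<mu> s = sqrt (s / (2 * (z s - \<mu>)))"
  proof (rule real_sqrt_unique[symmetric])
    have "(slope z \<mu> s)\<^sup>2 = 2 * s * (z s - \<mu>)" using zs \<mu> s by (intro slope_square) auto
    then show "(s / slope z \<mu> s)\<^sup>2 = s / (2 * (z s - \<mu>))"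
      using s by (simp add: power_divide power2_eq_square)
    show "0 \<le> s / slope z \<mu> s" using slope_nonneg[of s \<mu>] zs \<mu> s by auto
  qed
  also have "\<dots> \<le> sqrt (h / (2 * (z h - \<mu>)))" using zs \<mu> s by (intro real_sqrt_le_mono frac_le) auto
  finally show ?thesis .
qed

text \<open>The mass of one flank without plateau: the layer between levels s and s + ds is weighted
  by a width element ds / slope, which contributes s ds / slope.\<close>

definition mass :: "real \<Rightarrow> real \<Rightarrow> real" where
  "mass h \<mu> = (LINT s|lborel. s / slope z \<mu> s * indicator {0<..<h} s)"

lemma mass_density_nonneg: "\<mu> \<le> z h \<Longrightarrow> 0 \<le> s / slope z \<mu> s * indicator {0<..<h} s"
  using slope_nonneg[of s \<mu>] z_noninc[of s h] by (auto simp: indicator_def)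

lemma mass_integrable:
  assumes \<mu>: "\<mu> < z h" and h: "0 < h"
  shows "integrable lborel (\<lambda>s. s / slope z \<mu> s * indicator {0<..<h} s)"
proof (rule Bochner_Integration.integrable_bound)
  show "integrable lborel (\<lambda>s. sqrt (h / (2 * (z h - \<mu>))) * indicator {0<..<h} s)"
    using h by (intro integrable_mult_right integrable_real_indicator) auto
  have "norm (s / slope z \<mu> s * indicator {0<..<h} s) \<le> norm (sqrt (h / (2 * (z h - \<mu>))) * indicator {0<..<h} s)" for s
    using mass_density_bound[OF \<mu>, of s] mass_density_nonneg[of \<mu> h s] \<mu>
    by (cases "s \<in> {0<..<h}") auto
  then show "AE s in lborel. norm (s / slope z \<mu> s * indicator {0<..<h} s) \<le> norm (sqrt (h / (2 * (z h - \<mu>))) * indicator {0<..<h} s)"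
    by auto
qed auto

lemma mass_nn_integral:
  assumes \<mu>: "\<mu> < z h" and h: "0 < h"
  shows "(\<integral>\<^sup>+s\<in>{0<..<h}. ennreal (s / slope z \<mu> s) \<partial>lborel) = ennreal (mass h \<mu>)"
proof -
  have "(\<integral>\<^sup>+s\<in>{0<..<h}. ennreal (s / slope z \<mu> s) \<partial>lborel) = (\<integral>\<^sup>+s. ennreal (s / slope z \<mu> s * indicator {0<..<h} s) \<partial>lborel)"
    by (intro nn_integral_cong) (auto simp: indicator_def)
  also have "\<dots> = ennreal (mass h \<mu>)"
    unfolding mass_def using mass_density_nonneg[of \<mu> h] \<mu>
    by (intro nn_integral_eq_integral mass_integrable assms) auto
  finally show ?thesis .
qed

lemma mass_le:
  assumes \<mu>: "\<mu> < z h" and h: "0 < h"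
  shows "mass h \<mu> \<le> h * sqrt (h / (2 * (z h - \<mu>)))"
proof -
  have "mass h \<mu> \<le> (LINT s|lborel. sqrt (h / (2 * (z h - \<mu>))) * indicator {0<..<h} s)"
    unfolding mass_def
  proof (rule integral_mono)
    show "integrable lborel (\<lambda>s. sqrt (h / (2 * (z h - \<mu>))) * indicator {0<..<h} s)"
      using h by (intro integrable_mult_right integrable_real_indicator) auto
    show "s / slope z \<mu> s * indicator {0<..<h} s \<le> sqrt (h / (2 * (z h - \<mu>))) * indicator {0<..<h} s" for s
      using mass_density_bound[OF \<mu>, of s] by (auto simp: indicator_def)
  qed (rule mass_integrable[OF assms])
  then show ?thesis using h by (simp add: mult.commute)
qed

text \<open>Dominated convergence with the density bound taken at the right end \<open>b\<close>.
  That bound blows up as \<open>b\<close> approaches \<open>z h\<close>, so the end point itself is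
  left to Fatou's lemma.\<close>

lemma mass_continuous:
  assumes h: "0 < h" and b: "b < z h"
  shows "continuous_on {a..b} (mass h)"
  unfolding continuous_on_sequentially comp_def
proof (intro allI ballI impI, elim conjE)
  fix x \<mu> assume \<mu>: "\<mu> \<in> {a..b}" and x: "\<forall>n. x n \<in> {a..b}" "x \<longlonglongrightarrow> \<mu>"
  show "(\<lambda>n. mass h (x n)) \<longlonglongrightarrow> mass h \<mu>"
    unfolding mass_def
  proof (rule integral_dominated_convergence[where w="\<lambda>s. sqrt (h / (2 * (z h - b))) * indicator {0<..<h} s"])
    show "integrable lborel (\<lambda>s. sqrt (h / (2 * (z h - b))) * indicator {0<..<h} s)"
      using h by (intro integrable_mult_right integrable_real_indicator) auto
    show "AE s in lborel. (\<lambda>n. s / slope z (x n) s * indicator {0<..<h} s) \<longlonglongrightarrow> s / slope z \<mu> s * indicator {0<..<h} s"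
    proof (rule AE_I2)
      fix s
      show "(\<lambda>n. s / slope z (x n) s * indicator {0<..<h} s) \<longlonglongrightarrow> s / slope z \<mu> s * indicator {0<..<h} s"
      proof (cases "s \<in> {0<..<h}")
        case True
        then have "\<mu> < z s" using \<mu> b z_noninc[of s h] by auto
        then have "slope z \<mu> s \<noteq> 0" using slope_pos[of s \<mu>] True by auto
        then show ?thesis using x(2) unfolding slope_def
          by (intro tendsto_intros) auto
      qed simp
    qed
    fix n
    have "x n \<le> b" using x(1) by auto
    then have xn: "x n < z h" "x n \<le> b" using b by auto
    have "norm (s / slope z (x n) s * indicator {0<..<h} s) \<le> sqrt (h / (2 * (z h - b))) * indicator {0<..<h} s" for s
    proof (cases "s \<in> {0<..<h}")
      case True
      then have "s / slope z (x n) s \<le> sqrt (h / (2 * (z h - x n)))" using mass_density_bound[OF xn(1)] by auto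
      also have "\<dots> \<le> sqrt (h / (2 * (z h - b)))" using xn b h by (intro real_sqrt_le_mono frac_le) auto
      finally show ?thesis using mass_density_nonneg[of "x n" h s] xn True by auto
    qed simp
    then show "AE s in lborel. norm (s / slope z (x n) s * indicator {0<..<h} s) \<le> sqrt (h / (2 * (z h - b))) * indicator {0<..<h} s"
      by auto
  qed auto
qed

text \<open>The mass increases continuously with the multiplier. If it stays below \<open>w / 2\<close> up to
  the largest admissible multiplier \<open>z h\<close>, the missing mass goes into a plateau at height \<open>h\<close>.\<close>

lemma multiplier_exists:
  assumes h: "0 < h" and w: "0 < w"
  obtains \<mu> p m where "z h - 2 * h ^ 3 / w\<^sup>2 \<le> \<mu>" "\<mu> \<le> z h" "0 \<le> p" "p = 0 \<or> \<mu> = z h"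
    "\<forall>s\<in>{0<..<h}. \<mu> < z s"
    "(\<integral>\<^sup>+s\<in>{0<..<h}. ennreal (s / slope z \<mu> s) \<partial>lborel) = ennreal m" "0 \<le> m" "2 * m + 2 * h * p = w"
proof -
  \<comment> \<open>The solution of \<open>h * sqrt (h / (2 * e)) = w / 2\<close>: by
    \<open>mass_le\<close> the multiplier \<open>z h - e\<close> gives total mass at most
    \<open>w\<close>, the lower end of the intermediate value argument.\<close>
  define e where "e = 2 * h ^ 3 / w\<^sup>2"
  have e: "0 < e" unfolding e_def using h w by simp
  have low: "2 * mass h (z h - e) \<le> w"
  proof -
    have "h / (2 * (z h - (z h - e))) = (w / (2 * h))\<^sup>2"
      unfolding e_def using h w by (simp add: field_simps power2_eq_square power3_eq_cube)
    then have "h * sqrt (h / (2 * (z h - (z h - e)))) = w / 2" using h w by simp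
    then show ?thesis using mass_le[of "z h - e" h] e h by simp
  qed
  show thesis
  proof (cases "\<exists>\<nu>. z h - e < \<nu> \<and> \<nu> < z h \<and> w \<le> 2 * mass h \<nu>")
    case True
    then obtain \<nu> where \<nu>: "z h - e < \<nu>" "\<nu> < z h" "w \<le> 2 * mass h \<nu>" by blast
    have "\<exists>\<mu>\<ge>z h - e. \<mu> \<le> \<nu> \<and> mass h \<mu> = w / 2"
      by (rule IVT') (use \<nu> low mass_continuous[OF h \<nu>(2)] in auto)
    then obtain \<mu> where \<mu>: "z h - e \<le> \<mu>" "\<mu> \<le> \<nu>" "mass h \<mu> = w / 2" by blast
    have lt: "\<mu> < z h" using \<mu> \<nu> by simp
    show thesis
    proof (rule that[of \<mu> 0 "w / 2"])
      show "\<forall>s\<in>{0<..<h}. \<mu> < z s"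
      proof
        fix s assume "s \<in> {0<..<h}"
        then show "\<mu> < z s" using lt z_noninc[of s h] by auto
      qed
      show "(\<integral>\<^sup>+s\<in>{0<..<h}. ennreal (s / slope z \<mu> s) \<partial>lborel) = ennreal (w / 2)"
        using mass_nn_integral[OF lt h] \<mu> by simp
    qed (use \<mu> lt w in \<open>auto simp: e_def\<close>)
  next
    case False
    then have small: "2 * mass h \<nu> < w" if "z h - e < \<nu>" "\<nu> < z h" for \<nu> using that by (auto simp: not_le)
    have strict: "z h < z s" if s: "0 < s" "s < h" for s
    proof (rule ccontr)
      assume "\<not> z h < z s"
      then have zs: "z t = z h" if "s \<le> t" "t < h" for t
        using z_noninc[of s t] z_noninc[of t h] s that by auto
      \<comment> \<open>\<epsilon> solves
        \<open>(h - s) * sqrt (s / (2 * \<epsilon>)) = w / 2\<close>. As \<open>z\<close> is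
        constant between \<open>s\<close> and \<open>h\<close>, these levels alone would give a
        flank mass of at least \<open>w / 2\<close> at multiplier \<open>z h - \<epsilon>\<close>,
        against \<open>small\<close>, which applies because \<open>\<epsilon> < e\<close>.\<close>
      define \<epsilon> where "\<epsilon> = 2 * s * (h - s)\<^sup>2 / w\<^sup>2"
      have \<epsilon>: "0 < \<epsilon>" unfolding \<epsilon>_def using s w by simp
      have "s * (h - s)\<^sup>2 < h * h\<^sup>2" using s by (intro mult_strict_mono power_strict_mono) auto
      then have "\<epsilon> < e" unfolding \<epsilon>_def e_def using w by (simp add: divide_strict_right_mono power2_eq_square power3_eq_cube)
      then have "2 * mass h (z h - \<epsilon>) < w" using \<epsilon> by (intro small) auto
      moreover have "(h - s) * sqrt (s / (2 * \<epsilon>)) \<le> mass h (z h - \<epsilon>)"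
      proof -
        have "(h - s) * sqrt (s / (2 * \<epsilon>)) = (LINT t|lborel. sqrt (s / (2 * \<epsilon>)) * indicator {s<..<h} t)"
          using s by simp
        also have "\<dots> \<le> mass h (z h - \<epsilon>)"
          unfolding mass_def
        proof (rule integral_mono)
          show "integrable lborel (\<lambda>t. sqrt (s / (2 * \<epsilon>)) * indicator {s<..<h} t)"
            using s by (intro integrable_mult_right integrable_real_indicator) auto
          show "integrable lborel (\<lambda>t. t / slope z (z h - \<epsilon>) t * indicator {0<..<h} t)"
            using \<epsilon> h by (intro mass_integrable) auto
          fix t
          show "sqrt (s / (2 * \<epsilon>)) * indicator {s<..<h} t \<le> t / slope z (z h - \<epsilon>) t * indicator {0<..<h} t"
          proof (cases "t \<in> {s<..<h}")
            case True
            then have "slope z (z h - \<epsilon>) t = sqrt (2 * t * \<epsilon>)" using zs[of t] by (simp add: slope_def)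
            moreover have "t / sqrt (2 * t * \<epsilon>) = sqrt (t / (2 * \<epsilon>))"
              using True s \<epsilon> by (intro real_sqrt_unique[symmetric]) (auto simp: power_divide power2_eq_square)
            moreover have "sqrt (s / (2 * \<epsilon>)) \<le> sqrt (t / (2 * \<epsilon>))"
              using True \<epsilon> by (intro real_sqrt_le_mono divide_right_mono) auto
            ultimately show ?thesis using True s by simp
          next
            case False
            then show ?thesis using mass_density_nonneg[of "z h - \<epsilon>" h t] \<epsilon> by simp
          qed
        qed
        finally show ?thesis .
      qed
      moreover have "(h - s) * sqrt (s / (2 * \<epsilon>)) = w / 2"
      proof -
        define d where "d = h - s"
        have d: "0 < d" using s by (simp add: d_def)
        have "s / (2 * \<epsilon>) = (w / (2 * d))\<^sup>2"
          unfolding \<epsilon>_def d_def[symmetric] using s w d by (simp add: field_simps power2_eq_square)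
        then show ?thesis unfolding d_def[symmetric] using d w by simp
      qed
      ultimately show False by simp
    qed
    \<comment> \<open>At \<open>\<mu> = z h\<close> the density can be unbounded near
      \<open>h\<close>, so Fatou's lemma takes the place of dominated convergence;
      \<open>strict\<close> provides the pointwise limit.\<close>
    have "(\<integral>\<^sup>+s\<in>{0<..<h}. ennreal (s / slope z (z h) s) \<partial>lborel) \<le> ennreal (w / 2)"
    proof -
      \<comment> \<open>\<open>Suc (Suc n)\<close> keeps even the first term strictly above
        \<open>z h - e\<close>, as \<open>small\<close> requires.\<close>
      define \<nu> where "\<nu> n = z h - e / real (Suc (Suc n))" for n
      have \<nu>: "z h - e < \<nu> n" "\<nu> n < z h" for n
        unfolding \<nu>_def using e by (auto simp: field_simps add_pos_nonneg)
      have "(\<lambda>n. e / real (Suc (Suc n))) \<longlonglongrightarrow> 0"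
        using LIMSEQ_Suc[OF LIMSEQ_Suc[OF lim_const_over_n[of e]]] .
      then have \<nu>_lim: "\<nu> \<longlonglongrightarrow> z h" unfolding \<nu>_def using tendsto_diff[OF tendsto_const[of "z h"]] by fastforce
      let ?f = "\<lambda>\<mu> s. ennreal (s / slope z \<mu> s) * indicator {0<..<h} s"
      have "(\<integral>\<^sup>+s. ?f (z h) s \<partial>lborel) = (\<integral>\<^sup>+s. liminf (\<lambda>n. ?f (\<nu> n) s) \<partial>lborel)"
      proof (rule nn_integral_cong)
        fix s
        have "(\<lambda>n. ?f (\<nu> n) s) \<longlonglongrightarrow> ?f (z h) s"
        proof (cases "s \<in> {0<..<h}")
          case True
          then have "slope z (z h) s \<noteq> 0" using slope_pos[of s "z h"] strict by auto
          then have "(\<lambda>n. s / slope z (\<nu> n) s) \<longlonglongrightarrow> s / slope z (z h) s"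
            using \<nu>_lim unfolding slope_def by (intro tendsto_intros) auto
          then show ?thesis using True by (simp add: tendsto_ennrealI)
        qed simp
        then show "?f (z h) s = liminf (\<lambda>n. ?f (\<nu> n) s)" by (rule lim_imp_Liminf[OF sequentially_bot, symmetric])
      qed
      also have "\<dots> \<le> liminf (\<lambda>n. \<integral>\<^sup>+s. ?f (\<nu> n) s \<partial>lborel)" by (rule nn_integral_liminf) auto
      also have "\<dots> \<le> liminf (\<lambda>n::nat. ennreal (w / 2))"
      proof (rule Liminf_mono, rule always_eventually, rule allI)
        fix n
        show "(\<integral>\<^sup>+s. ?f (\<nu> n) s \<partial>lborel) \<le> ennreal (w / 2)"
          unfolding mass_nn_integral[OF \<nu>(2) h] using small[OF \<nu>, of n] by (intro ennreal_leI) simp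
      qed
      also have "\<dots> = ennreal (w / 2)" by (simp add: Liminf_const)
      finally show ?thesis .
    qed
    then obtain m where m: "(\<integral>\<^sup>+s\<in>{0<..<h}. ennreal (s / slope z (z h) s) \<partial>lborel) = ennreal m" "0 \<le> m" "m \<le> w / 2"
      using w by (cases "\<integral>\<^sup>+s\<in>{0<..<h}. ennreal (s / slope z (z h) s) \<partial>lborel") (auto simp: top_unique)
    show thesis
    proof (rule that[of "z h" "(w - 2 * m) / (2 * h)" m])
      show "z h - 2 * h ^ 3 / w\<^sup>2 \<le> z h" using e by (simp add: e_def)
    qed (use m strict h in \<open>auto simp: field_simps\<close>)
  qed
qed

section \<open>From a height to upper bounds and profiles\<close>

lemma tau_le_if_bell_profile:
  assumes "bell_profile w \<psi>" shows "tau z w \<le> energy (cz z) \<psi>"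
  unfolding tau_def using assms by (intro INF_lower) (auto simp: bell_profile_def)

text \<open>The explicit lower bound on \<mu> is recorded so that \<open>J\<close> can be estimated
  as \<open>h\<close> tends to 0.\<close>

lemma upper_bound:
  assumes h: "0 < h" and w: "0 < w"
  obtains \<mu> J where "z h - 2 * h ^ 3 / w\<^sup>2 \<le> \<mu>" "\<mu> \<le> z h" "0 \<le> J"
    "(\<integral>\<^sup>+t\<in>{0<..<h}. ennreal (slope z \<mu> t) \<partial>lborel) = ennreal J"
    "tau z w \<le> ennreal (\<mu> * w + 2 * J)"
proof -
  obtain \<mu> p m where *: "z h - 2 * h ^ 3 / w\<^sup>2 \<le> \<mu>" "\<mu> \<le> z h" "0 \<le> p" "p = 0 \<or> \<mu> = z h"
    "\<forall>s\<in>{0<..<h}. \<mu> < z s"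
    "(\<integral>\<^sup>+s\<in>{0<..<h}. ennreal (s / slope z \<mu> s) \<partial>lborel) = ennreal m" "0 \<le> m" "2 * m + 2 * h * p = w"
    using multiplier_exists[OF h w] .
  have pos: "\<mu> < z s" if "0 < s" "s < h" for s using *(5) that by auto
  obtain J where J: "(\<integral>\<^sup>+t\<in>{0<..<h}. ennreal (slope z \<mu> t) \<partial>lborel) = ennreal J" "0 \<le> J"
    using slope_integral_finite[OF h *(2)] by (metis ennreal_cases infinity_ennreal_def less_irrefl)
  have "\<exists>\<psi>. bell_profile w \<psi> \<and> energy (cz z) \<psi> \<le> ennreal (\<mu> * w + 2 * J)"
    by (rule profile_energy[OF h *(3,2) pos *(4,6,7,8)]) (use J in \<open>auto simp: ennreal_mult\<close>)
  then obtain \<psi> where "bell_profile w \<psi>" "energy (cz z) \<psi> \<le> ennreal (\<mu> * w + 2 * J)" by blast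
  then have "tau z w \<le> ennreal (\<mu> * w + 2 * J)" using tau_le_if_bell_profile order_trans by blast
  then show thesis using that[OF *(1,2) J(2,1)] by blast
qed

text \<open>The multiplier selected for height \<open>h\<close> may equal \<open>z h\<close>, and
  its integral runs up to \<open>h\<close>, whereas the dual bounds stop short of both.
  Approximation from below closes both gaps because \<open>slope\<close> decreases in \<mu>. A
  height satisfying the dual bounds is thus realized by a profile within the budget
  \<open>T\<close>.\<close>

lemma bell_profile_if_dual_bound:
  assumes h: "0 < h" and w: "0 < w"
    and T: "\<And>\<mu>. \<mu> < z h \<Longrightarrow> \<mu> * w \<le> T"
    and dual: "\<And>\<mu> s. \<mu> < z h \<Longrightarrow> s < h \<Longrightarrow>
      2 * (\<integral>\<^sup>+t\<in>{0<..<s}. ennreal (slope z \<mu> t) \<partial>lborel) \<le> ennreal (T - \<mu> * w)"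
  shows "\<exists>\<psi>. bell_profile w \<psi> \<and> energy (cz z) \<psi> \<le> ennreal T"
proof -
  obtain \<mu> p m where *: "z h - 2 * h ^ 3 / w\<^sup>2 \<le> \<mu>" "\<mu> \<le> z h" "0 \<le> p" "p = 0 \<or> \<mu> = z h"
    "\<forall>s\<in>{0<..<h}. \<mu> < z s"
    "(\<integral>\<^sup>+s\<in>{0<..<h}. ennreal (s / slope z \<mu> s) \<partial>lborel) = ennreal m" "0 \<le> m" "2 * m + 2 * h * p = w"
    using multiplier_exists[OF h w] .
  have pos: "\<mu> < z s" if "0 < s" "s < h" for s using *(5) that by auto
  have muT: "\<mu> * w \<le> T"
  proof (rule field_le_epsilon)
    fix e :: real assume "0 < e"
    then have "(\<mu> - e / w) * w \<le> T" using * w by (intro T) (simp add: less_le_trans[of _ \<mu>])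
    moreover have "(\<mu> - e / w) * w = \<mu> * w - e" using w by (simp add: left_diff_distrib)
    ultimately show "\<mu> * w \<le> T + e" by simp
  qed
  show ?thesis
  proof (rule profile_energy[OF h *(3,2) pos *(4,6,7,8) _ muT])
    have "(\<integral>\<^sup>+t\<in>{0<..<h}. 2 * ennreal (slope z \<mu> t) \<partial>lborel) \<le> ennreal (T - \<mu> * w)"
    proof (rule nn_integral_Ioo_le)
      fix c d :: real assume cd: "0 < c" "d < h"
      show "(\<integral>\<^sup>+t\<in>{c<..<d}. 2 * ennreal (slope z \<mu> t) \<partial>lborel) \<le> ennreal (T - \<mu> * w)"
      proof (rule ennreal_le_epsilon)
        fix e :: real assume e: "0 < e"
        \<comment> \<open>Lowering the multiplier by \<open>e / w\<close> raises the right-hand side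
          by exactly \<open>e\<close>.\<close>
        define \<nu> where "\<nu> = \<mu> - e / w"
        have \<nu>: "\<nu> < \<mu>" unfolding \<nu>_def using e w by simp
        have "(\<integral>\<^sup>+t\<in>{c<..<d}. 2 * ennreal (slope z \<mu> t) \<partial>lborel) \<le> (\<integral>\<^sup>+t\<in>{0<..<d}. 2 * ennreal (slope z \<nu> t) \<partial>lborel)"
        proof (rule nn_integral_mono)
          fix t
          show "2 * ennreal (slope z \<mu> t) * indicator {c<..<d} t \<le> 2 * ennreal (slope z \<nu> t) * indicator {0<..<d} t"
            using cd \<nu> by (cases "t \<in> {c<..<d}") (auto intro!: mult_left_mono ennreal_leI slope_antimono)
        qed
        also have "\<dots> = 2 * (\<integral>\<^sup>+t\<in>{0<..<d}. ennreal (slope z \<nu> t) \<partial>lborel)"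
          by (simp add: nn_integral_cmult mult.assoc)
        also have "\<dots> \<le> ennreal (T - \<nu> * w)" using \<nu> * cd by (intro dual) auto
        also have "T - \<nu> * w = (T - \<mu> * w) + e" unfolding \<nu>_def using w by (simp add: field_simps)
        also have "ennreal ((T - \<mu> * w) + e) = ennreal (T - \<mu> * w) + ennreal e" using muT e by simp
        finally show "(\<integral>\<^sup>+t\<in>{c<..<d}. 2 * ennreal (slope z \<mu> t) \<partial>lborel) \<le> ennreal (T - \<mu> * w) + ennreal e" .
      qed
    qed auto
    then show "2 * (\<integral>\<^sup>+t\<in>{0<..<h}. ennreal (slope z \<mu> t) \<partial>lborel) \<le> ennreal (T - \<mu> * w)"
      by (simp add: nn_integral_cmult mult.assoc)
  qed
qed

end

section \<open>Existence of a minimizer\<close>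

context cost_rate
begin

section \<open>Small masses and the right derivative of \<open>tau\<close>\<close>

lemma tau_finite: assumes "0 < w" shows "tau z w < \<infinity>"
proof -
  obtain \<mu> J where "tau z w \<le> ennreal (\<mu> * w + 2 * J)" using upper_bound[OF zero_less_one assms] by blast
  then show ?thesis using ennreal_less_top le_less_trans by (metis infinity_ennreal_def)
qed

text \<open>Low and wide profiles are tested: as the height tends to 0, the excess of their energy
  over \<open>Z * w\<close> disappears.\<close>

lemma tau_le_linear:
  assumes Z: "\<And>h. 0 < h \<Longrightarrow> z h \<le> Z" and w: "0 < w"
  shows "tau z w \<le> ennreal (Z * w)"
proof -
  \<comment> \<open>\<open>B h\<close> bounds the integral of \<open>slope\<close> up to level
    \<open>h\<close>: length times a uniform bound, in which \<open>- \<mu>\<close> is at most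
    \<open>2 * h ^ 3 / w\<^sup>2\<close> by the choice of the multiplier.\<close>
  define B where "B h = h * sqrt (2 * h * (Z + 2 * h ^ 3 / w\<^sup>2))" for h
  have Z0: "0 \<le> Z" using Z[of 1] z_nonneg[of 1] by simp
  have le: "tau z w \<le> ennreal (Z * w + 2 * B h)" if h: "0 < h" for h
  proof -
    obtain \<mu> J where *: "z h - 2 * h ^ 3 / w\<^sup>2 \<le> \<mu>" "\<mu> \<le> z h" "0 \<le> J"
      "(\<integral>\<^sup>+t\<in>{0<..<h}. ennreal (slope z \<mu> t) \<partial>lborel) = ennreal J" "tau z w \<le> ennreal (\<mu> * w + 2 * J)"
      using upper_bound[OF h w] .
    have mu: "- \<mu> \<le> 2 * h ^ 3 / w\<^sup>2" using *(1) z_nonneg[OF h] by linarith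
    define S where "S = sqrt (2 * h * (Z + 2 * h ^ 3 / w\<^sup>2))"
    have "ennreal J \<le> (\<integral>\<^sup>+t. ennreal S * indicator {0<..<h} t \<partial>lborel)"
      unfolding *(4)[symmetric]
    proof (rule nn_integral_mono)
      fix t
      have "slope z \<mu> t \<le> S" if t: "0 < t" "t < h"
      proof -
        have "0 \<le> z t - \<mu>" using z_noninc[of t h] t *(2) by simp
        moreover have "z t - \<mu> \<le> Z + 2 * h ^ 3 / w\<^sup>2" using Z[OF t(1)] mu by simp
        ultimately show ?thesis unfolding slope_def S_def using t
          by (intro real_sqrt_le_mono mult_mono) auto
      qed
      then show "ennreal (slope z \<mu> t) * indicator {0<..<h} t \<le> ennreal S * indicator {0<..<h} t"
        by (cases "t \<in> {0<..<h}") (auto intro!: ennreal_leI)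
    qed
    also have "\<dots> = ennreal S * ennreal h" using h by (simp add: nn_integral_cmult)
    also have "\<dots> = ennreal (B h)"
      using h unfolding B_def S_def[symmetric] by (simp add: ennreal_mult''[symmetric] mult.commute)
    finally have "J \<le> B h"
      by (subst (asm) ennreal_le_iff) (use h Z0 in \<open>auto simp: B_def\<close>)
    moreover have "\<mu> * w \<le> Z * w" using *(2) Z[OF h] w by (intro mult_right_mono) auto
    ultimately show ?thesis using *(5) by (elim order_trans) (intro ennreal_leI, linarith)
  qed
  have "((\<lambda>h. ennreal (Z * w + 2 * B h)) \<longlongrightarrow> ennreal (Z * w + 2 * (0 * sqrt (2 * 0 * (Z + 2 * 0 ^ 3 / w\<^sup>2))))) (at_right 0)"
    unfolding B_def using w by (intro tendsto_intros) auto
  then have "((\<lambda>h. ennreal (Z * w + 2 * B h)) \<longlongrightarrow> ennreal (Z * w)) (at_right 0)" by simp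
  then show ?thesis
    by (rule tendsto_lowerbound) (use le in \<open>auto simp: eventually_at_right_field intro: exI[of _ 1]\<close>)
qed

text \<open>The cubic bound forces a competitor with energy at most \<open>K * v\<close> to a height
  below \<open>h\<close>, where \<open>z\<close> exceeds \<open>K\<close>; but its energy is at
  least \<open>z\<close> at its height times the mass.\<close>

lemma tau_ge_linear_small:
  assumes h: "0 < h" and K: "0 < K" "K < z h" and v: "0 < v" "32 * v * (K * v) < h ^ 3"
  shows "ennreal (K * v) \<le> tau z v"
  unfolding tau_def
proof (rule INF_greatest, rule ccontr)
  fix \<psi> assume \<psi>: "\<psi> \<in> {\<psi>. (\<forall>y. 0 \<le> \<psi> y) \<and> integrable lborel \<psi> \<and> (LINT y|lborel. \<psi> y) = v}"
    and "\<not> ennreal (K * v) \<le> energy (cz z) \<psi>"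
  then have "energy (cz z) \<psi> \<le> ennreal (K * v)" by simp
  then show False
  proof (rule lower_bound[rotated 4])
    show "\<And>y. 0 \<le> \<psi> y" "integrable lborel \<psi>" "(LINT y|lborel. \<psi> y) = v" "0 < v" "0 < K * v"
      using \<psi> K v by auto
    fix h' assume h': "h' > 0" "h' ^ 3 \<le> 32 * v * (K * v)" "z h' * v \<le> K * v"
    have "h' < h" using h'(2) v(2) h power_less_imp_less_base[of h' 3 h] by simp
    then have "z h \<le> z h'" using z_noninc[of h' h] h' by simp
    moreover have "z h' \<le> K" using h'(3) v by simp
    ultimately show False using K by simp
  qed
qed

text \<open>If no level qualifies, \<open>z\<close> is bounded, and for its supremum Z the two
  linear bounds pin down both \<open>tau z w\<close> as Z w and the right derivative as Z, a
  contradiction. Arguing this way, an unbounded \<open>z\<close>, with infinite right derivative,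
  requires no case of its own.\<close>

lemma ex_level_above_tau:
  assumes D: "((\<lambda>v. tau z v / ennreal v) \<longlongrightarrow> D) (at_right 0)" and w: "0 < w"
    and ne: "tau z w \<noteq> D * ennreal w"
  shows "\<exists>h>0. tau z w < ennreal (z h * w)"
proof (rule ccontr)
  assume "\<not> ?thesis"
  then have le: "ennreal (z h * w) \<le> tau z w" if "0 < h" for h using that not_less by blast
  obtain T where T: "tau z w = ennreal T" "0 \<le> T"
    using tau_finite[OF w] by (metis ennreal_cases infinity_ennreal_def less_irrefl)
  have zT: "z h \<le> T / w" if "0 < h" for h
    using le[OF that] T w by (simp add: ennreal_le_iff field_simps)
  define Z where "Z = Sup (z ` {0<..})"
  have bdd: "bdd_above (z ` {0<..})" using zT by (auto intro!: bdd_aboveI[of _ "T / w"])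
  have zZ: "z h \<le> Z" if "0 < h" for h unfolding Z_def using that bdd by (intro cSup_upper) auto
  have "Z \<le> T / w" unfolding Z_def using zT by (intro cSup_least) (auto intro: exI[of _ 1])
  then have "ennreal (Z * w) \<le> tau z w" unfolding T(1) using w by (intro ennreal_leI) (simp add: field_simps)
  then have tau_w: "tau z w = ennreal (Z * w)" using tau_le_linear[OF zZ w] by simp
  have Z0: "0 \<le> Z" using zZ[of 1] z_nonneg[of 1] by simp
  have up: "tau z v / ennreal v \<le> ennreal Z" if v: "0 < v" for v
  proof -
    have "tau z v / ennreal v \<le> ennreal (Z * v) / ennreal v"
      by (rule divide_right_mono_ennreal[OF tau_le_linear[OF zZ v]])
    also have "\<dots> = ennreal Z" using v Z0 by (simp add: divide_ennreal)
    finally show ?thesis .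
  qed
  have "((\<lambda>v. tau z v / ennreal v) \<longlongrightarrow> ennreal Z) (at_right 0)"
  proof (rule order_tendstoI)
    fix a assume "ennreal Z < a"
    then have "tau z v / ennreal v < a" if "0 < v" for v using up[OF that] by simp
    then show "\<forall>\<^sub>F v in at_right 0. tau z v / ennreal v < a"
      by (auto simp: eventually_at_right_field intro: exI[of _ 1])
  next
    fix a assume a: "a < ennreal Z"
    then obtain a' where a': "a = ennreal a'" "0 \<le> a'" by (cases a) auto
    then have "a' < Z" using a by (simp add: ennreal_less_iff)
    define K where "K = (a' + Z) / 2"
    have K: "a' < K" "K < Z" "0 < K" unfolding K_def using \<open>a' < Z\<close> a' by auto
    then obtain h where h: "0 < h" "K < z h"
      unfolding Z_def using less_cSup_iff[OF _ bdd, of K] by auto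
    have "((\<lambda>v. 32 * v * (K * v)) \<longlongrightarrow> 32 * 0 * (K * 0)) (at_right 0)" by (intro tendsto_intros)
    then have "\<forall>\<^sub>F v in at_right 0. 32 * v * (K * v) < h ^ 3"
      by (rule order_tendstoD) (use h in simp)
    moreover have "\<forall>\<^sub>F v in at_right 0. (0::real) < v" by (rule eventually_at_right_less)
    ultimately show "\<forall>\<^sub>F v in at_right 0. a < tau z v / ennreal v"
    proof eventually_elim
      case (elim v)
      have "a < ennreal K" unfolding a' using K a' by (simp add: ennreal_less_iff)
      also have "\<dots> = ennreal (K * v) / ennreal v" using K elim by (simp add: divide_ennreal)
      also have "\<dots> \<le> tau z v / ennreal v"
        by (intro divide_right_mono_ennreal tau_ge_linear_small[OF h(1) K(3) h(2)] elim)
      finally show ?case .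
    qed
  qed
  then have "D = ennreal Z" using D by (intro tendsto_unique[OF _ D]) auto
  then have "D * ennreal w = tau z w" unfolding tau_w using Z0 w by (simp add: ennreal_mult')
  then show False using ne by simp
qed

section \<open>Convergence of heights and the minimizer\<close>

lemma minimizer_exists:
  assumes w: "0 < w" and h0: "0 < h0" "tau z w < ennreal (z h0 * w)"
  shows "\<exists>\<psi>. bell_profile w \<psi> \<and> energy (cz z) \<psi> = tau z w"
proof -
  obtain T where T: "tau z w = ennreal T" "0 \<le> T"
    using tau_finite[OF w] by (metis ennreal_cases infinity_ennreal_def less_irrefl)
  \<comment> \<open>Strictly above the infimum, so that competitors exist, and positive even for
    \<open>T = 0\<close>, as \<open>lower_bound\<close> demands.\<close>
  define E where "E n = T + inverse (real (Suc n))" for n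
  have E0: "0 < E n" for n unfolding E_def using T by (simp add: add_nonneg_pos)
  define P where "P n h \<longleftrightarrow> h > 0 \<and> h ^ 3 \<le> 32 * w * E n \<and> z h * w \<le> E n \<and>
    (\<forall>\<mu> s. \<mu> < z h \<longrightarrow> s < h \<longrightarrow>
      2 * (\<integral>\<^sup>+t\<in>{0<..<s}. ennreal (slope z \<mu> t) \<partial>lborel) \<le> ennreal (E n - \<mu> * w))" for n h
  have "\<exists>h. P n h" for n
  proof -
    have "tau z w < ennreal (E n)" unfolding T E_def using T by (simp add: ennreal_less_iff)
    then obtain \<psi> where \<psi>: "\<forall>y. 0 \<le> \<psi> y" "integrable lborel \<psi>" "(LINT y|lborel. \<psi> y) = w"
      "energy (cz z) \<psi> < ennreal (E n)"
      unfolding tau_def INF_less_iff by blast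
    show ?thesis
      by (rule lower_bound[of \<psi> w "E n"]) (use \<psi> w E0 in \<open>auto simp: P_def\<close>)
  qed
  then obtain H where H: "\<And>n. P n (H n)" by metis
  have zh0: "T < z h0 * w" using h0(2) T by (simp add: ennreal_less_iff)
  obtain N where N: "inverse (real (Suc N)) < z h0 * w - T"
    using reals_Archimedean[of "z h0 * w - T"] zh0 by auto
  have lowH: "h0 \<le> H n" if "N \<le> n" for n
  proof (rule ccontr)
    assume "\<not> h0 \<le> H n"
    then have "z h0 \<le> z (H n)" using H[of n] by (intro z_noninc) (auto simp: P_def)
    then have "z h0 * w \<le> z (H n) * w" using w by (intro mult_right_mono) auto
    also have "\<dots> \<le> E n" using H[of n] by (simp add: P_def)
    finally have "z h0 * w \<le> E n" .
    moreover have "inverse (real (Suc n)) \<le> inverse (real (Suc N))" using that by (intro le_imp_inverse_le) auto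
    ultimately show False using N unfolding E_def by linarith
  qed
  \<comment> \<open>Above 1 a number is at most its cube, which spares the cube root;
    \<open>T + 1\<close> bounds every \<open>E n\<close>.\<close>
  define K where "K = max 1 (32 * w * (T + 1))"
  have upH: "H n \<le> K" for n
  proof (cases "H n \<le> 1")
    case False
    have "H n \<le> H n ^ 3" using False self_le_power[of "H n" 3] by simp
    also have "\<dots> \<le> 32 * w * E n" using H[of n] by (simp add: P_def)
    also have "\<dots> \<le> 32 * w * (T + 1)"
    proof -
      have "inverse (real (Suc n)) \<le> 1" by (simp add: inverse_le_1_iff)
      then show ?thesis using w by (intro mult_left_mono) (auto simp: E_def)
    qed
    finally show ?thesis by (simp add: K_def)
  qed (simp add: K_def)
  have "\<forall>n. H (n + N) \<in> {h0..K}" using lowH upH by simp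
  then obtain l r where l: "l \<in> {h0..K}" and r: "strict_mono r" "((\<lambda>n. H (n + N)) \<circ> r) \<longlonglongrightarrow> l"
    using seq_compactE[OF compact_imp_seq_compact[OF compact_Icc]] by metis
  define \<rho> where "\<rho> n = r n + N" for n
  have \<rho>: "strict_mono \<rho>" using r(1) by (simp add: \<rho>_def strict_mono_def)
  have Hl: "(\<lambda>n. H (\<rho> n)) \<longlonglongrightarrow> l" using r(2) by (simp add: \<rho>_def comp_def)
  have El: "(\<lambda>n. E (\<rho> n)) \<longlonglongrightarrow> T"
    using tendsto_add[OF tendsto_const[of T] LIMSEQ_subseq_LIMSEQ[OF LIMSEQ_inverse_real_of_nat \<rho>]]
    by (simp add: E_def comp_def)
  have l0: "0 < l" using l h0 by auto
  \<comment> \<open>Lower semicontinuity makes a multiplier admissible at \<open>l\<close>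
    eventually admissible along the sequence. The filter at \<open>l\<close> is punctured, hence the
    separate case \<open>H (\<rho> n) = l\<close>.\<close>
  have ev: "\<forall>\<^sub>F n in sequentially. \<mu> < z (H (\<rho> n))" if \<mu>: "\<mu> < z l" for \<mu>
  proof -
    have "\<forall>\<^sub>F y in at l within {0<..}. \<mu> < z y" using z_lsc \<mu> l0 unfolding lsc_on_def by auto
    then obtain d where d: "d > 0" "\<And>y. 0 < y \<Longrightarrow> y \<noteq> l \<Longrightarrow> dist y l < d \<Longrightarrow> \<mu> < z y"
      unfolding eventually_at by auto
    have "\<forall>\<^sub>F n in sequentially. dist (H (\<rho> n)) l < d" using Hl d(1) by (rule tendstoD)
    then show ?thesis
    proof eventually_elim
      case (elim n)
      then show ?case using d(2)[of "H (\<rho> n)"] \<mu> H[of "\<rho> n"] by (cases "H (\<rho> n) = l") (auto simp: P_def)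
    qed
  qed
  have "\<exists>\<psi>. bell_profile w \<psi> \<and> energy (cz z) \<psi> \<le> ennreal T"
  proof (rule bell_profile_if_dual_bound[OF l0 w])
    fix \<mu> assume \<mu>: "\<mu> < z l"
    show "\<mu> * w \<le> T"
    proof (rule tendsto_lowerbound[OF El])
      show "\<forall>\<^sub>F n in sequentially. \<mu> * w \<le> E (\<rho> n)"
        using ev[OF \<mu>]
      proof eventually_elim
        case (elim n)
        then have "\<mu> * w \<le> z (H (\<rho> n)) * w" using w by (intro mult_right_mono) auto
        then show ?case using H[of "\<rho> n"] by (auto simp: P_def)
      qed
    qed simp
    fix s assume s: "s < l"
    \<comment> \<open>For fixed \<mu> and \<open>s\<close> the left-hand side of the dual bound is
      independent of \<open>n\<close>, so the limit concerns only
      \<open>E (\<rho> n)\<close>.\<close>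
    have "(\<lambda>n. ennreal (E (\<rho> n) - \<mu> * w)) \<longlonglongrightarrow> ennreal (T - \<mu> * w)"
      by (intro tendsto_ennrealI tendsto_diff El tendsto_const)
    then show "2 * (\<integral>\<^sup>+t\<in>{0<..<s}. ennreal (slope z \<mu> t) \<partial>lborel) \<le> ennreal (T - \<mu> * w)"
    proof (rule tendsto_lowerbound)
      have "\<forall>\<^sub>F n in sequentially. s < H (\<rho> n)" using order_tendstoD(1)[OF Hl s] .
      with ev[OF \<mu>] show "\<forall>\<^sub>F n in sequentially.
        2 * (\<integral>\<^sup>+t\<in>{0<..<s}. ennreal (slope z \<mu> t) \<partial>lborel) \<le> ennreal (E (\<rho> n) - \<mu> * w)"
        by eventually_elim (use H in \<open>auto simp: P_def\<close>)
    qed simp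
  qed
  then obtain \<psi> where "bell_profile w \<psi>" "energy (cz z) \<psi> \<le> tau z w" unfolding T(1) by blast
  then show ?thesis using tau_le_if_bell_profile[of w \<psi>] by (auto intro: antisym)
qed

end

text \<open>Since \<open>tau z 0 = 0\<close>, the quotient defining \<open>D\<close> is the
  difference quotient at 0. With \<open>D\<close> in \<open>ennreal\<close> an infinite right
  derivative is included; as \<open>tau z w\<close> is finite, the condition on \<open>w\<close>
  then holds for every positive \<open>w\<close>.\<close>

theorem mainTheorem9:
  fixes z :: "real \<Rightarrow> real" and w :: real and D :: ennreal
  assumes z_nonneg: "\<forall>x>0. 0 \<le> z x"
    and z_noninc: "\<forall>x y. 0 < x \<longrightarrow> x \<le> y \<longrightarrow> z y \<le> z x"
    and z_lsc: "lsc_on {0<..} z"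
    and sqrt_int: "(\<integral>\<^sup>+ phi\<in>{0..1}. ennreal (sqrt (cz z phi)) \<partial>lborel) < \<infinity>"
    and D: "((\<lambda>v. tau z v / ennreal v) \<longlongrightarrow> D) (at_right 0)"
    and w_pos: "0 < w"
    and w_ne: "tau z w \<noteq> D * ennreal w"
  shows "\<exists>psi. (\<forall>y. 0 \<le> psi y) \<and> integrable lborel psi \<and> (LINT y|lborel. psi y) = w
            \<and> energy (cz z) psi = tau z w
            \<and> H1 psi \<and> bounded (range psi) \<and> continuous_on UNIV psi
            \<and> (\<forall>y. psi (- y) = psi y)
            \<and> (\<forall>x y. 0 \<le> x \<longrightarrow> x \<le> y \<longrightarrow> psi y \<le> psi x)"
proof -
  \<comment> \<open>\<open>energy\<close> evaluates the cost only at
    \<open>\<bar>psi y\<bar>\<close>, and \<open>cz\<close> is 0 at 0 by definition, so this change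
    of \<open>z\<close> affects neither \<open>energy\<close> nor \<open>tau\<close>.\<close>
  define z' where "z' x = (if 0 < x then z x else 0)" for x
  have cz': "cz z' s = cz z s" if "0 \<le> s" for s using that by (auto simp: cz_def z'_def)
  have en': "energy (cz z') = energy (cz z)" by (rule ext) (simp add: energy_def cz')
  have tau': "tau z' = tau z" unfolding tau_def en' ..
  interpret cost_rate z'
  proof
    have "(\<integral>\<^sup>+ phi\<in>{0..1}. ennreal (sqrt (cz z' phi)) \<partial>lborel) = (\<integral>\<^sup>+ phi\<in>{0..1}. ennreal (sqrt (cz z phi)) \<partial>lborel)"
      by (intro nn_integral_cong) (auto simp: indicator_def cz')
    then show "(\<integral>\<^sup>+ phi\<in>{0..1}. ennreal (sqrt (cz z' phi)) \<partial>lborel) < \<infinity>" using sqrt_int by simp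
    show "lsc_on {0<..} z'"
      unfolding lsc_on_def
    proof (intro ballI allI impI)
      fix x a assume x: "x \<in> {0<..}" and "a < z' x"
      then have "\<forall>\<^sub>F y in at x within {0<..}. a < z y" using z_lsc unfolding lsc_on_def z'_def by auto
      then show "\<forall>\<^sub>F y in at x within {0<..}. a < z' y"
        unfolding eventually_at_filter by eventually_elim (auto simp: z'_def)
    qed
  qed (use z_nonneg z_noninc in \<open>auto simp: z'_def\<close>)
  obtain h where "0 < h" "tau z' w < ennreal (z' h * w)"
    using ex_level_above_tau[of D w] D w_pos w_ne unfolding tau' by blast
  then obtain \<psi> where "bell_profile w \<psi>" "energy (cz z') \<psi> = tau z' w"
    using minimizer_exists[OF w_pos] by blast
  then show ?thesis unfolding bell_profile_def en' tau' by blast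
qed

end
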